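(* Let $(\phi,\xi,\eta,g)$ be a contact metric structure on $M^{2n+1}$, and $h=\tfrac12L_\xi\phi$. Then $$\delta h=\phi\,\nabla^*\nabla\xi-T(\phi).$$ The first harmonic section equation $\tau(\xi)+\tfrac12J\,T(\phi)=0$ is equivalent to $$\tau(\xi)=\phi\,\delta h.$$ If the structure is $H$-contact, then the first harmonic section equation is verified if and only if $h$ is co-closed (i.e. $\delta h=0$); in particular, the first harmonic section equation is always verified for a $K$-contact structure.
   Context: An almost contact metric structure on a Riemannian manifold $(M^{2n+1},g)$, $g=\langle\,,\rangle$, consists of a $(1,1)$-tensor $\phi$, a unit vector field $\xi$ and its dual $1$-form $\eta=g(\xi,\cdot)$, with $\phi^2=-I+\eta\otimes\xi$ and $g(\phi X,\phi Y)=g(X,Y)-\eta(X)\eta(Y)$. It is a contact metric structure if $d\eta=\Phi$, where $\Phi(X,Y)=g(X,\phi Y)$ and $d\eta(X,Y)=\tfrac12\big(X\eta(Y)-Y\eta(X)-\eta([X,Y])\big)$. Everything is smooth. $\nabla$ is the Levi-Civita connection; $\mathcal{D}=\operatorname{im}\phi=\ker\eta$; $J=\phi|_{\mathcal D}$; $\bar\nabla$ is the connection in $\mathcal{D}\to M$ given by $\bar\nabla_XY=(\nabla_XY)_{\mathcal D}$ (orthogonal projection), $X\in TM$, $Y$ a section of $\mathcal D$. $\nabla^2_{X,Y}=\nabla_X\nabla_Y-\nabla_{\nabla_XY}$. For a local orthonormal frame $(E_i)$ of $TM$ (sums over repeated indices): $\nabla^*\nabla\xi=-\nabla^2_{E_i,E_i}\xi$,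 $$\tau(\xi)=\nabla^*\nabla\xi-|\nabla\xi|^2\xi,\qquad T(\phi)=(\bar\nabla_{E_i}J)\big(\nabla_{E_i}\xi\big),$$ (note that $\nabla_X\xi\in\mathcal D$). Also $L_\xi$ is the Lie derivative and $\delta h=-(\nabla_{E_i}h)(E_i)$. A contact metric structure is $H$-contact if $\xi$ is a harmonic unit vector field, i.e. $\tau(\xi)=0$; it is $K$-contact if $h=0$ (equivalently $\xi$ is Killing). *)

theory Defs
  imports "HOL-Analysis.Analysis" "HOL-Library.Function_Algebras" "HOL-Library.FuncSet"
begin

text \<open>Tangent vectors are derivations, i.e. functions on functions; their vector space
  operations are the pointwise ones.\<close>

instantiation "fun" :: (type, real_vector) real_vector
begin

definition scaleR_fun :: "real \<Rightarrow> ('a \<Rightarrow> 'b) \<Rightarrow> 'a \<Rightarrow> 'b"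
  where "scaleR_fun r f = (\<lambda>x. r *\<^sub>R f x)"

instance
  by standard (simp_all add: scaleR_fun_def fun_eq_iff scaleR_add_right scaleR_add_left)

end

text \<open>\<open>Ck_on k S f\<close> is meant for open \<open>S\<close>: all iterated directional derivatives of \<open>f\<close> up to order
  \<open>k\<close> exist and are continuous on \<open>S\<close>, those of order below \<open>k\<close> being (totally) differentiable.\<close>

primrec Ck_on :: "nat \<Rightarrow> 'b::real_normed_vector set \<Rightarrow> ('b \<Rightarrow> 'c::real_normed_vector) \<Rightarrow> bool" where
  "Ck_on 0 S f \<longleftrightarrow> continuous_on S f"
| "Ck_on (Suc k) S f \<longleftrightarrow>
     (\<forall>x\<in>S. f differentiable (at x)) \<and> (\<forall>v. Ck_on k S (\<lambda>x. frechet_derivative f (at x) v))"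

definition Cinf_on :: "'b::real_normed_vector set \<Rightarrow> ('b \<Rightarrow> 'c::real_normed_vector) \<Rightarrow> bool" where
  "Cinf_on S f \<longleftrightarrow> (\<forall>k. Ck_on k S f)"

text \<open>The underlying set of the manifold is the whole type \<open>'a\<close>; Hausdorff and second countable are
  the sort constraints on \<open>'a\<close>. A chart is a pair of its domain and its coordinate map into a
  Euclidean space \<open>'b\<close>; the values of the map outside the domain are irrelevant.\<close>

type_synonym ('a, 'b) atlas = "('a set \<times> ('a \<Rightarrow> 'b)) set"

definition smooth_manifold ::
    "('a::{t2_space, second_countable_topology}, 'b::euclidean_space) atlas \<Rightarrow> bool" where
  "smooth_manifold A \<longleftrightarrow>
     (\<Union>(U, c)\<in>A. U) = UNIV \<and>
     (\<forall>(U, c)\<in>A. open U \<and> open (c ` U) \<and> homeomorphism U (c ` U) c (inv_into U c)) \<and>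
     (\<forall>(U, c)\<in>A. \<forall>(V, d)\<in>A. Cinf_on (c ` (U \<inter> V)) (d \<circ> inv_into U c))"

definition smooth_fun_on ::
    "('a::topological_space, 'b::euclidean_space) atlas \<Rightarrow> 'a set \<Rightarrow> ('a \<Rightarrow> real) \<Rightarrow> bool" where
  "smooth_fun_on A U f \<longleftrightarrow>
     open U \<and> (\<forall>(V, c)\<in>A. Cinf_on (c ` (U \<inter> V)) (f \<circ> inv_into V c))"

definition smooth_fun_near ::
    "('a::topological_space, 'b::euclidean_space) atlas \<Rightarrow> 'a \<Rightarrow> ('a \<Rightarrow> real) \<Rightarrow> bool" where
  "smooth_fun_near A p f \<longleftrightarrow> (\<exists>U. p \<in> U \<and> smooth_fun_on A U f)"

type_synonym 'a tvec = "('a \<Rightarrow> real) \<Rightarrow> real"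

text \<open>The derivations at \<open>p\<close> of the functions that are smooth near \<open>p\<close>. That they depend on germs
  only is automatic, because indicator functions of neighbourhoods of \<open>p\<close> are smooth near \<open>p\<close>.
  The value \<open>0\<close> on functions not smooth near \<open>p\<close> makes the representation unique.\<close>

definition tangent_space ::
    "('a::topological_space, 'b::euclidean_space) atlas \<Rightarrow> 'a \<Rightarrow> 'a tvec set" where
  "tangent_space A p = {v.
     (\<forall>f. \<not> smooth_fun_near A p f \<longrightarrow> v f = 0) \<and>
     (\<forall>f g. smooth_fun_near A p f \<longrightarrow> smooth_fun_near A p g \<longrightarrow>
        v (\<lambda>q. f q + g q) = v f + v g) \<and>
     (\<forall>a f. smooth_fun_near A p f \<longrightarrow> v (\<lambda>q. a * f q) = a * v f) \<and>
     (\<forall>f g. smooth_fun_near A p f \<longrightarrow> smooth_fun_near A p g \<longrightarrow>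
        v (\<lambda>q. f q * g q) = f p * v g + g p * v f)}"

type_synonym 'a vfield = "'a \<Rightarrow> 'a tvec"

definition smooth_vfield_on ::
    "('a::topological_space, 'b::euclidean_space) atlas \<Rightarrow> 'a set \<Rightarrow> 'a vfield \<Rightarrow> bool" where
  "smooth_vfield_on A U X \<longleftrightarrow>
     open U \<and> (\<forall>p\<in>U. X p \<in> tangent_space A p) \<and>
     (\<forall>V f. V \<subseteq> U \<longrightarrow> smooth_fun_on A V f \<longrightarrow> smooth_fun_on A V (\<lambda>p. X p f))"

definition smooth_vfield_near ::
    "('a::topological_space, 'b::euclidean_space) atlas \<Rightarrow> 'a \<Rightarrow> 'a vfield \<Rightarrow> bool" where
  "smooth_vfield_near A p X \<longleftrightarrow> (\<exists>U. p \<in> U \<and> smooth_vfield_on A U X)"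

definition lie_bracket ::
    "('a::topological_space, 'b::euclidean_space) atlas \<Rightarrow> 'a vfield \<Rightarrow> 'a vfield \<Rightarrow> 'a vfield" where
  "lie_bracket A X Y p = (\<lambda>f.
     if smooth_fun_near A p f then X p (\<lambda>q. Y q f) - Y p (\<lambda>q. X q f) else 0)"

type_synonym 'a endo_field = "'a \<Rightarrow> 'a tvec \<Rightarrow> 'a tvec"

definition smooth_endo_field ::
    "('a::topological_space, 'b::euclidean_space) atlas \<Rightarrow> 'a endo_field \<Rightarrow> bool" where
  "smooth_endo_field A \<phi> \<longleftrightarrow>
     (\<forall>p. \<forall>v\<in>tangent_space A p. \<phi> p v \<in> tangent_space A p) \<and>
     (\<forall>p a b. \<forall>v\<in>tangent_space A p. \<forall>w\<in>tangent_space A p.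
        \<phi> p (a *\<^sub>R v + b *\<^sub>R w) = a *\<^sub>R \<phi> p v + b *\<^sub>R \<phi> p w) \<and>
     (\<forall>U X. smooth_vfield_on A U X \<longrightarrow> smooth_vfield_on A U (\<lambda>p. \<phi> p (X p)))"

text \<open>\<open>(L\<^sub>\<xi> \<phi>)(X) = [\<xi>, \<phi> X] - \<phi> [\<xi>, X]\<close> is tensorial in \<open>X\<close>; its value on a tangent vector \<open>v\<close> is
  computed with a smooth local extension \<open>X\<close> of \<open>v\<close>, on whose choice it does not depend.\<close>

definition lie_derivative_endo ::
    "('a::topological_space, 'b::euclidean_space) atlas \<Rightarrow> 'a vfield \<Rightarrow> 'a endo_field
     \<Rightarrow> 'a endo_field" where
  "lie_derivative_endo A \<xi> \<phi> p v =
     (let X = (SOME X. smooth_vfield_near A p X \<and> X p = v)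
      in lie_bracket A \<xi> (\<lambda>q. \<phi> q (X q)) p - \<phi> p (lie_bracket A \<xi> X p))"

type_synonym 'a metric = "'a \<Rightarrow> 'a tvec \<Rightarrow> 'a tvec \<Rightarrow> real"

definition riemannian_metric ::
    "('a::topological_space, 'b::euclidean_space) atlas \<Rightarrow> 'a metric \<Rightarrow> bool" where
  "riemannian_metric A g \<longleftrightarrow>
     (\<forall>p a b. \<forall>u\<in>tangent_space A p. \<forall>v\<in>tangent_space A p. \<forall>w\<in>tangent_space A p.
        g p (a *\<^sub>R u + b *\<^sub>R v) w = a * g p u w + b * g p v w) \<and>
     (\<forall>p. \<forall>v\<in>tangent_space A p. \<forall>w\<in>tangent_space A p. g p v w = g p w v) \<and>
     (\<forall>p. \<forall>v\<in>tangent_space A p. v \<noteq> 0 \<longrightarrow> g p v v > 0) \<and>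
     (\<forall>U X Y. smooth_vfield_on A U X \<longrightarrow> smooth_vfield_on A U Y \<longrightarrow>
        smooth_fun_on A U (\<lambda>p. g p (X p) (Y p)))"

text \<open>\<open>nabla p v Y\<close> is the covariant derivative of \<open>Y\<close> in the direction \<open>v\<close>, for \<open>v\<close> tangent at \<open>p\<close>
  and \<open>Y\<close> a vector field that is smooth near \<open>p\<close>.
  Dependence on the germ of \<open>Y\<close> only follows from the Leibniz rule, applied to indicator functions.\<close>

type_synonym 'a connection = "'a \<Rightarrow> 'a tvec \<Rightarrow> 'a vfield \<Rightarrow> 'a tvec"

definition affine_connection ::
    "('a::topological_space, 'b::euclidean_space) atlas \<Rightarrow> 'a connection \<Rightarrow> bool" where
  "affine_connection A nabla \<longleftrightarrow>
     (\<forall>p Y. \<forall>v\<in>tangent_space A p. smooth_vfield_near A p Y \<longrightarrow> nabla p v Y \<in> tangent_space A p) \<and>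
     (\<forall>p Y a b. \<forall>v\<in>tangent_space A p. \<forall>w\<in>tangent_space A p. smooth_vfield_near A p Y \<longrightarrow>
        nabla p (a *\<^sub>R v + b *\<^sub>R w) Y = a *\<^sub>R nabla p v Y + b *\<^sub>R nabla p w Y) \<and>
     (\<forall>p Y Z. \<forall>v\<in>tangent_space A p. smooth_vfield_near A p Y \<longrightarrow> smooth_vfield_near A p Z \<longrightarrow>
        nabla p v (\<lambda>q. Y q + Z q) = nabla p v Y + nabla p v Z) \<and>
     (\<forall>p f Y. \<forall>v\<in>tangent_space A p. smooth_fun_near A p f \<longrightarrow> smooth_vfield_near A p Y \<longrightarrow>
        nabla p v (\<lambda>q. f q *\<^sub>R Y q) = v f *\<^sub>R Y p + f p *\<^sub>R nabla p v Y) \<and>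
     (\<forall>U X Y. smooth_vfield_on A U X \<longrightarrow> smooth_vfield_on A U Y \<longrightarrow>
        smooth_vfield_on A U (\<lambda>p. nabla p (X p) Y))"

definition levi_civita ::
    "('a::topological_space, 'b::euclidean_space) atlas \<Rightarrow> 'a metric \<Rightarrow> 'a connection \<Rightarrow> bool" where
  "levi_civita A g nabla \<longleftrightarrow>
     affine_connection A nabla \<and>
     (\<forall>p X Y. smooth_vfield_near A p X \<longrightarrow> smooth_vfield_near A p Y \<longrightarrow>
        nabla p (X p) Y - nabla p (Y p) X = lie_bracket A X Y p) \<and>
     (\<forall>p Y Z. \<forall>v\<in>tangent_space A p. smooth_vfield_near A p Y \<longrightarrow> smooth_vfield_near A p Z \<longrightarrow>
        v (\<lambda>q. g q (Y q) (Z q)) = g p (nabla p v Y) (Z p) + g p (Y p) (nabla p v Z))"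

definition local_orthonormal_frame ::
    "('a::topological_space, 'b::euclidean_space) atlas \<Rightarrow> 'a metric \<Rightarrow> 'a \<Rightarrow> (nat \<Rightarrow> 'a vfield) \<Rightarrow> bool"
  where
  "local_orthonormal_frame A g p E \<longleftrightarrow> (\<exists>U. p \<in> U \<and> open U \<and>
     (\<forall>i<DIM('b). smooth_vfield_on A U (E i)) \<and>
     (\<forall>q\<in>U. tangent_space A q = span ((\<lambda>i. E i q) ` {..<DIM('b)})) \<and>
     (\<forall>q\<in>U. \<forall>i<DIM('b). \<forall>j<DIM('b). g q (E i q) (E j q) = (if i = j then 1 else 0)))"

text \<open>The traces below are taken at \<open>p\<close> over one chosen local orthonormal frame around \<open>p\<close>; they do
  not depend on it, since the expressions summed are tensorial in the two frame arguments.\<close>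

definition onframe ::
    "('a::topological_space, 'b::euclidean_space) atlas \<Rightarrow> 'a metric \<Rightarrow> 'a \<Rightarrow> nat \<Rightarrow> 'a vfield" where
  "onframe A g p = (SOME E. local_orthonormal_frame A g p E)"

definition second_cov_deriv :: "'a connection \<Rightarrow> 'a vfield \<Rightarrow> 'a vfield \<Rightarrow> 'a vfield \<Rightarrow> 'a vfield" where
  "second_cov_deriv nabla X Y Z p =
     nabla p (X p) (\<lambda>q. nabla q (Y q) Z) - nabla p (nabla p (X p) Y) Z"

definition rough_laplacian ::
    "('a::topological_space, 'b::euclidean_space) atlas \<Rightarrow> 'a metric \<Rightarrow> 'a connection \<Rightarrow> 'a vfield
     \<Rightarrow> 'a vfield" where
  "rough_laplacian A g nabla Z p =
     - (\<Sum>i<DIM('b). second_cov_deriv nabla (onframe A g p i) (onframe A g p i) Z p)"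

definition grad_norm_sq ::
    "('a::topological_space, 'b::euclidean_space) atlas \<Rightarrow> 'a metric \<Rightarrow> 'a connection \<Rightarrow> 'a vfield
     \<Rightarrow> 'a \<Rightarrow> real" where
  "grad_norm_sq A g nabla Z p =
     (\<Sum>i<DIM('b). let w = nabla p (onframe A g p i p) Z in g p w w)"

definition tension ::
    "('a::topological_space, 'b::euclidean_space) atlas \<Rightarrow> 'a metric \<Rightarrow> 'a connection \<Rightarrow> 'a vfield
     \<Rightarrow> 'a vfield" where
  "tension A g nabla \<xi> p = rough_laplacian A g nabla \<xi> p - grad_norm_sq A g nabla \<xi> p *\<^sub>R \<xi> p"

definition cov_deriv_endo :: "'a connection \<Rightarrow> 'a endo_field \<Rightarrow> 'a vfield \<Rightarrow> 'a vfield \<Rightarrow> 'a vfield" where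
  "cov_deriv_endo nabla h X Y p = nabla p (X p) (\<lambda>q. h q (Y q)) - h p (nabla p (X p) Y)"

definition codiff_endo ::
    "('a::topological_space, 'b::euclidean_space) atlas \<Rightarrow> 'a metric \<Rightarrow> 'a connection \<Rightarrow> 'a endo_field
     \<Rightarrow> 'a vfield" where
  "codiff_endo A g nabla h p =
     - (\<Sum>i<DIM('b). cov_deriv_endo nabla h (onframe A g p i) (onframe A g p i) p)"

definition eta :: "'a metric \<Rightarrow> 'a vfield \<Rightarrow> 'a \<Rightarrow> 'a tvec \<Rightarrow> real" where
  "eta g \<xi> p v = g p (\<xi> p) v"

definition almost_contact_metric ::
    "('a::topological_space, 'b::euclidean_space) atlas \<Rightarrow> 'a metric \<Rightarrow> 'a endo_field \<Rightarrow> 'a vfield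
     \<Rightarrow> bool" where
  "almost_contact_metric A g \<phi> \<xi> \<longleftrightarrow>
     smooth_endo_field A \<phi> \<and> smooth_vfield_on A UNIV \<xi> \<and>
     (\<forall>p. g p (\<xi> p) (\<xi> p) = 1) \<and>
     (\<forall>p. \<forall>v\<in>tangent_space A p. \<phi> p (\<phi> p v) = - v + eta g \<xi> p v *\<^sub>R \<xi> p) \<and>
     (\<forall>p. \<forall>v\<in>tangent_space A p. \<forall>w\<in>tangent_space A p.
        g p (\<phi> p v) (\<phi> p w) = g p v w - eta g \<xi> p v * eta g \<xi> p w)"

definition d_one_form ::
    "('a::topological_space, 'b::euclidean_space) atlas \<Rightarrow> ('a \<Rightarrow> 'a tvec \<Rightarrow> real) \<Rightarrow> 'a vfield
     \<Rightarrow> 'a vfield \<Rightarrow> 'a \<Rightarrow> real" where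
  "d_one_form A \<omega> X Y p =
     1/2 * (X p (\<lambda>q. \<omega> q (Y q)) - Y p (\<lambda>q. \<omega> q (X q)) - \<omega> p (lie_bracket A X Y p))"

definition contact_metric ::
    "('a::topological_space, 'b::euclidean_space) atlas \<Rightarrow> 'a metric \<Rightarrow> 'a endo_field \<Rightarrow> 'a vfield
     \<Rightarrow> bool" where
  "contact_metric A g \<phi> \<xi> \<longleftrightarrow>
     almost_contact_metric A g \<phi> \<xi> \<and>
     (\<forall>p X Y. smooth_vfield_near A p X \<longrightarrow> smooth_vfield_near A p Y \<longrightarrow>
        d_one_form A (eta g \<xi>) X Y p = g p (X p) (\<phi> p (Y p)))"

definition contact_distribution ::
    "('a::topological_space, 'b::euclidean_space) atlas \<Rightarrow> 'a endo_field \<Rightarrow> 'a \<Rightarrow> 'a tvec set" where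
  "contact_distribution A \<phi> p = \<phi> p ` tangent_space A p"

definition J_of ::
    "('a::topological_space, 'b::euclidean_space) atlas \<Rightarrow> 'a endo_field \<Rightarrow> 'a endo_field" where
  "J_of A \<phi> p = restrict (\<phi> p) (contact_distribution A \<phi> p)"

definition orth_proj :: "'a metric \<Rightarrow> 'a \<Rightarrow> 'a tvec set \<Rightarrow> 'a tvec \<Rightarrow> 'a tvec" where
  "orth_proj g p S v = (THE w. w \<in> S \<and> (\<forall>u\<in>S. g p (v - w) u = 0))"

definition nabla_bar ::
    "('a::topological_space, 'b::euclidean_space) atlas \<Rightarrow> 'a metric \<Rightarrow> 'a connection \<Rightarrow> 'a endo_field
     \<Rightarrow> 'a connection" where
  "nabla_bar A g nabla \<phi> p v Y = orth_proj g p (contact_distribution A \<phi> p) (nabla p v Y)"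

definition T_phi ::
    "('a::topological_space, 'b::euclidean_space) atlas \<Rightarrow> 'a metric \<Rightarrow> 'a connection \<Rightarrow> 'a endo_field
     \<Rightarrow> 'a vfield \<Rightarrow> 'a vfield" where
  "T_phi A g nabla \<phi> \<xi> p =
     (\<Sum>i<DIM('b). cov_deriv_endo (nabla_bar A g nabla \<phi>) (J_of A \<phi>)
        (onframe A g p i) (\<lambda>q. nabla q (onframe A g p i q) \<xi>) p)"

definition h_tensor ::
    "('a::topological_space, 'b::euclidean_space) atlas \<Rightarrow> 'a endo_field \<Rightarrow> 'a vfield \<Rightarrow> 'a endo_field"
  where
  "h_tensor A \<phi> \<xi> p v = (1/2) *\<^sub>R lie_derivative_endo A \<xi> \<phi> p v"

definition H_contact ::
    "('a::topological_space, 'b::euclidean_space) atlas \<Rightarrow> 'a metric \<Rightarrow> 'a connection \<Rightarrow> 'a endo_field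
     \<Rightarrow> 'a vfield \<Rightarrow> bool" where
  "H_contact A g nabla \<phi> \<xi> \<longleftrightarrow> contact_metric A g \<phi> \<xi> \<and> (\<forall>p. tension A g nabla \<xi> p = 0)"

definition K_contact ::
    "('a::topological_space, 'b::euclidean_space) atlas \<Rightarrow> 'a metric \<Rightarrow> 'a endo_field \<Rightarrow> 'a vfield
     \<Rightarrow> bool" where
  "K_contact A g \<phi> \<xi> \<longleftrightarrow>
     contact_metric A g \<phi> \<xi> \<and> (\<forall>p. \<forall>v\<in>tangent_space A p. h_tensor A \<phi> \<xi> p v = 0)"

definition first_harmonic_section_eq ::
    "('a::topological_space, 'b::euclidean_space) atlas \<Rightarrow> 'a metric \<Rightarrow> 'a connection \<Rightarrow> 'a endo_field
     \<Rightarrow> 'a vfield \<Rightarrow> bool" where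
  "first_harmonic_section_eq A g nabla \<phi> \<xi> \<longleftrightarrow>
     (\<forall>p. tension A g nabla \<xi> p + (1/2) *\<^sub>R J_of A \<phi> p (T_phi A g nabla \<phi> \<xi> p) = 0)"

end

theory Submission
  imports Defs
begin

text \<open>
Write \<open>\<nabla>\<xi> = S - \<phi>\<close>: the contact condition says that the skew part of \<open>\<nabla>\<xi>\<close> is \<open>- \<phi>\<close>. Since
\<open>\<Phi> = d\<eta>\<close> is closed, the cyclic sum of \<open>g((\<nabla>\<^sub>X \<phi>)Y, Z)\<close> vanishes. Putting \<open>\<xi>\<close> into this sum gives
\<open>\<nabla>\<^sub>\<xi> \<phi> = - (S \<phi> + \<phi> S)\<close>, and differentiating \<open>\<phi>\<^sup>2 = - I + \<eta> \<otimes> \<xi>\<close> along \<open>\<xi>\<close> turns this into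
\<open>S \<phi> + \<phi> S = 0\<close>. Hence \<open>\<nabla>\<^sub>\<xi> \<phi> = 0\<close>, \<open>h = \<phi> S = \<phi> \<nabla>\<xi> - I + \<eta> \<otimes> \<xi>\<close> and \<open>tr \<nabla>\<xi> = 0\<close>. Taking the
divergence of this formula for \<open>h\<close> gives \<open>\<delta>h = \<phi> \<nabla>\<^sup>*\<nabla>\<xi> - \<Sum> (\<nabla>\<^sub>E \<phi>)(\<nabla>\<^sub>E \<xi>)\<close>, and the last sum is
\<open>T(\<phi>)\<close>, because its terms are orthogonal to \<open>\<xi>\<close>. Moreover \<open>\<tau>(\<xi>) = - \<phi>\<^sup>2 \<nabla>\<^sup>*\<nabla>\<xi>\<close>, so that
\<open>\<phi> \<delta>h = - \<tau>(\<xi>) - J T(\<phi>)\<close>. In the K-contact case \<open>\<nabla>\<xi> = - \<phi>\<close>, and \<open>\<nabla>\<^sup>*\<nabla>\<xi>\<close> is the divergence of \<open>\<phi>\<close>;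
taking traces in the cyclic identity shows that it is a multiple of \<open>\<xi>\<close>, whence \<open>\<tau>(\<xi>) = 0\<close>.

Working with derivations and with a frame picked by choice requires the coordinate fields to span
the tangent spaces (Hadamard's lemma) and orthonormal frames to exist locally (Gram-Schmidt).
\<close>

section \<open>Iterated derivatives\<close>

text \<open>Functions that agree near \<open>x\<close> have the same derivatives there, so the
  choice in \<open>frechet_derivative\<close> has the same candidates on both sides, also when there
  are none.\<close>

lemma frechet_derivative_cong_open:
  assumes "open S" "x \<in> S" "\<And>y. y \<in> S \<Longrightarrow> f y = g y"
  shows "frechet_derivative f (at x) = frechet_derivative g (at x)"
proof -
  have "(f has_derivative D) (at x) \<longleftrightarrow> (g has_derivative D) (at x)" for D
    using assms has_derivative_transform_within_open[of f D x UNIV S g]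
      has_derivative_transform_within_open[of g D x UNIV S f] by auto
  then show ?thesis unfolding frechet_derivative_def by simp
qed

lemma differentiable_cong_open:
  assumes "open S" "x \<in> S" "\<And>y. y \<in> S \<Longrightarrow> f y = g y" "f differentiable (at x)"
  shows "g differentiable (at x)"
  using assms has_derivative_transform_within_open[of f _ x UNIV S g]
  unfolding differentiable_def by auto

lemma Ck_on_cong:
  assumes "Ck_on k S f" "open S" "\<And>x. x \<in> S \<Longrightarrow> f x = g x"
  shows "Ck_on k S g"
  using assms
proof (induction k arbitrary: f g)
  case 0
  then show ?case using continuous_on_cong[of S S f g] by simp
next
  case (Suc k)
  have "Ck_on k S (\<lambda>x. frechet_derivative f (at x) v)" for v
    using Suc.prems(1) by simp
  then have "Ck_on k S (\<lambda>x. frechet_derivative g (at x) v)" for v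
    by (rule Suc.IH) (use Suc.prems frechet_derivative_cong_open[of S _ f g] in auto)
  moreover have "g differentiable (at x)" if "x \<in> S" for x
    by (rule differentiable_cong_open[of S _ f]) (use that Suc.prems in auto)
  ultimately show ?case by simp
qed

lemma Ck_on_subset:
  assumes "Ck_on k S f" "T \<subseteq> S"
  shows "Ck_on k T f"
  using assms by (induction k arbitrary: f) (auto intro: continuous_on_subset)

text \<open>Order \<open>Suc k\<close> does not list continuity of \<open>f\<close> itself. It comes
  from differentiability in the base case; the induction then descends through the directional
  derivatives.\<close>

lemma Ck_on_Suc_imp:
  assumes "Ck_on (Suc k) S f"
  shows "Ck_on k S f"
  using assms
proof (induction k arbitrary: f)
  case 0
  then have "\<forall>x\<in>S. isCont f x" by (simp add: differentiable_imp_continuous_within)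
  then show ?case by (simp add: continuous_at_imp_continuous_on)
next
  case (Suc k)
  have "Ck_on (Suc k) S (\<lambda>x. frechet_derivative f (at x) v)" for v
    using Suc.prems unfolding Ck_on.simps(2)[of "Suc k"] by blast
  with Suc.IH have "Ck_on k S (\<lambda>x. frechet_derivative f (at x) v)" for v .
  moreover have "\<forall>x\<in>S. f differentiable (at x)"
    using Suc.prems unfolding Ck_on.simps(2)[of "Suc k"] by (rule conjunct1)
  ultimately show ?case unfolding Ck_on.simps(2)[of k] by (intro conjI allI)
qed

lemma Ck_on_has_derivative:
  assumes "Ck_on (Suc k) S f" "x \<in> S"
  shows "(f has_derivative frechet_derivative f (at x)) (at x)"
  using assms by (simp add: frechet_derivative_works)

text \<open>Lets an explicitly given derivative \<open>D\<close> stand in for the chosen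
  \<open>frechet_derivative\<close>.\<close>

lemma Ck_on_SucI:
  assumes "open S" "\<And>x. x \<in> S \<Longrightarrow> (f has_derivative D x) (at x)"
    and "\<And>v. Ck_on k S (\<lambda>x. D x v)"
  shows "Ck_on (Suc k) S f"
proof -
  have "Ck_on k S (\<lambda>x. frechet_derivative f (at x) v)" for v
    by (rule Ck_on_cong[OF assms(3)[of v] assms(1)]) (simp add: frechet_derivative_at[OF assms(2)])
  then show ?thesis using assms(2) by (auto simp: differentiable_def)
qed

lemma Ck_on_const: "open S \<Longrightarrow> Ck_on k S (\<lambda>x. c)"
proof (induction k arbitrary: c)
  case (Suc k)
  then show ?case by (intro Ck_on_SucI[where D = "\<lambda>_ _. 0"]) auto
qed simp

lemma Ck_on_bounded_linear_compose:
  assumes "bounded_linear L" "open S" "Ck_on k S f"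
  shows "Ck_on k S (\<lambda>x. L (f x))"
  using assms(3)
proof (induction k arbitrary: f)
  case 0
  then show ?case
    using bounded_linear.continuous_on[OF assms(1)] by auto
next
  case (Suc k)
  show ?case
    by (rule Ck_on_SucI[OF assms(2), where D = "\<lambda>x v. L (frechet_derivative f (at x) v)"])
      (use Suc in \<open>auto intro!: bounded_linear.has_derivative[OF assms(1)]
          simp flip: frechet_derivative_works\<close>)
qed

lemma Ck_on_add:
  assumes "open S" "Ck_on k S f" "Ck_on k S g"
  shows "Ck_on k S (\<lambda>x. f x + g x)"
  using assms(2,3)
proof (induction k arbitrary: f g)
  case 0
  then show ?case by (auto intro: continuous_on_add)
next
  case (Suc k)
  show ?case
    by (rule Ck_on_SucI[OF assms(1), where
          D = "\<lambda>x v. frechet_derivative f (at x) v + frechet_derivative g (at x) v"])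
      (use Suc in \<open>auto intro!: has_derivative_add simp flip: frechet_derivative_works\<close>)
qed

lemma Ck_on_sum:
  assumes "open S" "\<And>i. i \<in> I \<Longrightarrow> Ck_on k S (f i)"
  shows "Ck_on k S (\<lambda>x. \<Sum>i\<in>I. f i x)"
  using assms(2)
  by (induction I rule: infinite_finite_induct)
    (auto intro: Ck_on_add Ck_on_const simp: assms(1))

lemma Ck_on_scaleR:
  fixes f :: "'b::real_normed_vector \<Rightarrow> real"
  assumes "open S" "Ck_on k S f" "Ck_on k S g"
  shows "Ck_on k S (\<lambda>x. f x *\<^sub>R g x)"
  using assms(2,3)
proof (induction k arbitrary: f g)
  case 0
  then show ?case by (auto intro: continuous_on_scaleR)
next
  case (Suc k)
  show ?case
  proof (rule Ck_on_SucI[OF assms(1)])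
    show "((\<lambda>x. f x *\<^sub>R g x) has_derivative
        (\<lambda>v. f x *\<^sub>R frechet_derivative g (at x) v + frechet_derivative f (at x) v *\<^sub>R g x)) (at x)"
      if "x \<in> S" for x
      using that Suc.prems by (intro has_derivative_scaleR Ck_on_has_derivative)
    show "Ck_on k S (\<lambda>x. f x *\<^sub>R frechet_derivative g (at x) v
        + frechet_derivative f (at x) v *\<^sub>R g x)" for v
      \<comment> \<open>The induction hypothesis asks both factors for order \<open>k\<close>, so
        the undifferentiated one is lowered from \<open>Suc k\<close>.\<close>
      using Suc by (intro Ck_on_add[OF assms(1)] Suc.IH) (auto simp del: Ck_on.simps intro: Ck_on_Suc_imp, auto)
  qed
qed

lemma Ck_on_mult:
  fixes f g :: "'b::real_normed_vector \<Rightarrow> real"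
  assumes "open S" "Ck_on k S f" "Ck_on k S g"
  shows "Ck_on k S (\<lambda>x. f x * g x)"
  using Ck_on_scaleR[OF assms] by simp

text \<open>The chain rule differentiates \<open>f\<close> in the moving direction
  \<open>frechet_derivative u (at x) v\<close>, whereas the induction hypothesis covers fixed
  directions only. Expanding this vector in the basis gives a sum of products of a real function and
  a derivative of \<open>f\<close> in a fixed direction.\<close>

lemma Ck_on_compose:
  fixes f :: "'b::euclidean_space \<Rightarrow> 'c::real_normed_vector"
  assumes "open S" "open T" "u ` S \<subseteq> T" "Ck_on k T f" "Ck_on k S u"
  shows "Ck_on k S (\<lambda>x. f (u x))"
  using assms(4,5)
proof (induction k arbitrary: f)
  case 0
  then show ?case
    using continuous_on_compose2[of T f S u] assms(3) by simp
next
  case (Suc k)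
  let ?D = "\<lambda>x v. \<Sum>b\<in>Basis. (frechet_derivative u (at x) v \<bullet> b) *\<^sub>R frechet_derivative f (at (u x)) b"
  show ?case
  proof (rule Ck_on_SucI[OF assms(1)])
    show "((\<lambda>x. f (u x)) has_derivative ?D x) (at x)" if "x \<in> S" for x
    proof -
      have f: "(f has_derivative frechet_derivative f (at (u x))) (at (u x))"
        using that assms(3) by (intro Ck_on_has_derivative[OF Suc.prems(1)]) auto
      have "(\<lambda>v. frechet_derivative f (at (u x)) (frechet_derivative u (at x) v)) = ?D x"
        by (rule ext, subst euclidean_representation[symmetric])
          (simp only: linear_sum[OF has_derivative_linear[OF f]]
              linear_cmul[OF has_derivative_linear[OF f]])
      then show ?thesis
        using has_derivative_compose[OF Ck_on_has_derivative[OF Suc.prems(2) that] f] by simp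
    qed
    have "Ck_on k S (\<lambda>x. frechet_derivative u (at x) v \<bullet> b)" for v b
      using Suc.prems
      by (intro Ck_on_bounded_linear_compose[OF bounded_linear_inner_left assms(1)]) simp
    moreover have "Ck_on k S (\<lambda>x. frechet_derivative f (at (u x)) b)" for b
      using Suc.prems(1) Ck_on_Suc_imp[OF Suc.prems(2)]
      by (intro Suc.IH[of "\<lambda>x. frechet_derivative f (at x) b"]) simp_all
    ultimately show "Ck_on k S (\<lambda>x. ?D x v)" for v
      by (intro Ck_on_sum Ck_on_scaleR assms(1))
  qed
qed

lemma Ck_on_ident: "open S \<Longrightarrow> Ck_on k S (\<lambda>x. x)"
proof (cases k)
  case (Suc m)
  then show "open S \<Longrightarrow> ?thesis"
    by (auto intro!: Ck_on_SucI[where D = "\<lambda>_ v. v"] Ck_on_const simp del: Ck_on.simps)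
qed simp

text \<open>Differentiation lowers the exponent, so it is generalised in the induction. The exponent
  \<open>- 1 / 2\<close> normalises vectors in the Gram-Schmidt process.\<close>

lemma Ck_on_powr: "Ck_on k {0<..} (\<lambda>x::real. x powr a)"
proof (induction k arbitrary: a)
  case 0
  then show ?case by (auto intro!: continuous_intros)
next
  case (Suc k)
  show ?case
  proof (rule Ck_on_SucI)
    show "((\<lambda>x. x powr a) has_derivative (\<lambda>v. (a * x powr (a - 1)) * v)) (at x)"
      if "x \<in> {0<..}" for x :: real
      using that has_real_derivative_powr[of x a] by (simp add: has_field_derivative_def)
    show "Ck_on k {0<..} (\<lambda>x::real. a * x powr (a - 1) * v)" for v
      by (intro Ck_on_mult Ck_on_const Suc.IH) auto
  qed auto
qed

section \<open>Integrals along segments and Hadamard's lemma\<close>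

lemma Ck_on_segment_integral:
  fixes f :: "'b::euclidean_space \<Rightarrow> real"
  assumes "open S" "convex S" "z \<in> S" "Ck_on k S f"
  shows "Ck_on k S (\<lambda>x. integral {0..1} (\<lambda>t. t ^ m * f (z + t *\<^sub>R (x - z))))"
  using assms(4)
\<comment> \<open>Each differentiation under the integral sign produces a factor \<open>t\<close>,
  so the power \<open>m\<close> has to vary.\<close>
proof (induction k arbitrary: f m)
  let ?s = "\<lambda>x t. z + t *\<^sub>R (x - z)"
  have seg: "?s x t \<in> S" if "x \<in> S" "t \<in> {0..1}" for x t
    using convexD[OF assms(2,3) that(1), of "1 - t" t] that(2) by (simp add: algebra_simps)
  have cont: "continuous_on (S \<times> {0..1}) (\<lambda>(x, t). t ^ m * f (?s x t))"
    if "continuous_on S f" for f :: "'b \<Rightarrow> real" and m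
    unfolding case_prod_beta
    by (intro continuous_intros continuous_on_compose2[OF that]) (use seg in auto)
  {
    case 0
    then show ?case
      using cont[of f m] integral_continuous_on_param[of S 0 "1::real" "\<lambda>x t. t ^ m * f (?s x t)"] by simp
  next
    case (Suc k)
    have f': "(f has_derivative frechet_derivative f (at x)) (at x)" if "x \<in> S" for x
      using Ck_on_has_derivative[OF Suc.prems that] .
    have cf: "continuous_on S f"
      using f' has_derivative_continuous by (blast intro: continuous_at_imp_continuous_on)
    have cf': "continuous_on S (\<lambda>x. frechet_derivative f (at x) v)" for v
    proof -
      have "Ck_on k S (\<lambda>x. frechet_derivative f (at x) v)" using Suc.prems by simp
      then have "Ck_on 0 S (\<lambda>x. frechet_derivative f (at x) v)"
        by (induction k) (blast intro: Ck_on_Suc_imp)+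
      then show ?thesis by simp
    qed
    \<comment> \<open>\<open>leibniz_rule\<close> takes the derivative of the integrand as a bounded
      linear operator, hence the passage through \<open>Blinfun\<close>.\<close>
    let ?F = "\<lambda>x t. t ^ Suc m *\<^sub>R Blinfun (frechet_derivative f (at (?s x t)))"
    have F: "blinfun_apply (?F x t) v = t ^ Suc m * frechet_derivative f (at (?s x t)) v"
      if "x \<in> S" "t \<in> {0..1}" for x t v
      using f'[OF seg[OF that]]
      by (simp add: scaleR_blinfun.rep_eq bounded_linear_Blinfun_apply has_derivative_bounded_linear)
    have cF: "continuous_on (S \<times> {0..1}) (\<lambda>(x, t). ?F x t)"
    \<comment> \<open>In finite dimension, continuity of an operator-valued map can be tested on
      basis vectors.\<close>
    proof (rule continuous_on_blinfun_componentwise)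
      fix i :: 'b
      have "continuous_on (S \<times> {0..1}) (\<lambda>(x, t). t ^ Suc m * frechet_derivative f (at (?s x t)) i)"
        by (rule cont[OF cf'])
      then show "continuous_on (S \<times> {0..1}) (\<lambda>xt. blinfun_apply (case xt of (x, t) \<Rightarrow> ?F x t) i)"
        using F by (subst continuous_on_cong[OF refl]) auto
    qed
    let ?I = "\<lambda>x. integral {0..1} (?F x)"
    have D: "((\<lambda>x. integral {0..1} (\<lambda>t. t ^ m * f (?s x t))) has_derivative blinfun_apply (?I x)) (at x)"
      if "x \<in> S" for x
    proof -
      have "((\<lambda>x. integral (cbox 0 1) (\<lambda>t. t ^ m * f (?s x t))) has_derivative
          integral (cbox 0 1) (?F x)) (at x within S)"
      proof (rule leibniz_rule[OF _ _ _ that assms(2)])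
        fix y t assume yt: "y \<in> S" "t \<in> cbox (0::real) 1"
        then have *: "y \<in> S" "t \<in> {0..1}" by auto
        have "((\<lambda>y. t ^ m * f (?s y t)) has_derivative
            (\<lambda>v. t ^ m * frechet_derivative f (at (?s y t)) (t *\<^sub>R v))) (at y)"
          by (rule has_derivative_mult_right,
              rule has_derivative_compose[where f = "\<lambda>y. ?s y t" and g = f, OF _ f'[OF seg[OF *]]])
            (auto intro!: derivative_eq_intros)
        moreover have "(\<lambda>v. t ^ m * frechet_derivative f (at (?s y t)) (t *\<^sub>R v)) = blinfun_apply (?F y t)"
          using F[OF *] linear_cmul[OF has_derivative_linear[OF f'[OF seg[OF *]]]]
          by (auto simp: fun_eq_iff)
        ultimately show "((\<lambda>y. t ^ m * f (?s y t)) has_derivative blinfun_apply (?F y t)) (at y within S)"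
          using has_derivative_at_withinI by metis
      next
        fix y assume "y \<in> S"
        then have "continuous_on {0..1} (\<lambda>t. t ^ m * f (?s y t))"
          by (intro continuous_intros continuous_on_compose2[OF cf]) (use seg in auto)
        then show "(\<lambda>t. t ^ m * f (?s y t)) integrable_on cbox 0 1"
          by (simp add: integrable_continuous_real)
      next
        show "continuous_on (S \<times> cbox 0 1) (\<lambda>(x, t). ?F x t)" using cF by simp
      qed
      then show ?thesis using at_within_open[OF that assms(1)] by simp
    qed
    have I: "blinfun_apply (?I x) v =
        integral {0..1} (\<lambda>t. t ^ Suc m * frechet_derivative f (at (?s x t)) v)" if "x \<in> S" for x v
    proof -
      have "continuous_on {0..1} (\<lambda>t. case (x, t) of (x, t) \<Rightarrow> ?F x t)"
        by (rule continuous_on_compose2[OF cF]) (use that in \<open>auto intro!: continuous_intros\<close>)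
      then have "?F x integrable_on {0..1}" by (simp add: integrable_continuous_real)
      then have "blinfun_apply (?I x) v = integral {0..1} (\<lambda>t. blinfun_apply (?F x t) v)"
        by (simp add: blinfun_apply_integral)
      then show ?thesis using F that by (auto intro: integral_cong)
    qed
    have "Ck_on k S (\<lambda>x. blinfun_apply (?I x) v)" for v
    proof (rule Ck_on_cong[OF _ assms(1)])
      show "Ck_on k S (\<lambda>x. integral {0..1} (\<lambda>t. t ^ Suc m * frechet_derivative f (at (?s x t)) v))"
        using Suc.prems by (intro Suc.IH[of "\<lambda>x. frechet_derivative f (at x) v"]) simp
    qed (rule I[symmetric])
    with D show ?case by (rule Ck_on_SucI[OF assms(1)])
  }
qed

text \<open>The cofactors are the integrals of the partial derivatives along segments from \<open>z\<close>.\<close>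

lemma Cinf_on_Hadamard:
  fixes f :: "'b::euclidean_space \<Rightarrow> real"
  assumes "open S" "convex S" "z \<in> S" "Cinf_on S f"
  obtains G where "\<And>b. Cinf_on S (G b)" "\<And>b. G b z = frechet_derivative f (at z) b"
    "\<And>x. x \<in> S \<Longrightarrow> f x = f z + (\<Sum>b\<in>Basis. ((x - z) \<bullet> b) * G b x)"
proof
  let ?G = "\<lambda>b x. integral {0..1} (\<lambda>t. t ^ 0 * frechet_derivative f (at (z + t *\<^sub>R (x - z))) b)"
  have Ck': "Ck_on k S (\<lambda>x. frechet_derivative f (at x) b)" for k b
    using assms(4) Ck_on.simps(2) unfolding Cinf_on_def by metis
  show "Cinf_on S (?G b)" for b
    unfolding Cinf_on_def using Ck_on_segment_integral[OF assms(1-3) Ck'] by blast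
  show "?G b z = frechet_derivative f (at z) b" for b by simp
  fix x assume "x \<in> S"
  let ?s = "\<lambda>t. z + t *\<^sub>R (x - z)"
  have seg: "?s t \<in> S" if "t \<in> {0..1}" for t
    using convexD[OF assms(2,3) \<open>x \<in> S\<close>, of "1 - t" t] that by (simp add: algebra_simps)
  have f': "(f has_derivative frechet_derivative f (at y)) (at y)" if "y \<in> S" for y
    using assms(4) that Ck_on_has_derivative[of 0 S f y] unfolding Cinf_on_def by blast
  \<comment> \<open>Integrating the derivative of \<open>f\<close> along the segment from
    \<open>z\<close> to \<open>x\<close> gives \<open>f x - f z\<close>; splitting
    \<open>x - z\<close> into coordinates then separates the cofactors.\<close>
  have "((\<lambda>t. f (?s t)) has_vector_derivative frechet_derivative f (at (?s t)) (x - z)) (at t within {0..1})"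
    if "t \<in> {0..1}" for t
  proof -
    have "((\<lambda>t. f (?s t)) has_derivative (\<lambda>h. frechet_derivative f (at (?s t)) (h *\<^sub>R (x - z)))) (at t)"
      by (rule has_derivative_compose[where f = ?s and g = f, OF _ f'[OF seg[OF that]]])
        (auto intro!: derivative_eq_intros)
    then show ?thesis
      using linear_cmul[OF has_derivative_linear[OF f'[OF seg[OF that]]]]
      by (simp add: has_vector_derivative_def has_derivative_at_withinI)
  qed
  then have 1: "((\<lambda>t. frechet_derivative f (at (?s t)) (x - z)) has_integral f x - f z) {0..1}"
    using fundamental_theorem_of_calculus[of 0 1 "\<lambda>t. f (?s t)"] by simp
  have 2: "((\<lambda>t. \<Sum>b\<in>Basis. ((x - z) \<bullet> b) * frechet_derivative f (at (?s t)) b) has_integral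
      (\<Sum>b\<in>Basis. ((x - z) \<bullet> b) * ?G b x)) {0..1}"
  proof (intro has_integral_sum has_integral_mult_right)
    fix b :: 'b
    have "continuous_on S (\<lambda>x. frechet_derivative f (at x) b)" using Ck'[of 0] by simp
    then have "continuous_on {0..1} (\<lambda>t. frechet_derivative f (at (?s t)) b)"
      by (rule continuous_on_compose2) (use seg in \<open>auto intro!: continuous_intros\<close>)
    then show "((\<lambda>t. frechet_derivative f (at (?s t)) b) has_integral ?G b x) {0..1}"
      by (simp add: integrable_continuous_real integrable_integral)
  qed simp
  have "frechet_derivative f (at (?s t)) (x - z)
      = (\<Sum>b\<in>Basis. ((x - z) \<bullet> b) * frechet_derivative f (at (?s t)) b)" if "t \<in> {0..1}" for t
  proof -
    note lin = has_derivative_linear[OF f'[OF seg[OF that]]]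
    have "frechet_derivative f (at (?s t)) (x - z)
        = frechet_derivative f (at (?s t)) (\<Sum>b\<in>Basis. ((x - z) \<bullet> b) *\<^sub>R b)"
      by (simp only: euclidean_representation)
    then show ?thesis
      by (simp only: linear_sum[OF lin] linear_cmul[OF lin] real_scaleR_def)
  qed
  from has_integral_eq[OF this 1] show "f x = f z + (\<Sum>b\<in>Basis. ((x - z) \<bullet> b) * ?G b x)"
    using has_integral_unique[OF _ 2] by fastforce
qed

section \<open>Tangent vectors, coordinate fields and orthonormal frames\<close>

lemma sum_fun_apply: "(\<Sum>i\<in>I. f i) x = (\<Sum>i\<in>I. f i x)" for f :: "'i \<Rightarrow> 'x \<Rightarrow> 'v::comm_monoid_add"
  by (induction I rule: infinite_finite_induct) auto

lemma scaleR_tvec_apply: "(r *\<^sub>R v) f = r * v f" for v :: "'a tvec"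
  by (simp add: scaleR_fun_def)

lemma tangent_spaceD:
  assumes "v \<in> tangent_space A p"
  shows "\<not> smooth_fun_near A p f \<Longrightarrow> v f = 0"
    and "smooth_fun_near A p f \<Longrightarrow> smooth_fun_near A p g \<Longrightarrow> v (\<lambda>q. f q + g q) = v f + v g"
    and "smooth_fun_near A p f \<Longrightarrow> v (\<lambda>q. a * f q) = a * v f"
    and "smooth_fun_near A p f \<Longrightarrow> smooth_fun_near A p g \<Longrightarrow>
      v (\<lambda>q. f q * g q) = f p * v g + g p * v f"
  using assms unfolding tangent_space_def by blast+

lemma subspace_tangent_space: "subspace (tangent_space A p)"
  unfolding subspace_def tangent_space_def by (auto simp: scaleR_tvec_apply algebra_simps)

lemmas tangent_space_zero = subspace_0[OF subspace_tangent_space]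
  and tangent_space_add = subspace_add[OF subspace_tangent_space]
  and tangent_space_diff = subspace_diff[OF subspace_tangent_space]
  and tangent_space_scale = subspace_scale[OF subspace_tangent_space]
  and tangent_space_neg = subspace_neg[OF subspace_tangent_space]
  and tangent_space_sum = subspace_sum[OF subspace_tangent_space]

text \<open>The partial derivative in direction \<open>b\<close> of the coordinates
  \<open>c\<close>. The value 0 on functions that are not smooth near \<open>p\<close> is the
  normalisation that \<open>tangent_space\<close> demands.\<close>

definition coord_field ::
    "('a::topological_space, 'b::euclidean_space) atlas \<Rightarrow> 'a set \<Rightarrow> ('a \<Rightarrow> 'b) \<Rightarrow> 'b \<Rightarrow> 'a vfield" where
  "coord_field A U c b p = (\<lambda>f. if smooth_fun_near A p f
     then frechet_derivative (f \<circ> inv_into U c) (at (c p)) b else 0)"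

locale manifold =
  fixes A :: "('a::{t2_space, second_countable_topology}, 'b::euclidean_space) atlas"
  assumes smooth_manifold: "smooth_manifold A"
begin

lemma chart_exists: obtains U c where "(U, c) \<in> A" "p \<in> U"
proof -
  have "p \<in> (\<Union>(U, c)\<in>A. U)"
    using smooth_manifold unfolding smooth_manifold_def by simp
  then show thesis using that by auto
qed

lemma
  assumes "(U, c) \<in> A"
  shows open_chart: "open U" and open_chart_image: "open (c ` U)"
    and homeomorphism_chart: "homeomorphism U (c ` U) c (inv_into U c)"
  using smooth_manifold assms unfolding smooth_manifold_def by auto

lemma Cinf_on_transition:
  assumes "(U, c) \<in> A" "(V, d) \<in> A"
  shows "Cinf_on (c ` (U \<inter> V)) (d \<circ> inv_into U c)"
  using smooth_manifold assms unfolding smooth_manifold_def by blast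

lemma chart_inv: "(U, c) \<in> A \<Longrightarrow> p \<in> U \<Longrightarrow> inv_into U c (c p) = p"
  using homeomorphism_chart by (simp add: homeomorphism_def)

lemma open_chart_image_Int:
  assumes "(V, c) \<in> A" "open U"
  shows "open (c ` (U \<inter> V))"
proof -
  have "openin (top_of_set V) (U \<inter> V)"
    using openin_open_Int[OF assms(2), of V] by (simp add: Int_commute)
  from homeomorphism_imp_open_map[OF homeomorphism_chart[OF assms(1)] this]
  show ?thesis using openin_open_trans open_chart_image[OF assms(1)] by blast
qed

lemma open_chart_preimage:
  assumes "(U, c) \<in> A" "open B"
  shows "open {q \<in> U. c q \<in> B}"
  using continuous_on_open_vimage[OF open_chart[OF assms(1)], of c]
    homeomorphism_chart[OF assms(1)] assms(2)
  by (auto simp: homeomorphism_def Int_def vimage_def conj_commute)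

section \<open>Smooth functions\<close>

lemma smooth_fun_onI:
  assumes "open U" "\<And>V c. (V, c) \<in> A \<Longrightarrow> open (c ` (U \<inter> V)) \<Longrightarrow> Cinf_on (c ` (U \<inter> V)) (f \<circ> inv_into V c)"
  shows "smooth_fun_on A U f"
  using assms open_chart_image_Int unfolding smooth_fun_on_def by blast

lemma smooth_fun_onD:
  "smooth_fun_on A U f \<Longrightarrow> (V, c) \<in> A \<Longrightarrow> Cinf_on (c ` (U \<inter> V)) (f \<circ> inv_into V c)"
  unfolding smooth_fun_on_def by blast

lemma smooth_fun_on_open: "smooth_fun_on A U f \<Longrightarrow> open U"
  unfolding smooth_fun_on_def by blast

lemma smooth_fun_on_subset:
  assumes "smooth_fun_on A U f" "open V" "V \<subseteq> U"
  shows "smooth_fun_on A V f"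
proof (rule smooth_fun_onI[OF assms(2)])
  fix W c assume "(W, c) \<in> A"
  from smooth_fun_onD[OF assms(1) this] show "Cinf_on (c ` (V \<inter> W)) (f \<circ> inv_into W c)"
    unfolding Cinf_on_def using assms(3) by (blast intro: Ck_on_subset)
qed

lemma smooth_fun_on_cong:
  assumes "smooth_fun_on A U f" "\<And>q. q \<in> U \<Longrightarrow> f q = g q"
  shows "smooth_fun_on A U g"
proof (rule smooth_fun_onI[OF smooth_fun_on_open[OF assms(1)]])
  fix V c assume V: "(V, c) \<in> A" and op: "open (c ` (U \<inter> V))"
  have "(f \<circ> inv_into V c) x = (g \<circ> inv_into V c) x" if "x \<in> c ` (U \<inter> V)" for x
    using that assms(2) chart_inv[OF V] by auto
  with smooth_fun_onD[OF assms(1) V] show "Cinf_on (c ` (U \<inter> V)) (g \<circ> inv_into V c)"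
    unfolding Cinf_on_def by (blast intro: Ck_on_cong[OF _ op])
qed

lemma smooth_fun_on_const: "open U \<Longrightarrow> smooth_fun_on A U (\<lambda>q. a)"
  by (rule smooth_fun_onI) (auto simp: Cinf_on_def o_def intro: Ck_on_const)

lemma smooth_fun_on_add:
  assumes "smooth_fun_on A U f" "smooth_fun_on A U g"
  shows "smooth_fun_on A U (\<lambda>q. f q + g q)"
proof (rule smooth_fun_onI[OF smooth_fun_on_open[OF assms(1)]])
  fix V c assume V: "(V, c) \<in> A" and op: "open (c ` (U \<inter> V))"
  show "Cinf_on (c ` (U \<inter> V)) ((\<lambda>q. f q + g q) \<circ> inv_into V c)"
    using smooth_fun_onD[OF assms(1) V] smooth_fun_onD[OF assms(2) V]
    unfolding Cinf_on_def o_def by (auto intro: Ck_on_add[OF op])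
qed

lemma smooth_fun_on_mult:
  assumes "smooth_fun_on A U f" "smooth_fun_on A U g"
  shows "smooth_fun_on A U (\<lambda>q. f q * g q)"
proof (rule smooth_fun_onI[OF smooth_fun_on_open[OF assms(1)]])
  fix V c assume V: "(V, c) \<in> A" and op: "open (c ` (U \<inter> V))"
  show "Cinf_on (c ` (U \<inter> V)) ((\<lambda>q. f q * g q) \<circ> inv_into V c)"
    using smooth_fun_onD[OF assms(1) V] smooth_fun_onD[OF assms(2) V]
    unfolding Cinf_on_def o_def by (auto intro: Ck_on_mult[OF op])
qed

lemma smooth_fun_on_diff:
  assumes "smooth_fun_on A U f" "smooth_fun_on A U g"
  shows "smooth_fun_on A U (\<lambda>q. f q - g q)"
  using smooth_fun_on_add[OF assms(1) smooth_fun_on_mult[OF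
        smooth_fun_on_const[OF smooth_fun_on_open[OF assms(2)], of "-1"] assms(2)]]
  by simp

lemma smooth_fun_on_compose:
  fixes \<psi> :: "real \<Rightarrow> real"
  assumes "smooth_fun_on A U f" "open T" "f ` U \<subseteq> T" "Cinf_on T \<psi>"
  shows "smooth_fun_on A U (\<lambda>q. \<psi> (f q))"
proof (rule smooth_fun_onI[OF smooth_fun_on_open[OF assms(1)]])
  fix V c assume V: "(V, c) \<in> A" and op: "open (c ` (U \<inter> V))"
  have "(f \<circ> inv_into V c) ` (c ` (U \<inter> V)) \<subseteq> T"
    using assms(3) chart_inv[OF V] by auto
  then have "Ck_on k (c ` (U \<inter> V)) (\<lambda>x. \<psi> ((f \<circ> inv_into V c) x))" for k
    using assms(4) smooth_fun_onD[OF assms(1) V] unfolding Cinf_on_def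
    by (intro Ck_on_compose[where f = \<psi> and u = "f \<circ> inv_into V c", OF op assms(2)]) (blast | simp)+
  then show "Cinf_on (c ` (U \<inter> V)) ((\<lambda>q. \<psi> (f q)) \<circ> inv_into V c)"
    by (simp add: Cinf_on_def o_def)
qed

text \<open>Read in another chart \<open>d\<close>, the function is \<open>F\<close> composed with
  the transition map from \<open>d\<close> to \<open>c\<close>, which is smooth.\<close>

lemma smooth_fun_on_chart:
  fixes F :: "'b \<Rightarrow> real"
  assumes U: "(U, c) \<in> A" and "open W" "W \<subseteq> U" "open S" "c ` W \<subseteq> S" "Cinf_on S F"
  shows "smooth_fun_on A W (\<lambda>q. F (c q))"
proof (rule smooth_fun_onI[OF assms(2)])
  fix V d assume V: "(V, d) \<in> A" and op: "open (d ` (W \<inter> V))"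
  have tr: "Ck_on k (d ` (W \<inter> V)) (c \<circ> inv_into V d)" for k
  proof (rule Ck_on_subset)
    show "Ck_on k (d ` (V \<inter> U)) (c \<circ> inv_into V d)"
      using Cinf_on_transition[OF V U] by (simp add: Cinf_on_def)
  qed (use assms(3) in auto)
  have "(c \<circ> inv_into V d) ` (d ` (W \<inter> V)) \<subseteq> S"
    using assms(5) chart_inv[OF V] by auto
  then have "Ck_on k (d ` (W \<inter> V)) (\<lambda>x. F ((c \<circ> inv_into V d) x))" for k
    using assms(6) tr unfolding Cinf_on_def
    by (intro Ck_on_compose[where f = F and u = "c \<circ> inv_into V d", OF op assms(4)]) (blast | simp)+
  then show "Cinf_on (d ` (W \<inter> V)) ((\<lambda>q. F (c q)) \<circ> inv_into V d)"
    by (simp add: Cinf_on_def o_def)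
qed

lemma smooth_fun_on_coordinate:
  assumes "(U, c) \<in> A"
  shows "smooth_fun_on A U (\<lambda>q. c q \<bullet> b)"
proof (rule smooth_fun_on_chart[OF assms open_chart[OF assms] order.refl open_UNIV])
  show "Cinf_on UNIV (\<lambda>x::'b. x \<bullet> b)"
    using Ck_on_bounded_linear_compose[OF bounded_linear_inner_left open_UNIV Ck_on_ident[OF open_UNIV]]
    unfolding Cinf_on_def by blast
qed simp

section \<open>Germs of functions and locality of derivations\<close>

lemma smooth_fun_near_eq_on:
  assumes "open W" "p \<in> W" "\<And>q. q \<in> W \<Longrightarrow> f q = g q" "smooth_fun_near A p f"
  shows "smooth_fun_near A p g"
proof -
  from assms(4) obtain U where U: "p \<in> U" "smooth_fun_on A U f"
    unfolding smooth_fun_near_def by blast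
  have "smooth_fun_on A (U \<inter> W) g"
    by (rule smooth_fun_on_cong[OF smooth_fun_on_subset[OF U(2)]])
      (use assms U smooth_fun_on_open in auto)
  then show ?thesis unfolding smooth_fun_near_def using U assms(2) by blast
qed

lemma smooth_fun_on_near: "smooth_fun_on A U f \<Longrightarrow> p \<in> U \<Longrightarrow> smooth_fun_near A p f"
  unfolding smooth_fun_near_def by blast

lemma smooth_fun_near2:
  assumes "smooth_fun_near A p f" "smooth_fun_near A p g"
  obtains U where "p \<in> U" "smooth_fun_on A U f" "smooth_fun_on A U g"
proof -
  from assms obtain U V where UV: "p \<in> U" "p \<in> V" "smooth_fun_on A U f" "smooth_fun_on A V g"
    unfolding smooth_fun_near_def by blast
  then have "open (U \<inter> V)" by (simp add: smooth_fun_on_open open_Int)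
  show thesis
  proof (rule that)
    show "p \<in> U \<inter> V" using UV by simp
    show "smooth_fun_on A (U \<inter> V) f" "smooth_fun_on A (U \<inter> V) g"
      by (rule smooth_fun_on_subset[OF UV(3) \<open>open (U \<inter> V)\<close>], simp)
        (rule smooth_fun_on_subset[OF UV(4) \<open>open (U \<inter> V)\<close>], simp)
  qed
qed

lemma smooth_fun_near_const: "smooth_fun_near A p (\<lambda>q. a)"
  using smooth_fun_on_const[OF open_UNIV] smooth_fun_on_near by blast

text \<open>An indicator function is constantly 1 near \<open>p\<close>. It takes the place of the
  bump functions of the usual localisation arguments.\<close>

lemma smooth_fun_near_indicator:
  assumes "open W" "p \<in> W"
  shows "smooth_fun_near A p (indicat_real W)"
  by (rule smooth_fun_near_eq_on[OF assms _ smooth_fun_near_const[of p 1]]) simp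

text \<open>The indicator is idempotent and equals 1 at \<open>p\<close>, so the Leibniz rule makes
  its derivative equal to twice itself.\<close>

lemma tangent_indicator:
  assumes v: "v \<in> tangent_space A p" and W: "open W" "p \<in> W"
  shows "v (indicat_real W) = 0"
proof -
  have "v (\<lambda>q. indicat_real W q * indicat_real W q) = 2 * v (indicat_real W)"
    using tangent_spaceD(4)[OF v] smooth_fun_near_indicator[OF W] W(2) by simp
  moreover have "(\<lambda>q. indicat_real W q * indicat_real W q) = indicat_real W"
    by (auto simp: indicator_def)
  ultimately show ?thesis by simp
qed

text \<open>By the Leibniz rule, multiplying by the indicator of \<open>W\<close> does not affect
  the derivative, and after this multiplication the two functions coincide everywhere. If they are
  not smooth near \<open>p\<close>, both values are 0.\<close>

lemma tangent_local:
  assumes v: "v \<in> tangent_space A p" and W: "open W" "p \<in> W" and eq: "\<And>q. q \<in> W \<Longrightarrow> f q = g q"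
  shows "v f = v g"
proof (cases "smooth_fun_near A p f")
  case True
  then have g: "smooth_fun_near A p g" using smooth_fun_near_eq_on[of W p f g] W eq by blast
  have "v (\<lambda>q. indicat_real W q * h q) = v h" if "smooth_fun_near A p h" for h
    using tangent_spaceD(4)[OF v smooth_fun_near_indicator[OF W] that] W(2)
      tangent_indicator[OF v W] by simp
  moreover have "(\<lambda>q. indicat_real W q * f q) = (\<lambda>q. indicat_real W q * g q)"
    using eq by (auto simp: indicator_def)
  ultimately show ?thesis using True g by metis
next
  case False
  then have "\<not> smooth_fun_near A p g" using smooth_fun_near_eq_on[of W p g f] W eq by auto
  with False show ?thesis using tangent_spaceD(1)[OF v] by simp
qed

lemma tangent_const:
  assumes v: "v \<in> tangent_space A p"
  shows "v (\<lambda>q. a) = 0"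
proof -
  have "v (\<lambda>q. 1) = 0"
    using tangent_local[OF v open_UNIV UNIV_I, of "\<lambda>q. 1" "indicat_real UNIV"]
      tangent_indicator[OF v open_UNIV] by simp
  then show ?thesis using tangent_spaceD(3)[OF v smooth_fun_near_const, of a 1] by simp
qed

lemma smooth_fun_near_mult:
  assumes "smooth_fun_near A p f" "smooth_fun_near A p g"
  shows "smooth_fun_near A p (\<lambda>q. f q * g q)"
  by (rule smooth_fun_near2[OF assms]) (rule smooth_fun_on_near[OF smooth_fun_on_mult])

lemma smooth_fun_near_add:
  assumes "smooth_fun_near A p f" "smooth_fun_near A p g"
  shows "smooth_fun_near A p (\<lambda>q. f q + g q)"
  by (rule smooth_fun_near2[OF assms]) (rule smooth_fun_on_near[OF smooth_fun_on_add])

lemma tangent_diff: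
  assumes v: "v \<in> tangent_space A p" and f: "smooth_fun_near A p f" and g: "smooth_fun_near A p g"
  shows "v (\<lambda>q. f q - g q) = v f - v g"
proof -
  have "v (\<lambda>q. f q + -1 * g q) = v f + v (\<lambda>q. -1 * g q)"
    by (rule tangent_spaceD(2)[OF v f smooth_fun_near_mult[OF smooth_fun_near_const g]])
  then show ?thesis using tangent_spaceD(3)[OF v g, of "-1"] by simp
qed

lemma smooth_fun_near_sum:
  assumes "\<And>i. i \<in> I \<Longrightarrow> smooth_fun_near A p (f i)"
  shows "smooth_fun_near A p (\<lambda>q. \<Sum>i\<in>I. f i q)"
  using assms
  by (induction I rule: infinite_finite_induct)
    (auto intro: smooth_fun_near_const smooth_fun_near_add)

lemma tangent_sum:
  assumes v: "v \<in> tangent_space A p" and "\<And>i. i \<in> I \<Longrightarrow> smooth_fun_near A p (f i)"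
  shows "v (\<lambda>q. \<Sum>i\<in>I. f i q) = (\<Sum>i\<in>I. v (f i))"
  using assms(2)
  by (induction I rule: infinite_finite_induct)
    (auto simp: tangent_const[OF v] tangent_spaceD(2)[OF v] smooth_fun_near_sum)

section \<open>Coordinate fields\<close>

lemma smooth_fun_near_has_derivative:
  assumes "(U, c) \<in> A" "p \<in> U" "smooth_fun_near A p f"
  shows "((f \<circ> inv_into U c) has_derivative frechet_derivative (f \<circ> inv_into U c) (at (c p))) (at (c p))"
proof -
  from assms(3) obtain W where W: "p \<in> W" "smooth_fun_on A W f"
    unfolding smooth_fun_near_def by blast
  have "Ck_on (Suc 0) (c ` (W \<inter> U)) (f \<circ> inv_into U c)"
    using smooth_fun_onD[OF W(2) assms(1)] unfolding Cinf_on_def by (rule spec)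
  from Ck_on_has_derivative[OF this] show ?thesis using W assms(2) by blast
qed

lemma coord_field_tangent:
  assumes U: "(U, c) \<in> A" and p: "p \<in> U"
  shows "coord_field A U c b p \<in> tangent_space A p"
proof -
  note der = smooth_fun_near_has_derivative[OF U p]
  note inv = chart_inv[OF U p]
  have add: "frechet_derivative ((\<lambda>q. f q + g q) \<circ> inv_into U c) (at (c p)) b
      = frechet_derivative (f \<circ> inv_into U c) (at (c p)) b + frechet_derivative (g \<circ> inv_into U c) (at (c p)) b"
    if "smooth_fun_near A p f" "smooth_fun_near A p g" for f g
    using fun_cong[OF frechet_derivative_at[OF has_derivative_add[OF der[OF that(1)] der[OF that(2)]]], of b]
    by (simp add: o_def)
  have mult: "frechet_derivative ((\<lambda>q. f q * g q) \<circ> inv_into U c) (at (c p)) b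
      = f p * frechet_derivative (g \<circ> inv_into U c) (at (c p)) b
        + g p * frechet_derivative (f \<circ> inv_into U c) (at (c p)) b"
    if "smooth_fun_near A p f" "smooth_fun_near A p g" for f g
    using fun_cong[OF frechet_derivative_at[OF has_derivative_mult[OF der[OF that(1)] der[OF that(2)]]], of b] inv
    by (simp add: o_def mult.commute)
  have const: "frechet_derivative ((\<lambda>q. a) \<circ> inv_into U c) (at (c p)) b = 0" for a :: real
    by (simp add: o_def)
  show ?thesis
    unfolding tangent_space_def mem_Collect_eq coord_field_def
    by (intro conjI allI impI)
      (simp_all only: add mult const smooth_fun_near_add smooth_fun_near_mult smooth_fun_near_const
        if_True if_False mult_zero_right add_0_right)
qed

lemma coord_field_smooth:
  assumes U: "(U, c) \<in> A"
  shows "smooth_vfield_on A U (coord_field A U c b)"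
  unfolding smooth_vfield_on_def
proof (intro conjI ballI allI impI)
  fix V f assume V: "V \<subseteq> U" "smooth_fun_on A V f"
  then have op: "open (c ` (V \<inter> U))" and oV: "open V"
    using open_chart_image_Int[OF U] smooth_fun_on_open by auto
  have "Cinf_on (c ` (V \<inter> U)) (\<lambda>x. frechet_derivative (f \<circ> inv_into U c) (at x) b)"
    unfolding Cinf_on_def
  proof
    fix k
    have "Ck_on (Suc k) (c ` (V \<inter> U)) (f \<circ> inv_into U c)"
      using smooth_fun_onD[OF V(2) U] unfolding Cinf_on_def by (rule spec)
    then show "Ck_on k (c ` (V \<inter> U)) (\<lambda>x. frechet_derivative (f \<circ> inv_into U c) (at x) b)"
      by simp
  qed
  from smooth_fun_on_chart[OF U oV V(1) op _ this]
  have "smooth_fun_on A V (\<lambda>q. frechet_derivative (f \<circ> inv_into U c) (at (c q)) b)"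
    using V(1) by blast
  then show "smooth_fun_on A V (\<lambda>p. coord_field A U c b p f)"
    by (rule smooth_fun_on_cong) (simp add: coord_field_def smooth_fun_on_near[OF V(2)])
qed (use open_chart[OF U] coord_field_tangent[OF U] in auto)

text \<open>Coordinate functions are dual to coordinate fields; this detects the linear independence
  that Gram-Schmidt requires.\<close>

lemma coord_field_coordinate:
  assumes U: "(U, c) \<in> A" and p: "p \<in> U"
  shows "coord_field A U c b p (\<lambda>q. c q \<bullet> b') = b \<bullet> b'"
proof -
  have eq: "((\<lambda>q. c q \<bullet> b') \<circ> inv_into U c) x = x \<bullet> b'" if "x \<in> c ` U" for x
    using that chart_inv[OF U] by auto
  have "frechet_derivative ((\<lambda>q. c q \<bullet> b') \<circ> inv_into U c) (at (c p)) = frechet_derivative (\<lambda>x. x \<bullet> b') (at (c p))"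
    by (rule frechet_derivative_cong_open[OF open_chart_image[OF U] _ eq]) (use p in auto)
  also have "\<dots> = (\<lambda>v. v \<bullet> b')"
    by (rule frechet_derivative_at[symmetric]) (auto intro!: derivative_eq_intros)
  finally show ?thesis
    using smooth_fun_on_near[OF smooth_fun_on_coordinate[OF U] p] by (simp add: coord_field_def)
qed

text \<open>Hadamard's lemma writes \<open>f\<close> near \<open>p\<close> as \<open>f p\<close>
  plus a sum of coordinate differences times smooth cofactors. The differences vanish at
  \<open>p\<close>, so the Leibniz rule leaves their derivatives times the cofactors at
  \<open>p\<close>, which are the partial derivatives of \<open>f\<close>.\<close>

lemma tangent_coord_expansion:
  assumes U: "(U, c) \<in> A" and p: "p \<in> U" and v: "v \<in> tangent_space A p"
  shows "v = (\<Sum>b\<in>Basis. v (\<lambda>q. c q \<bullet> b) *\<^sub>R coord_field A U c b p)"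
proof
  fix f
  show "v f = (\<Sum>b\<in>Basis. v (\<lambda>q. c q \<bullet> b) *\<^sub>R coord_field A U c b p) f"
  proof (cases "smooth_fun_near A p f")
    case False
    then show ?thesis
      by (simp add: sum_fun_apply scaleR_tvec_apply tangent_spaceD(1)[OF v] coord_field_def)
  next
    case True
    then obtain W where W: "p \<in> W" "smooth_fun_on A W f"
      unfolding smooth_fun_near_def by blast
    let ?F = "f \<circ> inv_into U c"
    have "open (c ` (W \<inter> U))" "c p \<in> c ` (W \<inter> U)"
      using open_chart_image_Int[OF U] smooth_fun_on_open W p by auto
    \<comment> \<open>Hadamard's lemma needs a convex domain, so the chart image is shrunk to a
      ball.\<close>
    then obtain r where r: "r > 0" "ball (c p) r \<subseteq> c ` (W \<inter> U)"
      using open_contains_ball by blast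
    let ?B = "ball (c p) r" and ?N = "{q \<in> U. c q \<in> ball (c p) r}"
    have F: "Cinf_on ?B ?F"
      using smooth_fun_onD[OF W(2) U] r(2) unfolding Cinf_on_def by (blast intro: Ck_on_subset)
    have cB: "c p \<in> ?B" using r(1) by simp
    obtain G where G: "\<And>b. Cinf_on ?B (G b)" "\<And>b. G b (c p) = frechet_derivative ?F (at (c p)) b"
      "\<And>x. x \<in> ?B \<Longrightarrow> ?F x = ?F (c p) + (\<Sum>b\<in>Basis. ((x - c p) \<bullet> b) * G b x)"
      by (rule Cinf_on_Hadamard[OF open_ball convex_ball cB F]) (rule that)
    have N: "open ?N" "p \<in> ?N" using open_chart_preimage[OF U open_ball] p r(1) by auto
    have co: "smooth_fun_near A p (\<lambda>q. c q \<bullet> b)" for b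
      using smooth_fun_on_near[OF smooth_fun_on_coordinate[OF U] p] .
    \<comment> \<open>Subtracting the constant \<open>c p\<close> makes the coordinate vanish at
      \<open>p\<close> without changing its derivative.\<close>
    have co': "smooth_fun_near A p (\<lambda>q. (c q - c p) \<bullet> b)" "v (\<lambda>q. (c q - c p) \<bullet> b) = v (\<lambda>q. c q \<bullet> b)" for b
      using smooth_fun_near_add[OF co smooth_fun_near_const[of p "- (c p \<bullet> b)"]]
        tangent_spaceD(2)[OF v co smooth_fun_near_const[of p "- (c p \<bullet> b)"]] tangent_const[OF v]
      by (simp_all add: inner_diff_left)
    have Gs: "smooth_fun_near A p (\<lambda>q. G b (c q))" for b
      by (rule smooth_fun_on_near[OF smooth_fun_on_chart[OF U N(1) _ open_ball _ G(1)] N(2)]) auto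
    have "f q = f p + (\<Sum>b\<in>Basis. ((c q - c p) \<bullet> b) * G b (c q))" if "q \<in> ?N" for q
    proof -
      have "q \<in> U" "c q \<in> ?B" using that by auto
      then show ?thesis using G(3)[of "c q"] by (simp add: chart_inv[OF U] p)
    qed
    from tangent_local[OF v N this]
    have "v f = v (\<lambda>q. f p + (\<Sum>b\<in>Basis. ((c q - c p) \<bullet> b) * G b (c q)))" .
    also have "\<dots> = (\<Sum>b\<in>Basis. v (\<lambda>q. ((c q - c p) \<bullet> b) * G b (c q)))"
      using co' Gs
      by (simp add: tangent_spaceD(2)[OF v smooth_fun_near_const] smooth_fun_near_sum
          smooth_fun_near_mult tangent_sum[OF v] tangent_const[OF v])
    also have "\<dots> = (\<Sum>b\<in>Basis. v (\<lambda>q. c q \<bullet> b) * G b (c p))"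
      using co' Gs by (intro sum.cong) (simp_all add: tangent_spaceD(4)[OF v])
    finally show ?thesis
      using True by (simp add: sum_fun_apply scaleR_tvec_apply coord_field_def G(2))
  qed
qed

section \<open>Smooth vector fields\<close>

lemma smooth_vfield_onD:
  assumes "smooth_vfield_on A U X"
  shows "open U" "\<And>p. p \<in> U \<Longrightarrow> X p \<in> tangent_space A p"
    "\<And>V f. V \<subseteq> U \<Longrightarrow> smooth_fun_on A V f \<Longrightarrow> smooth_fun_on A V (\<lambda>p. X p f)"
  using assms unfolding smooth_vfield_on_def by auto

lemma smooth_vfield_on_subset:
  assumes "smooth_vfield_on A U X" "open V" "V \<subseteq> U"
  shows "smooth_vfield_on A V X"
  using smooth_vfield_onD[OF assms(1)] assms(2,3) unfolding smooth_vfield_on_def by auto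

lemma smooth_vfield_on_cong:
  assumes "smooth_vfield_on A U X" "\<And>q. q \<in> U \<Longrightarrow> X q = Y q"
  shows "smooth_vfield_on A U Y"
  unfolding smooth_vfield_on_def
proof (intro conjI ballI allI impI)
  fix V f assume V: "V \<subseteq> U" "smooth_fun_on A V f"
  show "smooth_fun_on A V (\<lambda>p. Y p f)"
    by (rule smooth_fun_on_cong[OF smooth_vfield_onD(3)[OF assms(1) V]]) (use V assms(2) in auto)
qed (use smooth_vfield_onD[OF assms(1)] assms(2) in auto)

lemma smooth_vfield_on_add:
  assumes "smooth_vfield_on A U X" "smooth_vfield_on A U Y"
  shows "smooth_vfield_on A U (\<lambda>q. X q + Y q)"
  unfolding smooth_vfield_on_def
  using smooth_vfield_onD[OF assms(1)] smooth_vfield_onD[OF assms(2)]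
  by (auto intro: smooth_fun_on_add tangent_space_add)

lemma smooth_vfield_on_scale:
  assumes "smooth_fun_on A U f" "smooth_vfield_on A U X"
  shows "smooth_vfield_on A U (\<lambda>q. f q *\<^sub>R X q)"
  unfolding smooth_vfield_on_def
proof (intro conjI ballI allI impI)
  fix V h assume V: "V \<subseteq> U" "smooth_fun_on A V h"
  show "smooth_fun_on A V (\<lambda>p. (f p *\<^sub>R X p) h)"
    unfolding scaleR_tvec_apply
    by (intro smooth_fun_on_mult smooth_fun_on_subset[OF assms(1)] smooth_vfield_onD(3)[OF assms(2) V])
      (use V smooth_fun_on_open in auto)
qed (use smooth_vfield_onD[OF assms(2)] in \<open>auto intro: tangent_space_scale\<close>)

lemma smooth_vfield_on_zero: "open U \<Longrightarrow> smooth_vfield_on A U (\<lambda>q. 0)"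
  unfolding smooth_vfield_on_def
  by (auto intro: tangent_space_zero smooth_fun_on_const dest: smooth_fun_on_open)

lemma smooth_vfield_on_sum:
  assumes "open U" "\<And>i. i \<in> I \<Longrightarrow> smooth_vfield_on A U (X i)"
  shows "smooth_vfield_on A U (\<lambda>q. \<Sum>i\<in>I. X i q)"
  using assms(2)
  by (induction I rule: infinite_finite_induct)
    (auto intro: smooth_vfield_on_add smooth_vfield_on_zero assms(1))

lemma smooth_vfield_on_diff:
  assumes "smooth_vfield_on A U X" "smooth_vfield_on A U Y"
  shows "smooth_vfield_on A U (\<lambda>q. X q - Y q)"
  using smooth_vfield_on_add[OF assms(1) smooth_vfield_on_scale[OF
        smooth_fun_on_const[OF smooth_vfield_onD(1)[OF assms(2)], of "-1"] assms(2)]]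
  by simp

end

section \<open>Riemannian metrics and the Gram-Schmidt process\<close>

locale riemannian_manifold = manifold A
  for A :: "('a::{t2_space, second_countable_topology}, 'b::euclidean_space) atlas" +
  fixes g :: "'a metric"
  assumes metric: "riemannian_metric A g"
begin

lemma metric_lin:
  assumes "u \<in> tangent_space A p" "v \<in> tangent_space A p" "w \<in> tangent_space A p"
  shows "g p (a *\<^sub>R u + b *\<^sub>R v) w = a * g p u w + b * g p v w"
  using metric assms unfolding riemannian_metric_def by blast

lemma metric_sym: "v \<in> tangent_space A p \<Longrightarrow> w \<in> tangent_space A p \<Longrightarrow> g p v w = g p w v"
  using metric unfolding riemannian_metric_def by blast

lemma metric_pos: "v \<in> tangent_space A p \<Longrightarrow> v \<noteq> 0 \<Longrightarrow> g p v v > 0"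
  using metric unfolding riemannian_metric_def by blast

lemma metric_smooth:
  "smooth_vfield_on A U X \<Longrightarrow> smooth_vfield_on A U Y \<Longrightarrow> smooth_fun_on A U (\<lambda>p. g p (X p) (Y p))"
  using metric unfolding riemannian_metric_def by blast

lemma metric_add:
  assumes "u \<in> tangent_space A p" "v \<in> tangent_space A p" "w \<in> tangent_space A p"
  shows "g p (u + v) w = g p u w + g p v w" "g p w (u + v) = g p w u + g p w v"
  using metric_lin[OF assms, of 1 1] metric_sym[OF _ assms(3)] assms by (auto simp: tangent_space_add)

lemma metric_scale:
  assumes "u \<in> tangent_space A p" "w \<in> tangent_space A p"
  shows "g p (a *\<^sub>R u) w = a * g p u w" "g p w (a *\<^sub>R u) = a * g p w u"
  using metric_lin[OF assms(1) assms(1,2), of a 0] metric_sym[OF _ assms(2)] assms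
  by (auto simp: tangent_space_scale)

lemma metric_diff:
  assumes "u \<in> tangent_space A p" "v \<in> tangent_space A p" "w \<in> tangent_space A p"
  shows "g p (u - v) w = g p u w - g p v w" "g p w (u - v) = g p w u - g p w v"
  using metric_lin[OF assms, of 1 "-1"] metric_sym[OF _ assms(3)] assms by (auto simp: tangent_space_diff)

lemma metric_minus:
  assumes "u \<in> tangent_space A p" "w \<in> tangent_space A p"
  shows "g p (- u) w = - g p u w" "g p w (- u) = - g p w u"
  using metric_scale[OF assms, of "-1"] by auto

lemma metric_zero:
  assumes "w \<in> tangent_space A p"
  shows "g p 0 w = 0" "g p w 0 = 0"
  using metric_scale[OF assms assms, of 0] by auto

lemma metric_sum:
  assumes "\<And>i. i \<in> I \<Longrightarrow> u i \<in> tangent_space A p" "w \<in> tangent_space A p"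
  shows "g p (\<Sum>i\<in>I. u i) w = (\<Sum>i\<in>I. g p (u i) w)" "g p w (\<Sum>i\<in>I. u i) = (\<Sum>i\<in>I. g p w (u i))"
  using assms
  by (induction I rule: infinite_finite_induct) (auto simp: metric_zero metric_add tangent_space_sum)

text \<open>The third hypothesis is pointwise linear independence, in the form that every field lies
  outside the span of its predecessors; this keeps the residuals nonzero at every point of
  \<open>U\<close>.\<close>

lemma Gram_Schmidt:
  fixes X :: "nat \<Rightarrow> 'a vfield"
  assumes "open U" "\<And>i. i < N \<Longrightarrow> smooth_vfield_on A U (X i)"
    and "\<And>q i. q \<in> U \<Longrightarrow> i < N \<Longrightarrow> X i q \<notin> span ((\<lambda>i. X i q) ` {..<i})"
  obtains E :: "nat \<Rightarrow> 'a vfield" where "\<And>i. i < N \<Longrightarrow> smooth_vfield_on A U (E i)"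
    "\<And>q i j. q \<in> U \<Longrightarrow> i < N \<Longrightarrow> j < N \<Longrightarrow> g q (E i q) (E j q) = (if i = j then 1 else 0)"
    "\<And>q. q \<in> U \<Longrightarrow> span ((\<lambda>i. E i q) ` {..<N}) = span ((\<lambda>i. X i q) ` {..<N})"
proof -
  have "\<exists>E. (\<forall>i<N. smooth_vfield_on A U (E i)) \<and>
      (\<forall>q\<in>U. \<forall>i<N. \<forall>j<N. g q (E i q) (E j q) = (if i = j then 1 else 0)) \<and>
      (\<forall>q\<in>U. span ((\<lambda>i. E i q) ` {..<N}) = span ((\<lambda>i. X i q) ` {..<N}))"
    using assms(2,3)
  proof (induction N)
    case 0
    then show ?case by auto
  next
    case (Suc N)
    then obtain E where E: "\<And>i. i < N \<Longrightarrow> smooth_vfield_on A U (E i)"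
      "\<And>q i j. q \<in> U \<Longrightarrow> i < N \<Longrightarrow> j < N \<Longrightarrow> g q (E i q) (E j q) = (if i = j then 1 else 0)"
      "\<And>q. q \<in> U \<Longrightarrow> span ((\<lambda>i. E i q) ` {..<N}) = span ((\<lambda>i. X i q) ` {..<N})"
      by (metis less_SucI)
    have XN: "smooth_vfield_on A U (X N)" using Suc.prems(1) by simp
    \<comment> \<open>\<open>P\<close> is the projection onto the fields already built,
      \<open>Z\<close> the residual, \<open>r\<close> the reciprocal of its length and
      \<open>F\<close> the new unit field. The length enters through \<open>powr\<close>, which is
      smooth on the positive reals.\<close>
    define P where "P q = (\<Sum>i<N. g q (X N q) (E i q) *\<^sub>R E i q)" for q
    define Z where "Z q = X N q - P q" for q
    define r where "r q = g q (Z q) (Z q) powr (- 1 / 2)" for q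
    define F where "F q = r q *\<^sub>R Z q" for q
    have Zs: "smooth_vfield_on A U Z"
      unfolding Z_def P_def
      by (intro smooth_vfield_on_diff smooth_vfield_on_sum smooth_vfield_on_scale metric_smooth XN
          E(1) assms(1)) auto
    have Et: "E i q \<in> tangent_space A q" if "q \<in> U" "i < N" for q i
      using smooth_vfield_onD(2)[OF E(1)] that by blast
    have Xt: "X N q \<in> tangent_space A q" and Zt: "Z q \<in> tangent_space A q" if "q \<in> U" for q
      using smooth_vfield_onD(2)[OF XN that] smooth_vfield_onD(2)[OF Zs that] .
    have PE: "P q \<in> span ((\<lambda>i. E i q) ` {..<N})" for q
      unfolding P_def by (intro span_sum span_scale span_base) auto
    \<comment> \<open>A zero residual would put \<open>X N q\<close> into the span of its
      predecessors, as \<open>E\<close> and \<open>X\<close> have equal spans so far.\<close>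
    have Zpos: "g q (Z q) (Z q) > 0" if "q \<in> U" for q
    proof (rule metric_pos[OF Zt[OF that]])
      have "X N q \<noteq> P q"
        using PE[of q] E(3)[OF that] Suc.prems(2)[OF that, of N] by auto
      then show "Z q \<noteq> 0" by (simp add: Z_def)
    qed
    have rs: "smooth_fun_on A U r"
      unfolding r_def
      by (rule smooth_fun_on_compose[OF metric_smooth[OF Zs Zs], where T = "{0<..}"])
        (use Zpos in \<open>auto simp: Cinf_on_def Ck_on_powr\<close>)
    have rr: "r q * r q * g q (Z q) (Z q) = 1" and rpos: "r q > 0" if "q \<in> U" for q
      using Zpos[OF that] by (simp_all add: r_def powr_minus field_simps flip: powr_add)
    have Fs: "smooth_vfield_on A U F"
      unfolding F_def by (rule smooth_vfield_on_scale[OF rs Zs])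
    have ZE: "g q (Z q) (E j q) = 0" if "q \<in> U" "j < N" for q j
    proof -
      have "g q (P q) (E j q) = (\<Sum>i<N. g q (X N q) (E i q) * g q (E i q) (E j q))"
        unfolding P_def using that Et
        by (subst metric_sum) (auto simp: tangent_space_scale metric_scale intro!: sum.cong)
      also have "\<dots> = (\<Sum>i<N. if i = j then g q (X N q) (E i q) else 0)"
        using that by (intro sum.cong) (auto simp: E(2))
      also have "\<dots> = g q (X N q) (E j q)" using that(2) by simp
      finally show ?thesis
        using that Et Xt Zt unfolding Z_def P_def
        by (subst metric_diff) (auto intro!: tangent_space_sum tangent_space_scale)
    qed
    have FE: "g q (F q) (E j q) = 0" "g q (E j q) (F q) = 0" if "q \<in> U" "j < N" for q j
      using ZE[OF that] metric_sym[OF Zt[OF that(1)] Et[OF that]] Zt[OF that(1)] Et[OF that]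
      by (simp_all add: F_def metric_scale)
    have FF: "g q (F q) (F q) = 1" if "q \<in> U" for q
      using rr[OF that] Zt[OF that] by (simp add: F_def metric_scale tangent_space_scale mult.assoc)
    have sp: "span (insert (F q) ((\<lambda>i. E i q) ` {..<N})) = span (insert (X N q) ((\<lambda>i. X i q) ` {..<N}))"
      (is "span (insert _ ?E) = span (insert _ ?X)") if "q \<in> U" for q
    proof -
      have "span (insert (F q) ?E) = span (insert (X N q) ?E)"
      proof (intro subset_antisym span_minimal subspace_span insert_subsetI)
        have "P q \<in> span (insert (X N q) ?E)"
          by (rule subsetD[OF span_mono PE]) auto
        then show "F q \<in> span (insert (X N q) ?E)"
          unfolding F_def Z_def by (intro span_scale span_diff) (auto intro: span_base)
        have "X N q = (1 / r q) *\<^sub>R F q + P q"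
          using rpos[OF that] by (simp add: F_def Z_def)
        moreover have "P q \<in> span (insert (F q) ?E)"
          by (rule subsetD[OF span_mono PE]) auto
        ultimately show "X N q \<in> span (insert (F q) ?E)"
          by (simp add: span_add span_scale span_base)
      qed (auto intro: span_base)
      \<comment> \<open>The span after an insertion depends on the remaining set only through its
        span.\<close>
      also have "\<dots> = span (insert (X N q) ?X)"
        using E(3)[OF that] by (simp add: span_insert)
      finally show ?thesis .
    qed
    let ?E = "\<lambda>i. if i = N then F else E i"
    have im: "(\<lambda>i. ?E i q) ` {..<Suc N} = insert (F q) ((\<lambda>i. E i q) ` {..<N})"
      "(\<lambda>i. X i q) ` {..<Suc N} = insert (X N q) ((\<lambda>i. X i q) ` {..<N})" for q
      by (auto simp: lessThan_Suc)
    show ?case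
      by (rule exI[of _ ?E]) (auto simp: im sp FE FF E Fs less_Suc_eq)
  qed
  then show thesis using that by blast
qed

text \<open>Gram-Schmidt is applied to the coordinate fields of a chart around \<open>p\<close>,
  which form a basis of each tangent space over the chart domain.\<close>

lemma local_orthonormal_frame_exists: "\<exists>E. local_orthonormal_frame A g p E"
proof -
  obtain U c where U: "(U, c) \<in> A" "p \<in> U" by (rule chart_exists[of p]) (rule that)
  let ?N = "DIM('b)"
  obtain e where e: "bij_betw e {..<?N} (Basis :: 'b set)"
    using ex_bij_betw_nat_finite[OF finite_Basis] by (metis atLeast0LessThan)
  define X where "X i = coord_field A U c (e i)" for i :: nat
  have X: "smooth_vfield_on A U (X i)" for i
    unfolding X_def by (rule coord_field_smooth[OF U(1)])
  have eB: "e i \<in> Basis" if "i < ?N" for i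
    using bij_betw_apply[OF e] that by simp
  have einj: "e i = e j \<longleftrightarrow> i = j" if "i < ?N" "j < ?N" for i j
    using bij_betw_imp_inj_on[OF e] that by (auto simp: inj_on_def)
  have indep: "X m q \<notin> span ((\<lambda>i. X i q) ` {..<m})" if q: "q \<in> U" and m: "m < ?N" for q m
  proof
    \<comment> \<open>This coordinate function is annihilated by all earlier coordinate fields but
      not by \<open>X m\<close>.\<close>
    let ?f = "\<lambda>r. c r \<bullet> e m"
    have "subspace {v :: 'a tvec. v ?f = 0}"
      by (auto simp: subspace_def scaleR_tvec_apply)
    moreover have "(\<lambda>i. X i q) ` {..<m} \<subseteq> {v. v ?f = 0}"
      using eB einj m by (auto simp: X_def coord_field_coordinate[OF U(1) q] inner_Basis)
    ultimately have "span ((\<lambda>i. X i q) ` {..<m}) \<subseteq> {v. v ?f = 0}"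
      by (intro span_minimal)
    moreover assume "X m q \<in> span ((\<lambda>i. X i q) ` {..<m})"
    ultimately have "X m q ?f = 0" by blast
    then show False
      using eB[OF m] by (simp add: X_def coord_field_coordinate[OF U(1) q])
  qed
  have sp: "span ((\<lambda>i. X i q) ` {..<?N}) = tangent_space A q" if q: "q \<in> U" for q
  proof (intro subset_antisym span_minimal subspace_tangent_space subsetI)
    show "v \<in> tangent_space A q" if "v \<in> (\<lambda>i. X i q) ` {..<?N}" for v
      using that smooth_vfield_onD(2)[OF X q] by blast
    fix v assume v: "v \<in> tangent_space A q"
    have "coord_field A U c b q \<in> (\<lambda>i. X i q) ` {..<?N}" if "b \<in> Basis" for b
    proof -
      have "b \<in> e ` {..<?N}" using that bij_betw_imp_surj_on[OF e] by simp
      then show ?thesis unfolding X_def by auto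
    qed
    then show "v \<in> span ((\<lambda>i. X i q) ` {..<?N})"
      by (subst tangent_coord_expansion[OF U(1) q v]) (intro span_sum span_scale span_base)
  qed
  obtain E where E: "\<And>i. i < ?N \<Longrightarrow> smooth_vfield_on A U (E i)"
    "\<And>q i j. q \<in> U \<Longrightarrow> i < ?N \<Longrightarrow> j < ?N \<Longrightarrow> g q (E i q) (E j q) = (if i = j then 1 else 0)"
    "\<And>q. q \<in> U \<Longrightarrow> span ((\<lambda>i. E i q) ` {..<?N}) = span ((\<lambda>i. X i q) ` {..<?N})"
    by (rule Gram_Schmidt[OF open_chart[OF U(1)] X indep]) (assumption+, rule that)
  show ?thesis
    unfolding local_orthonormal_frame_def
    by (rule exI[of _ E], rule exI[of _ U]) (simp add: E U(2) open_chart[OF U(1)] sp)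
qed

end

section \<open>Lie brackets and connections\<close>

context manifold
begin

section \<open>Germs of vector fields\<close>

lemma tangent_cong:
  assumes "v \<in> tangent_space A p" "\<forall>\<^sub>F q in nhds p. f q = g q"
  shows "v f = v g"
proof -
  from assms(2) obtain W where "open W" "p \<in> W" "\<forall>q\<in>W. f q = g q"
    unfolding eventually_nhds by blast
  then show ?thesis using tangent_local[OF assms(1), of W f g] by simp
qed

lemma smooth_fun_near_diff:
  assumes "smooth_fun_near A p f" "smooth_fun_near A p g"
  shows "smooth_fun_near A p (\<lambda>q. f q - g q)"
  by (rule smooth_fun_near2[OF assms]) (rule smooth_fun_on_near[OF smooth_fun_on_diff])

lemma eventually_smooth_fun_near:
  assumes "smooth_fun_near A p f"
  shows "\<forall>\<^sub>F q in nhds p. smooth_fun_near A q f"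
proof -
  from assms obtain U where U: "p \<in> U" "smooth_fun_on A U f"
    unfolding smooth_fun_near_def by blast
  show ?thesis
    using eventually_nhds_in_open[OF smooth_fun_on_open[OF U(2)] U(1)]
    by eventually_elim (rule smooth_fun_on_near[OF U(2)])
qed

lemma smooth_vfield_on_near: "smooth_vfield_on A U X \<Longrightarrow> p \<in> U \<Longrightarrow> smooth_vfield_near A p X"
  unfolding smooth_vfield_near_def by blast

lemma smooth_vfield_near_tangent: "smooth_vfield_near A p X \<Longrightarrow> X p \<in> tangent_space A p"
  unfolding smooth_vfield_near_def using smooth_vfield_onD(2) by blast

lemma eventually_smooth_vfield_near:
  assumes "smooth_vfield_near A p X"
  shows "\<forall>\<^sub>F q in nhds p. smooth_vfield_near A q X"
proof -
  from assms obtain U where U: "p \<in> U" "smooth_vfield_on A U X"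
    unfolding smooth_vfield_near_def by blast
  show ?thesis
    using eventually_nhds_in_open[OF smooth_vfield_onD(1)[OF U(2)] U(1)]
    by eventually_elim (rule smooth_vfield_on_near[OF U(2)])
qed

lemma smooth_vfield_near2:
  assumes "smooth_vfield_near A p X" "smooth_vfield_near A p Y"
  obtains U where "p \<in> U" "smooth_vfield_on A U X" "smooth_vfield_on A U Y"
proof -
  from assms obtain U V where UV: "p \<in> U" "p \<in> V" "smooth_vfield_on A U X" "smooth_vfield_on A V Y"
    unfolding smooth_vfield_near_def by blast
  then have "open (U \<inter> V)" by (simp add: smooth_vfield_onD(1) open_Int)
  show thesis
  proof (rule that)
    show "p \<in> U \<inter> V" using UV by simp
    show "smooth_vfield_on A (U \<inter> V) X" "smooth_vfield_on A (U \<inter> V) Y"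
      by (rule smooth_vfield_on_subset[OF UV(3) \<open>open (U \<inter> V)\<close>], simp)
        (rule smooth_vfield_on_subset[OF UV(4) \<open>open (U \<inter> V)\<close>], simp)
  qed
qed

lemma smooth_vfield_near_cong:
  assumes "\<forall>\<^sub>F q in nhds p. X q = Y q" "smooth_vfield_near A p X"
  shows "smooth_vfield_near A p Y"
proof -
  from assms(1) obtain W where W: "open W" "p \<in> W" "\<forall>q\<in>W. X q = Y q"
    unfolding eventually_nhds by blast
  from assms(2) obtain U where U: "p \<in> U" "smooth_vfield_on A U X"
    unfolding smooth_vfield_near_def by blast
  have "smooth_vfield_on A (U \<inter> W) X"
    by (rule smooth_vfield_on_subset[OF U(2)]) (use W(1) smooth_vfield_onD(1)[OF U(2)] in auto)
  then have "smooth_vfield_on A (U \<inter> W) Y"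
    by (rule smooth_vfield_on_cong) (use W(3) in auto)
  then show ?thesis by (rule smooth_vfield_on_near) (use U W in auto)
qed

lemma smooth_vfield_near_add:
  assumes "smooth_vfield_near A p X" "smooth_vfield_near A p Y"
  shows "smooth_vfield_near A p (\<lambda>q. X q + Y q)"
  by (rule smooth_vfield_near2[OF assms]) (rule smooth_vfield_on_near[OF smooth_vfield_on_add])

lemma smooth_vfield_near_diff:
  assumes "smooth_vfield_near A p X" "smooth_vfield_near A p Y"
  shows "smooth_vfield_near A p (\<lambda>q. X q - Y q)"
  by (rule smooth_vfield_near2[OF assms]) (rule smooth_vfield_on_near[OF smooth_vfield_on_diff])

lemma smooth_vfield_near_zero: "smooth_vfield_near A p (\<lambda>q. 0)"
  by (rule smooth_vfield_on_near[OF smooth_vfield_on_zero[OF open_UNIV] UNIV_I])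

lemma smooth_vfield_near_sum:
  assumes "\<And>i. i \<in> I \<Longrightarrow> smooth_vfield_near A p (X i)"
  shows "smooth_vfield_near A p (\<lambda>q. \<Sum>i\<in>I. X i q)"
  using assms
  by (induction I rule: infinite_finite_induct)
    (auto intro: smooth_vfield_near_zero smooth_vfield_near_add)

lemma smooth_vfield_near_scale:
  assumes "smooth_fun_near A p f" "smooth_vfield_near A p X"
  shows "smooth_vfield_near A p (\<lambda>q. f q *\<^sub>R X q)"
proof -
  from assms obtain U V where UV: "p \<in> U" "p \<in> V" "smooth_fun_on A U f" "smooth_vfield_on A V X"
    unfolding smooth_fun_near_def smooth_vfield_near_def by blast
  then have op: "open (U \<inter> V)" by (simp add: smooth_vfield_onD(1) smooth_fun_on_open open_Int)
  have "smooth_vfield_on A (U \<inter> V) (\<lambda>q. f q *\<^sub>R X q)"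
    by (rule smooth_vfield_on_scale[OF smooth_fun_on_subset[OF UV(3) op] smooth_vfield_on_subset[OF UV(4) op]])
      auto
  then show ?thesis by (rule smooth_vfield_on_near) (use UV in auto)
qed

lemma smooth_fun_near_apply:
  assumes "smooth_vfield_near A p X" "smooth_fun_near A p f"
  shows "smooth_fun_near A p (\<lambda>q. X q f)"
proof -
  from assms obtain U V where UV: "p \<in> U" "p \<in> V" "smooth_fun_on A U f" "smooth_vfield_on A V X"
    unfolding smooth_fun_near_def smooth_vfield_near_def by blast
  then have op: "open (U \<inter> V)" by (simp add: smooth_vfield_onD(1) smooth_fun_on_open open_Int)
  have "smooth_fun_on A (U \<inter> V) (\<lambda>q. X q f)"
    by (rule smooth_vfield_onD(3)[OF UV(4) _ smooth_fun_on_subset[OF UV(3) op]]) auto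
  then show ?thesis by (rule smooth_fun_on_near) (use UV in auto)
qed

section \<open>Lie brackets and the Jacobi identity\<close>

lemma lie_bracket_apply:
  "smooth_fun_near A p f \<Longrightarrow> lie_bracket A X Y p f = X p (\<lambda>q. Y q f) - Y p (\<lambda>q. X q f)"
  by (simp add: lie_bracket_def)

lemma lie_bracket_tangent:
  assumes X: "smooth_vfield_near A p X" and Y: "smooth_vfield_near A p Y"
  shows "lie_bracket A X Y p \<in> tangent_space A p"
proof -
  note X_p = smooth_vfield_near_tangent[OF X] and Y_p = smooth_vfield_near_tangent[OF Y]
  note near = smooth_fun_near_apply[OF X] smooth_fun_near_apply[OF Y]
  have add: "v (\<lambda>q. Z q (\<lambda>r. f r + h r)) = v (\<lambda>q. Z q f) + v (\<lambda>q. Z q h)"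
    if "v \<in> tangent_space A p" "smooth_vfield_near A p Z" "smooth_fun_near A p f" "smooth_fun_near A p h"
    for v Z f h
  proof -
    have "\<forall>\<^sub>F q in nhds p. Z q (\<lambda>r. f r + h r) = Z q f + Z q h"
      using eventually_smooth_vfield_near[OF that(2)] eventually_smooth_fun_near[OF that(3)]
        eventually_smooth_fun_near[OF that(4)]
      by eventually_elim (rule tangent_spaceD(2)[OF smooth_vfield_near_tangent])
    from tangent_cong[OF that(1) this] show ?thesis
      by (simp add: tangent_spaceD(2)[OF that(1)] smooth_fun_near_apply that)
  qed
  have scale: "v (\<lambda>q. Z q (\<lambda>r. a * f r)) = a * v (\<lambda>q. Z q f)"
    if "v \<in> tangent_space A p" "smooth_vfield_near A p Z" "smooth_fun_near A p f" for v Z f a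
  proof -
    have "\<forall>\<^sub>F q in nhds p. Z q (\<lambda>r. a * f r) = a * Z q f"
      using eventually_smooth_vfield_near[OF that(2)] eventually_smooth_fun_near[OF that(3)]
      by eventually_elim (rule tangent_spaceD(3)[OF smooth_vfield_near_tangent])
    from tangent_cong[OF that(1) this] show ?thesis
      by (simp add: tangent_spaceD(3)[OF that(1)] smooth_fun_near_apply that)
  qed
  \<comment> \<open>The mixed products \<open>Z p h * v f + Z p f * v h\<close> are symmetric under
    exchange of the two fields, so they cancel in the bracket and the Leibniz rule remains.\<close>
  have mult: "v (\<lambda>q. Z q (\<lambda>r. f r * h r)) = f p * v (\<lambda>q. Z q h) + Z p h * v f + h p * v (\<lambda>q. Z q f) + Z p f * v h"
    if "v \<in> tangent_space A p" "smooth_vfield_near A p Z" "smooth_fun_near A p f" "smooth_fun_near A p h"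
    for v Z f h
  proof -
    have "\<forall>\<^sub>F q in nhds p. Z q (\<lambda>r. f r * h r) = f q * Z q h + h q * Z q f"
      using eventually_smooth_vfield_near[OF that(2)] eventually_smooth_fun_near[OF that(3)]
        eventually_smooth_fun_near[OF that(4)]
      by eventually_elim (rule tangent_spaceD(4)[OF smooth_vfield_near_tangent])
    from tangent_cong[OF that(1) this] show ?thesis
      by (simp add: tangent_spaceD(2,4)[OF that(1)] smooth_fun_near_apply smooth_fun_near_mult that)
  qed
  show ?thesis
    unfolding tangent_space_def mem_Collect_eq
  proof (intro conjI allI impI)
    show "lie_bracket A X Y p f = 0" if "\<not> smooth_fun_near A p f" for f
      using that by (simp add: lie_bracket_def)
  qed (simp_all add: lie_bracket_apply smooth_fun_near_add smooth_fun_near_mult smooth_fun_near_const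
      add[OF X_p Y] add[OF Y_p X] scale[OF X_p Y] scale[OF Y_p X] mult[OF X_p Y] mult[OF Y_p X]
      algebra_simps)
qed

lemma lie_bracket_smooth_near:
  assumes "smooth_vfield_near A p X" "smooth_vfield_near A p Y"
  shows "smooth_vfield_near A p (lie_bracket A X Y)"
proof (rule smooth_vfield_near2[OF assms])
  fix U assume U: "p \<in> U" "smooth_vfield_on A U X" "smooth_vfield_on A U Y"
  have "smooth_vfield_on A U (lie_bracket A X Y)"
    unfolding smooth_vfield_on_def
  proof (intro conjI ballI allI impI)
    show "lie_bracket A X Y q \<in> tangent_space A q" if "q \<in> U" for q
      by (rule lie_bracket_tangent) (use U that smooth_vfield_on_near in auto)
    fix V f assume V: "V \<subseteq> U" "smooth_fun_on A V f"
    have "smooth_fun_on A V (\<lambda>q. X q (\<lambda>r. Y r f) - Y q (\<lambda>r. X r f))"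
      by (intro smooth_fun_on_diff smooth_vfield_onD(3)[OF U(2) V(1)] smooth_vfield_onD(3)[OF U(3) V(1)] V(2))
    then show "smooth_fun_on A V (\<lambda>q. lie_bracket A X Y q f)"
      by (rule smooth_fun_on_cong) (simp add: lie_bracket_apply[OF smooth_fun_on_near[OF V(2)]])
  qed (rule smooth_vfield_onD(1)[OF U(2)])
  then show ?thesis by (rule smooth_vfield_on_near[OF _ U(1)])
qed

text \<open>The cyclic permutations of these four third-order terms give twelve terms, which cancel
  in pairs in the Jacobi identity.\<close>

lemma lie_bracket_lie_bracket_apply:
  assumes X: "smooth_vfield_near A p X" and Y: "smooth_vfield_near A p Y" and Z: "smooth_vfield_near A p Z"
    and f: "smooth_fun_near A p f"
  shows "lie_bracket A (lie_bracket A X Y) Z p f =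
    X p (\<lambda>q. Y q (\<lambda>r. Z r f)) - Y p (\<lambda>q. X q (\<lambda>r. Z r f))
    - Z p (\<lambda>q. X q (\<lambda>r. Y r f)) + Z p (\<lambda>q. Y q (\<lambda>r. X r f))"
proof -
  have "\<forall>\<^sub>F q in nhds p. lie_bracket A X Y q f = X q (\<lambda>r. Y r f) - Y q (\<lambda>r. X r f)"
    using eventually_smooth_fun_near[OF f] by eventually_elim (rule lie_bracket_apply)
  from tangent_cong[OF smooth_vfield_near_tangent[OF Z] this]
  show ?thesis
    by (simp add: lie_bracket_apply f smooth_fun_near_apply X Y Z
        tangent_diff[OF smooth_vfield_near_tangent[OF Z]])
qed

lemma Jacobi_identity:
  assumes X: "smooth_vfield_near A p X" and Y: "smooth_vfield_near A p Y" and Z: "smooth_vfield_near A p Z"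
  shows "lie_bracket A (lie_bracket A X Y) Z p + lie_bracket A (lie_bracket A Y Z) X p
    + lie_bracket A (lie_bracket A Z X) Y p = 0"
proof
  fix f
  show "(lie_bracket A (lie_bracket A X Y) Z p + lie_bracket A (lie_bracket A Y Z) X p
    + lie_bracket A (lie_bracket A Z X) Y p) f = 0 f"
  proof (cases "smooth_fun_near A p f")
    case True
    then show ?thesis
      by (simp add: lie_bracket_lie_bracket_apply X Y Z)
  next
    case False
    then show ?thesis by (simp add: lie_bracket_def)
  qed
qed

text \<open>This is \<open>d(d\<omega>)(X, Y, Z) = 0\<close>, with the invariant formula for the outer \<open>d\<close> written out.\<close>

lemma d_d_one_form:
  assumes smooth: "\<And>q X. smooth_vfield_near A q X \<Longrightarrow> smooth_fun_near A q (\<lambda>r. \<omega> r (X r))"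
    and add: "\<And>v w. v \<in> tangent_space A p \<Longrightarrow> w \<in> tangent_space A p \<Longrightarrow> \<omega> p (v + w) = \<omega> p v + \<omega> p w"
    and X: "smooth_vfield_near A p X" and Y: "smooth_vfield_near A p Y" and Z: "smooth_vfield_near A p Z"
  shows "X p (d_one_form A \<omega> Y Z) + Y p (d_one_form A \<omega> Z X) + Z p (d_one_form A \<omega> X Y)
    = d_one_form A \<omega> (lie_bracket A X Y) Z p + d_one_form A \<omega> (lie_bracket A Y Z) X p
      + d_one_form A \<omega> (lie_bracket A Z X) Y p"
proof -
  have outer: "v (d_one_form A \<omega> Y Z)
      = 1/2 * (v (\<lambda>q. Y q (\<lambda>r. \<omega> r (Z r))) - v (\<lambda>q. Z q (\<lambda>r. \<omega> r (Y r))) - v (\<lambda>r. \<omega> r (lie_bracket A Y Z r)))"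
    if "v \<in> tangent_space A p" "smooth_vfield_near A p Y" "smooth_vfield_near A p Z" for v Y Z
  proof -
    let ?w = "\<lambda>q. Y q (\<lambda>r. \<omega> r (Z r)) - Z q (\<lambda>r. \<omega> r (Y r)) - \<omega> q (lie_bracket A Y Z q)"
    have "d_one_form A \<omega> Y Z = (\<lambda>q. 1/2 * ?w q)"
      by (rule ext) (simp add: d_one_form_def)
    moreover have "smooth_fun_near A p ?w"
      using that by (simp add: smooth smooth_fun_near_diff smooth_fun_near_apply lie_bracket_smooth_near)
    ultimately have "v (d_one_form A \<omega> Y Z) = 1/2 * v ?w"
      by (simp only: tangent_spaceD(3)[OF that(1)])
    then show ?thesis
      using that
      by (simp add: smooth smooth_fun_near_diff smooth_fun_near_apply lie_bracket_smooth_near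
          tangent_diff[OF that(1)])
  qed
  let ?J = "\<lambda>X Y Z. lie_bracket A (lie_bracket A X Y) Z p"
  have J: "?J X Y Z \<in> tangent_space A p" "?J Y Z X \<in> tangent_space A p" "?J Z X Y \<in> tangent_space A p"
    by (intro lie_bracket_tangent lie_bracket_smooth_near X Y Z)+
  \<comment> \<open>The double brackets to which \<omega> is applied on the right-hand side add up
    to 0 by the Jacobi identity, and \<omega> is additive at \<open>p\<close>.\<close>
  have "\<omega> p (?J X Y Z) + \<omega> p (?J Y Z X) + \<omega> p (?J Z X Y) = \<omega> p 0"
    using Jacobi_identity[OF X Y Z] add J tangent_space_add by metis
  also have "\<omega> p 0 = 0" using add[OF tangent_space_zero tangent_space_zero] by simp
  finally show ?thesis
    using X Y Z
    by (simp add: outer smooth_vfield_near_tangent)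
      (simp add: d_one_form_def lie_bracket_apply smooth field_simps)
qed

end

section \<open>The Levi-Civita connection\<close>

locale levi_civita_manifold = riemannian_manifold A g
  for A :: "('a::{t2_space, second_countable_topology}, 'b::euclidean_space) atlas" and g +
  fixes nabla :: "'a connection"
  assumes levi_civita: "levi_civita A g nabla"
begin

lemma metric_smooth_near:
  assumes "smooth_vfield_near A p X" "smooth_vfield_near A p Y"
  shows "smooth_fun_near A p (\<lambda>q. g q (X q) (Y q))"
  by (rule smooth_vfield_near2[OF assms]) (rule smooth_fun_on_near[OF metric_smooth])

lemma affine: "affine_connection A nabla"
  using levi_civita unfolding levi_civita_def by blast

lemma nabla_tangent:
  "v \<in> tangent_space A p \<Longrightarrow> smooth_vfield_near A p Y \<Longrightarrow> nabla p v Y \<in> tangent_space A p"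
  using affine unfolding affine_connection_def by blast

lemma nabla_lin:
  "v \<in> tangent_space A p \<Longrightarrow> w \<in> tangent_space A p \<Longrightarrow> smooth_vfield_near A p Y \<Longrightarrow>
    nabla p (a *\<^sub>R v + b *\<^sub>R w) Y = a *\<^sub>R nabla p v Y + b *\<^sub>R nabla p w Y"
  using affine unfolding affine_connection_def by blast

lemma nabla_add:
  "v \<in> tangent_space A p \<Longrightarrow> smooth_vfield_near A p Y \<Longrightarrow> smooth_vfield_near A p Z \<Longrightarrow>
    nabla p v (\<lambda>q. Y q + Z q) = nabla p v Y + nabla p v Z"
  using affine unfolding affine_connection_def by blast

lemma nabla_leibniz:
  "v \<in> tangent_space A p \<Longrightarrow> smooth_fun_near A p f \<Longrightarrow> smooth_vfield_near A p Y \<Longrightarrow>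
    nabla p v (\<lambda>q. f q *\<^sub>R Y q) = v f *\<^sub>R Y p + f p *\<^sub>R nabla p v Y"
  using affine unfolding affine_connection_def by blast

lemma nabla_smooth_near:
  assumes "smooth_vfield_near A p X" "smooth_vfield_near A p Y"
  shows "smooth_vfield_near A p (\<lambda>q. nabla q (X q) Y)"
proof (rule smooth_vfield_near2[OF assms])
  fix U assume U: "p \<in> U" "smooth_vfield_on A U X" "smooth_vfield_on A U Y"
  then have "smooth_vfield_on A U (\<lambda>p. nabla p (X p) Y)"
    using affine unfolding affine_connection_def by simp
  then show ?thesis using U(1) by (rule smooth_vfield_on_near)
qed

lemma torsion_free:
  "smooth_vfield_near A p X \<Longrightarrow> smooth_vfield_near A p Y \<Longrightarrow>
    lie_bracket A X Y p = nabla p (X p) Y - nabla p (Y p) X"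
  using levi_civita unfolding levi_civita_def by simp

lemma metric_compatible:
  "v \<in> tangent_space A p \<Longrightarrow> smooth_vfield_near A p Y \<Longrightarrow> smooth_vfield_near A p Z \<Longrightarrow>
    v (\<lambda>q. g q (Y q) (Z q)) = g p (nabla p v Y) (Z p) + g p (Y p) (nabla p v Z)"
  using levi_civita unfolding levi_civita_def by blast

lemma nabla_dir_add:
  "v \<in> tangent_space A p \<Longrightarrow> w \<in> tangent_space A p \<Longrightarrow> smooth_vfield_near A p Y \<Longrightarrow>
    nabla p (v + w) Y = nabla p v Y + nabla p w Y"
  using nabla_lin[of v p w Y 1 1] by simp

lemma nabla_dir_scale:
  "v \<in> tangent_space A p \<Longrightarrow> smooth_vfield_near A p Y \<Longrightarrow> nabla p (a *\<^sub>R v) Y = a *\<^sub>R nabla p v Y"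
  using nabla_lin[of v p v Y a 0] by simp

text \<open>Multiplying a field by an indicator function leaves its covariant derivative unchanged,
  by the Leibniz rule, and makes the two fields equal everywhere.\<close>

lemma nabla_cong:
  assumes v: "v \<in> tangent_space A p" and Y: "smooth_vfield_near A p Y"
    and eq: "\<forall>\<^sub>F q in nhds p. Y q = Z q"
  shows "nabla p v Y = nabla p v Z"
proof -
  from eq obtain W where W: "open W" "p \<in> W" "\<forall>q\<in>W. Y q = Z q"
    unfolding eventually_nhds by blast
  have *: "nabla p v (\<lambda>q. indicat_real W q *\<^sub>R X q) = nabla p v X" if "smooth_vfield_near A p X" for X
    using nabla_leibniz[OF v smooth_fun_near_indicator[OF W(1,2)] that] W(2)
      tangent_indicator[OF v W(1,2)] by simp
  have "(\<lambda>q. indicat_real W q *\<^sub>R Y q) = (\<lambda>q. indicat_real W q *\<^sub>R Z q)"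
  proof
    show "indicat_real W q *\<^sub>R Y q = indicat_real W q *\<^sub>R Z q" for q
      by (cases "q \<in> W") (use W(3) in simp_all)
  qed
  then show ?thesis
    using *[OF Y] *[OF smooth_vfield_near_cong[OF eq Y]] by simp
qed

lemma nabla_scale:
  assumes "v \<in> tangent_space A p" "smooth_vfield_near A p Y"
  shows "nabla p v (\<lambda>q. a *\<^sub>R Y q) = a *\<^sub>R nabla p v Y"
  using nabla_leibniz[OF assms(1) smooth_fun_near_const assms(2), of a] tangent_const[OF assms(1)]
  by simp

lemma nabla_diff:
  assumes v: "v \<in> tangent_space A p" and Y: "smooth_vfield_near A p Y" and Z: "smooth_vfield_near A p Z"
  shows "nabla p v (\<lambda>q. Y q - Z q) = nabla p v Y - nabla p v Z"
  using nabla_add[OF v Y smooth_vfield_near_scale[OF smooth_fun_near_const Z], of "-1"]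
    nabla_scale[OF v Z, of "-1"] by simp

lemma nabla_zero: "v \<in> tangent_space A p \<Longrightarrow> nabla p v (\<lambda>q. 0) = 0"
  using nabla_scale[OF _ smooth_vfield_near_zero, of v p 0] by simp

lemma nabla_sum:
  assumes v: "v \<in> tangent_space A p" and "\<And>i. i \<in> I \<Longrightarrow> smooth_vfield_near A p (Y i)"
  shows "nabla p v (\<lambda>q. \<Sum>i\<in>I. Y i q) = (\<Sum>i\<in>I. nabla p v (Y i))"
  using assms(2)
  by (induction I rule: infinite_finite_induct)
    (auto simp: nabla_zero[OF v] nabla_add[OF v] smooth_vfield_near_sum)

end

text \<open>From here on, tangent vectors are elements of an abstract vector space, and unfolding their
  pointwise operations only hurts.\<close>

declare plus_fun_apply [simp del] minus_apply [simp del] uminus_apply [simp del]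
  zero_fun_apply [simp del]

section \<open>Expansions in orthonormal frames and traces\<close>

context riemannian_manifold
begin

lemma metric_eqI:
  assumes "v \<in> tangent_space A p" "w \<in> tangent_space A p"
    and "\<And>u. u \<in> tangent_space A p \<Longrightarrow> g p v u = g p w u"
  shows "v = w"
proof (rule ccontr)
  assume "v \<noteq> w"
  moreover have d: "v - w \<in> tangent_space A p" using assms by (simp add: tangent_space_diff)
  ultimately have "g p (v - w) (v - w) > 0" by (intro metric_pos) auto
  then show False using assms(3)[OF d] assms(1,2) d by (simp add: metric_diff)
qed

text \<open>The vectors that equal their expansion form a subspace, which contains every
  \<open>e j\<close> by orthonormality.\<close>

lemma orthonormal_expansion:
  assumes "tangent_space A q = span (e ` {..<N})"
    and "\<And>i j. i < N \<Longrightarrow> j < N \<Longrightarrow> g q (e i) (e j) = (if i = j then 1 else 0)"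
    and v: "v \<in> tangent_space A q"
  shows "v = (\<Sum>i<N::nat. g q v (e i) *\<^sub>R e i)"
proof -
  have e: "e i \<in> tangent_space A q" if "i < N" for i
    using that assms(1) span_base[of "e i" "e ` {..<N}"] by auto
  let ?S = "{v \<in> tangent_space A q. v = (\<Sum>i<N. g q v (e i) *\<^sub>R e i)}"
  have "subspace ?S"
    unfolding subspace_def
  proof (intro conjI ballI allI)
    show "0 \<in> ?S" using e by (simp add: tangent_space_zero metric_zero)
    show "v + w \<in> ?S" if "v \<in> ?S" "w \<in> ?S" for v w
    proof -
      have "(\<Sum>i<N. g q (v + w) (e i) *\<^sub>R e i) = (\<Sum>i<N. g q v (e i) *\<^sub>R e i) + (\<Sum>i<N. g q w (e i) *\<^sub>R e i)"
        using conjunct1[OF that(1)[unfolded mem_Collect_eq]] conjunct1[OF that(2)[unfolded mem_Collect_eq]] e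
        by (simp add: metric_add scaleR_add_left sum.distrib)
      then show ?thesis using that by (simp add: tangent_space_add)
    qed
    show "c *\<^sub>R v \<in> ?S" if "v \<in> ?S" for v c
    proof -
      have "(\<Sum>i<N. g q (c *\<^sub>R v) (e i) *\<^sub>R e i) = c *\<^sub>R (\<Sum>i<N. g q v (e i) *\<^sub>R e i)"
        using conjunct1[OF that[unfolded mem_Collect_eq]] e by (simp add: metric_scale scaleR_sum_right)
      then show ?thesis using that by (simp add: tangent_space_scale)
    qed
  qed
  moreover have "e ` {..<N} \<subseteq> ?S"
  proof (intro image_subsetI CollectI conjI)
    fix j assume j: "j \<in> {..<N}"
    have "(\<Sum>i<N. g q (e j) (e i) *\<^sub>R e i) = (\<Sum>i<N. if i = j then e j else 0)"
      using j by (intro sum.cong) (auto simp: assms(2))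
    then show "e j = (\<Sum>i<N. g q (e j) (e i) *\<^sub>R e i)" using j by simp
  qed (use e in auto)
  ultimately have "span (e ` {..<N}) \<subseteq> ?S" by (intro span_minimal)
  with v assms(1) show ?thesis by blast
qed

lemma onframe: "local_orthonormal_frame A g p (onframe A g p)"
  unfolding onframe_def by (rule someI_ex[OF local_orthonormal_frame_exists])

lemma onframe_near: "i < DIM('b) \<Longrightarrow> smooth_vfield_near A p (onframe A g p i)"
  using onframe[of p] unfolding local_orthonormal_frame_def smooth_vfield_near_def by auto

lemma onframe_tangent: "i < DIM('b) \<Longrightarrow> onframe A g p i p \<in> tangent_space A p"
  by (rule smooth_vfield_near_tangent[OF onframe_near])

text \<open>The frame chosen at \<open>p\<close> serves a whole neighbourhood, so expansions in it
  can be differentiated at \<open>p\<close>.\<close>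

lemma eventually_onframe_expansion:
  "\<forall>\<^sub>F q in nhds p. \<forall>v\<in>tangent_space A q.
    v = (\<Sum>i<DIM('b). g q v (onframe A g p i q) *\<^sub>R onframe A g p i q)"
proof -
  obtain U where U: "p \<in> U" "open U"
    "\<And>q. q \<in> U \<Longrightarrow> tangent_space A q = span ((\<lambda>i. onframe A g p i q) ` {..<DIM('b)})"
    "\<And>q i j. q \<in> U \<Longrightarrow> i < DIM('b) \<Longrightarrow> j < DIM('b) \<Longrightarrow>
      g q (onframe A g p i q) (onframe A g p j q) = (if i = j then 1 else 0)"
    using onframe[of p] unfolding local_orthonormal_frame_def by auto
  show ?thesis
    using eventually_nhds_in_open[OF U(2,1)]
  proof eventually_elim
    case (elim q)
    show ?case by (intro ballI orthonormal_expansion[OF U(3)[OF elim] U(4)[OF elim]])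
  qed
qed

lemma onframe_expansion:
  "v \<in> tangent_space A p \<Longrightarrow>
    v = (\<Sum>i<DIM('b). g p v (onframe A g p i p) *\<^sub>R onframe A g p i p)"
  using eventually_nhds_x_imp_x[OF eventually_onframe_expansion[of p]] by blast

lemma onframe_Parseval:
  assumes v: "v \<in> tangent_space A p" and w: "w \<in> tangent_space A p"
  shows "(\<Sum>i<DIM('b). g p v (onframe A g p i p) * g p w (onframe A g p i p)) = g p v w"
proof -
  have "g p v w = g p (\<Sum>i<DIM('b). g p v (onframe A g p i p) *\<^sub>R onframe A g p i p) w"
    using onframe_expansion[OF v] by simp
  also have "\<dots> = (\<Sum>i<DIM('b). g p v (onframe A g p i p) * g p (onframe A g p i p) w)"
    using w by (subst metric_sum) (auto simp: metric_scale onframe_tangent intro!: tangent_space_scale)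
  also have "\<dots> = (\<Sum>i<DIM('b). g p v (onframe A g p i p) * g p w (onframe A g p i p))"
    using metric_sym[OF w onframe_tangent] by (intro sum.cong) simp_all
  finally show ?thesis by simp
qed

text \<open>The coefficients are constant and only the frame varies with \<open>q\<close>. Every
  tangent vector thus gets a smooth local extension, on which derivatives of tensors can be
  evaluated.\<close>

definition extend :: "'a \<Rightarrow> 'a tvec \<Rightarrow> 'a vfield" where
  "extend p v q = (\<Sum>i<DIM('b). g p v (onframe A g p i p) *\<^sub>R onframe A g p i q)"

lemma extend_near: "smooth_vfield_near A p (extend p v)"
  unfolding extend_def
  by (intro smooth_vfield_near_sum smooth_vfield_near_scale smooth_fun_near_const onframe_near) simp

lemma extend_at: "v \<in> tangent_space A p \<Longrightarrow> extend p v p = v"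
  unfolding extend_def using onframe_expansion[of v p] by simp

text \<open>Expanding \<open>L\<close> on frame vectors turns both traces into double sums over the
  matrix of \<open>L\<close> and the values of the bilinear \<open>F\<close>; skewness of the matrix
  and an exchange of summation relate them. With \<phi> for \<open>L\<close>, this does the work of
  a frame adapted to \<phi>.\<close>

lemma trace_skew:
  assumes L: "\<And>v. v \<in> tangent_space A p \<Longrightarrow> L v \<in> tangent_space A p"
    and skew: "\<And>v w. v \<in> tangent_space A p \<Longrightarrow> w \<in> tangent_space A p \<Longrightarrow> g p (L v) w = - g p v (L w)"
    and F_add: "\<And>u v w. u \<in> tangent_space A p \<Longrightarrow> v \<in> tangent_space A p \<Longrightarrow> w \<in> tangent_space A p \<Longrightarrow>
      F (u + v) w = F u w + F v w \<and> F w (u + v) = F w u + F w v"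
    and F_scale: "\<And>a v w. v \<in> tangent_space A p \<Longrightarrow> w \<in> tangent_space A p \<Longrightarrow>
      F (a *\<^sub>R v) w = a * F v w \<and> F w (a *\<^sub>R v) = a * F w v"
  shows "(\<Sum>i<DIM('b). F (L (onframe A g p i p)) (onframe A g p i p))
    = - (\<Sum>i<DIM('b). F (onframe A g p i p) (L (onframe A g p i p)))" (is "?l = - ?r")
proof -
  let ?e = "\<lambda>i. onframe A g p i p"
  have F_zero: "F 0 w = 0" "F w 0 = 0" if "w \<in> tangent_space A p" for w
    using F_scale[OF that that, of 0] by auto
  have F_sum: "F (\<Sum>i\<in>I. c i *\<^sub>R ?e i) w = (\<Sum>i\<in>I. c i * F (?e i) w)"
    "F w (\<Sum>i\<in>I. c i *\<^sub>R ?e i) = (\<Sum>i\<in>I. c i * F w (?e i))"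
    if "I \<subseteq> {..<DIM('b)}" "w \<in> tangent_space A p" for I c w
  proof -
    have "finite I" using that(1) by (rule finite_subset) simp
    then have "F (\<Sum>i\<in>I. c i *\<^sub>R ?e i) w = (\<Sum>i\<in>I. c i * F (?e i) w) \<and>
      F w (\<Sum>i\<in>I. c i *\<^sub>R ?e i) = (\<Sum>i\<in>I. c i * F w (?e i))"
      using that(1)
    proof (induction I rule: finite_induct)
      case (insert i I)
      then have "?e j \<in> tangent_space A p" if "j \<in> insert i I" for j
        using that onframe_tangent by blast
      then have e: "?e i \<in> tangent_space A p" and "(\<Sum>i\<in>I. c i *\<^sub>R ?e i) \<in> tangent_space A p"
        by (auto intro!: tangent_space_sum tangent_space_scale)
      then have "F (c i *\<^sub>R ?e i + (\<Sum>i\<in>I. c i *\<^sub>R ?e i)) w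
          = F (c i *\<^sub>R ?e i) w + F (\<Sum>i\<in>I. c i *\<^sub>R ?e i) w \<and>
        F w (c i *\<^sub>R ?e i + (\<Sum>i\<in>I. c i *\<^sub>R ?e i))
          = F w (c i *\<^sub>R ?e i) + F w (\<Sum>i\<in>I. c i *\<^sub>R ?e i)"
        using that(2) by (intro F_add tangent_space_scale)
      moreover have "F (\<Sum>i\<in>I. c i *\<^sub>R ?e i) w = (\<Sum>i\<in>I. c i * F (?e i) w) \<and>
        F w (\<Sum>i\<in>I. c i *\<^sub>R ?e i) = (\<Sum>i\<in>I. c i * F w (?e i))"
        using insert by simp
      ultimately show ?case
        using F_scale[OF e that(2), of "c i"] by (simp only: sum.insert[OF insert.hyps] simp_thms)
    qed (simp add: F_zero that(2))
    then show "F (\<Sum>i\<in>I. c i *\<^sub>R ?e i) w = (\<Sum>i\<in>I. c i * F (?e i) w)"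
      "F w (\<Sum>i\<in>I. c i *\<^sub>R ?e i) = (\<Sum>i\<in>I. c i * F w (?e i))" by auto
  qed
  have "?l = (\<Sum>i<DIM('b). \<Sum>j<DIM('b). g p (L (?e i)) (?e j) * F (?e j) (?e i))"
  proof (rule sum.cong[OF refl])
    fix i assume "i \<in> {..<DIM('b)}"
    then have i: "?e i \<in> tangent_space A p" by (simp add: onframe_tangent)
    have "F (L (?e i)) (?e i) = F (\<Sum>j<DIM('b). g p (L (?e i)) (?e j) *\<^sub>R ?e j) (?e i)"
      using onframe_expansion[OF L[OF i]] by simp
    then show "F (L (?e i)) (?e i) = (\<Sum>j<DIM('b). g p (L (?e i)) (?e j) * F (?e j) (?e i))"
      using i by (simp add: F_sum)
  qed
  also have "\<dots> = (\<Sum>j<DIM('b). \<Sum>i<DIM('b). g p (L (?e i)) (?e j) * F (?e j) (?e i))"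
    by (rule sum.swap)
  also have "\<dots> = (\<Sum>j<DIM('b). - F (?e j) (L (?e j)))"
  proof (rule sum.cong[OF refl])
    fix j assume "j \<in> {..<DIM('b)}"
    then have j: "?e j \<in> tangent_space A p" by (simp add: onframe_tangent)
    have "F (?e j) (L (?e j)) = F (?e j) (\<Sum>i<DIM('b). g p (L (?e j)) (?e i) *\<^sub>R ?e i)"
      using onframe_expansion[OF L[OF j]] by simp
    also have "\<dots> = (\<Sum>i<DIM('b). g p (L (?e j)) (?e i) * F (?e j) (?e i))"
      using j by (simp add: F_sum)
    also have "\<dots> = (\<Sum>i<DIM('b). - (g p (L (?e i)) (?e j) * F (?e j) (?e i)))"
    proof (rule sum.cong[OF refl])
      fix i assume "i \<in> {..<DIM('b)}"
      then have "?e i \<in> tangent_space A p" by (simp add: onframe_tangent)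
      then have "g p (L (?e j)) (?e i) = - g p (L (?e i)) (?e j)"
        using skew[OF j, of "?e i"] metric_sym[OF j L, of "?e i"] by simp
      then show "g p (L (?e j)) (?e i) * F (?e j) (?e i) = - (g p (L (?e i)) (?e j) * F (?e j) (?e i))"
        by simp
    qed
    finally show "(\<Sum>i<DIM('b). g p (L (?e i)) (?e j) * F (?e j) (?e i)) = - F (?e j) (L (?e j))"
      by (simp add: sum_negf)
  qed
  finally show ?thesis by (simp add: sum_negf)
qed

end

section \<open>Contact metric structures\<close>

locale contact_manifold = levi_civita_manifold A g nabla
  for A :: "('a::{t2_space, second_countable_topology}, 'b::euclidean_space) atlas" and g nabla +
  fixes \<phi> :: "'a endo_field" and \<xi> :: "'a vfield"
  assumes contact: "contact_metric A g \<phi> \<xi>"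
begin

abbreviation "T \<equiv> tangent_space A"

lemma almost_contact: "almost_contact_metric A g \<phi> \<xi>"
  using contact unfolding contact_metric_def by blast

lemma phi_endo: "smooth_endo_field A \<phi>"
  using almost_contact unfolding almost_contact_metric_def by blast

lemma phi_tangent: "v \<in> T p \<Longrightarrow> \<phi> p v \<in> T p"
  using phi_endo unfolding smooth_endo_field_def by simp

lemma phi_lin: "v \<in> T p \<Longrightarrow> w \<in> T p \<Longrightarrow> \<phi> p (a *\<^sub>R v + b *\<^sub>R w) = a *\<^sub>R \<phi> p v + b *\<^sub>R \<phi> p w"
  using phi_endo unfolding smooth_endo_field_def by simp

lemma phi_smooth_near:
  assumes "smooth_vfield_near A p X"
  shows "smooth_vfield_near A p (\<lambda>q. \<phi> q (X q))"
proof -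
  from assms obtain U where U: "p \<in> U" "smooth_vfield_on A U X"
    unfolding smooth_vfield_near_def by blast
  then have "smooth_vfield_on A U (\<lambda>q. \<phi> q (X q))"
    using phi_endo unfolding smooth_endo_field_def by simp
  then show ?thesis using U(1) by (rule smooth_vfield_on_near)
qed

lemma xi_smooth_near: "smooth_vfield_near A p \<xi>"
  using almost_contact smooth_vfield_on_near unfolding almost_contact_metric_def by blast

lemma xi_tangent: "\<xi> p \<in> T p"
  by (rule smooth_vfield_near_tangent[OF xi_smooth_near])

lemma xi_unit: "g p (\<xi> p) (\<xi> p) = 1"
  using almost_contact unfolding almost_contact_metric_def by blast

lemma phi_phi: "v \<in> T p \<Longrightarrow> \<phi> p (\<phi> p v) = - v + g p (\<xi> p) v *\<^sub>R \<xi> p"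
  using almost_contact unfolding almost_contact_metric_def eta_def by blast

lemma metric_phi_phi:
  "v \<in> T p \<Longrightarrow> w \<in> T p \<Longrightarrow> g p (\<phi> p v) (\<phi> p w) = g p v w - g p (\<xi> p) v * g p (\<xi> p) w"
  using almost_contact unfolding almost_contact_metric_def eta_def by blast

lemma phi_add: "v \<in> T p \<Longrightarrow> w \<in> T p \<Longrightarrow> \<phi> p (v + w) = \<phi> p v + \<phi> p w"
  using phi_lin[of v p w 1 1] by simp

lemma phi_scale: "v \<in> T p \<Longrightarrow> \<phi> p (a *\<^sub>R v) = a *\<^sub>R \<phi> p v"
  using phi_lin[of v p v a 0] by simp

lemma phi_minus: "v \<in> T p \<Longrightarrow> \<phi> p (- v) = - \<phi> p v"
  using phi_scale[of v p "-1"] by simp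

lemma phi_diff: "v \<in> T p \<Longrightarrow> w \<in> T p \<Longrightarrow> \<phi> p (v - w) = \<phi> p v - \<phi> p w"
  using phi_lin[of v p w 1 "-1"] by simp

lemma phi_zero: "\<phi> p 0 = 0"
  using phi_scale[OF xi_tangent, of p 0] by simp

lemma phi_sum: "\<forall>i\<in>I. v i \<in> T p \<Longrightarrow> \<phi> p (\<Sum>i\<in>I. v i) = (\<Sum>i\<in>I. \<phi> p (v i))"
  by (induction I rule: infinite_finite_induct) (auto simp: phi_zero phi_add tangent_space_sum)

lemmas tangent = phi_tangent xi_tangent tangent_space_zero tangent_space_add tangent_space_diff
  tangent_space_scale tangent_space_neg

lemmas metric_linear = metric_add metric_diff metric_scale metric_minus metric_zero

text \<open>The compatibility of the metric with \<phi> gives \<phi> \<xi> the squared length 1 - 1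
  = 0.\<close>

lemma phi_xi: "\<phi> p (\<xi> p) = 0"
proof -
  have "g p (\<phi> p (\<xi> p)) (\<phi> p (\<xi> p)) = 0"
    by (simp add: metric_phi_phi xi_tangent xi_unit)
  then show ?thesis using metric_pos[OF phi_tangent[OF xi_tangent]] by force
qed

text \<open>The cube of \<phi> can be reduced in two ways: one gives - \<phi> v, the other has the
  extra term g(\<xi>, \<phi> v) \<xi>, which must therefore vanish.\<close>

lemma
  assumes "v \<in> T p"
  shows xi_phi: "g p (\<xi> p) (\<phi> p v) = 0" and phi_orth_xi: "g p (\<phi> p v) (\<xi> p) = 0"
proof -
  have "\<phi> p (\<phi> p (\<phi> p v)) = - \<phi> p v"
    using assms by (simp add: phi_phi[of v] phi_diff phi_scale phi_xi tangent)
  then have "g p (\<xi> p) (\<phi> p v) *\<^sub>R \<xi> p = 0"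
    using phi_phi[OF phi_tangent[OF assms]] by simp
  moreover have "\<xi> p \<noteq> 0" using xi_unit[of p] metric_zero[OF xi_tangent, of p] by auto
  ultimately show "g p (\<xi> p) (\<phi> p v) = 0" by simp
  then show "g p (\<phi> p v) (\<xi> p) = 0" using metric_sym[OF phi_tangent[OF assms] xi_tangent] by simp
qed

text \<open>Compatibility is applied to \<open>v\<close> and \<open>\<phi> p w\<close>, where the
  \<eta>-terms vanish by \<open>xi_phi\<close>; then \<open>\<phi>\<^sup>2\<close> is resolved by
  \<open>phi_phi\<close>.\<close>

lemma phi_skew:
  assumes "v \<in> T p" "w \<in> T p"
  shows "g p (\<phi> p v) w = - g p v (\<phi> p w)"
proof -
  have "g p (\<phi> p v) (\<phi> p (\<phi> p w)) = g p v (\<phi> p w)"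
    using assms by (simp add: metric_phi_phi xi_phi tangent)
  then show ?thesis
    using assms by (simp add: phi_phi metric_linear tangent phi_orth_xi)
qed

section \<open>The covariant derivative of \<xi>\<close>

abbreviation "B p v \<equiv> nabla p v \<xi>"

lemma B_tangent: "v \<in> T p \<Longrightarrow> B p v \<in> T p"
  by (rule nabla_tangent[OF _ xi_smooth_near])

lemma B_add: "v \<in> T p \<Longrightarrow> w \<in> T p \<Longrightarrow> B p (v + w) = B p v + B p w"
  by (rule nabla_dir_add[OF _ _ xi_smooth_near])

lemma B_scale: "v \<in> T p \<Longrightarrow> B p (a *\<^sub>R v) = a *\<^sub>R B p v"
  by (rule nabla_dir_scale[OF _ xi_smooth_near])

text \<open>Half the derivative of the constant function g(\<xi>, \<xi>) = 1.\<close>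

lemma
  assumes v: "v \<in> T p"
  shows B_orth_xi: "g p (B p v) (\<xi> p) = 0" and xi_B: "g p (\<xi> p) (B p v) = 0"
proof -
  have "v (\<lambda>q. g q (\<xi> q) (\<xi> q)) = 0" by (simp add: xi_unit tangent_const[OF v])
  then show "g p (B p v) (\<xi> p) = 0"
    using metric_compatible[OF v xi_smooth_near xi_smooth_near]
      metric_sym[OF B_tangent[OF v] xi_tangent] by simp
  then show "g p (\<xi> p) (B p v) = 0"
    using metric_sym[OF B_tangent[OF v] xi_tangent] by simp
qed

lemma d_eta:
  "smooth_vfield_near A p X \<Longrightarrow> smooth_vfield_near A p Y \<Longrightarrow>
    d_one_form A (eta g \<xi>) X Y p = g p (X p) (\<phi> p (Y p))"
  using contact unfolding contact_metric_def by blast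

text \<open>Metric compatibility and vanishing torsion reduce the formula for d\<eta> on extensions
  of \<open>v\<close> and \<open>w\<close> to half of the left-hand side; the derivatives of the
  extensions drop out. The contact condition supplies the value.\<close>

lemma B_antisym:
  assumes v: "v \<in> T p" and w: "w \<in> T p"
  shows "g p (B p v) w - g p v (B p w) = 2 * g p v (\<phi> p w)"
proof -
  note V = extend_near[of p v] and W = extend_near[of p w]
  have "g p v (\<phi> p w) = 1/2 * (v (\<lambda>q. g q (\<xi> q) (extend p w q)) - w (\<lambda>q. g q (\<xi> q) (extend p v q))
      - g p (\<xi> p) (lie_bracket A (extend p v) (extend p w) p))"
    using d_eta[OF V W] by (simp add: d_one_form_def eta_def extend_at v w)
  also have "\<dots> = 1/2 * (g p (B p v) w - g p (B p w) v)"
    by (simp add: metric_compatible[OF v xi_smooth_near W] metric_compatible[OF w xi_smooth_near V]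
        torsion_free V W extend_at v w metric_diff nabla_tangent xi_tangent)
  finally show ?thesis using metric_sym[OF B_tangent[OF w] v] by simp
qed

section \<open>The covariant derivative of \<phi>\<close>

text \<open>This is \<open>(\<nabla>\<^sub>v \<phi>) w\<close>; that the extension of \<open>w\<close> does not matter is \<open>nabla_phi\<close> below.\<close>

definition Dphi :: "'a \<Rightarrow> 'a tvec \<Rightarrow> 'a tvec \<Rightarrow> 'a tvec" where
  "Dphi p v w = nabla p v (\<lambda>q. \<phi> q (extend p w q)) - \<phi> p (nabla p v (extend p w))"

lemma Dphi_tangent: "v \<in> T p \<Longrightarrow> Dphi p v w \<in> T p"
  unfolding Dphi_def by (intro tangent nabla_tangent phi_smooth_near extend_near)

lemma eventually_tangent: "smooth_vfield_near A p X \<Longrightarrow> \<forall>\<^sub>F q in nhds p. X q \<in> T q"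
  by (drule eventually_smooth_vfield_near)
    (auto elim: eventually_mono intro: smooth_vfield_near_tangent)

text \<open>This is the tensoriality of \<nabla>\<phi>. The frame coefficients of \<open>Z\<close>
  vanish at \<open>p\<close>, so by the Leibniz rule only their derivatives survive, and \<phi> acts
  on the frame vectors alone.\<close>

lemma nabla_phi_vanishing:
  assumes v: "v \<in> T p" and Z: "smooth_vfield_near A p Z" and "Z p = 0"
  shows "nabla p v (\<lambda>q. \<phi> q (Z q)) = \<phi> p (nabla p v Z)"
proof -
  let ?E = "onframe A g p" and ?N = "DIM('b)"
  let ?f = "\<lambda>i q. g q (Z q) (?E i q)"
  have f: "smooth_fun_near A p (?f i)" "?f i p = 0" if "i < ?N" for i
    using metric_smooth_near[OF Z onframe_near[OF that]] assms(3) onframe_tangent[OF that]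
    by (simp_all add: metric_zero)
  have exp: "\<forall>\<^sub>F q in nhds p. Z q = (\<Sum>i<?N. ?f i q *\<^sub>R ?E i q)"
    using eventually_onframe_expansion[of p] eventually_tangent[OF Z]
    by eventually_elim blast
  have "\<forall>\<^sub>F q in nhds p. \<forall>i\<in>{..<?N}. ?E i q \<in> T q"
    by (rule eventually_ball_finite) (auto intro: eventually_tangent onframe_near)
  with exp have exp': "\<forall>\<^sub>F q in nhds p. \<phi> q (Z q) = (\<Sum>i<?N. ?f i q *\<^sub>R \<phi> q (?E i q))"
  proof eventually_elim
    case (elim q)
    have "\<phi> q (Z q) = \<phi> q (\<Sum>i<?N. ?f i q *\<^sub>R ?E i q)" by (rule arg_cong[OF elim(1)])
    also have "\<dots> = (\<Sum>i<?N. ?f i q *\<^sub>R \<phi> q (?E i q))"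
      using elim(2) by (simp add: phi_sum phi_scale tangent)
    finally show ?case .
  qed
  have "nabla p v Z = (\<Sum>i<?N. v (?f i) *\<^sub>R ?E i p)"
    using nabla_cong[OF v Z exp]
    by (subst (asm) nabla_sum[OF v])
      (auto simp: nabla_leibniz[OF v] f onframe_near intro!: smooth_vfield_near_scale)
  moreover have "nabla p v (\<lambda>q. \<phi> q (Z q)) = (\<Sum>i<?N. v (?f i) *\<^sub>R \<phi> p (?E i p))"
    using nabla_cong[OF v phi_smooth_near[OF Z] exp']
    by (subst (asm) nabla_sum[OF v])
      (auto simp: nabla_leibniz[OF v] f onframe_near phi_smooth_near intro!: smooth_vfield_near_scale)
  ultimately show ?thesis
    by (simp add: phi_sum phi_scale tangent onframe_tangent)
qed

text \<open>The difference of \<open>Y\<close> and the extension of \<open>Y p\<close> vanishes at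
  \<open>p\<close>, so \<open>nabla_phi_vanishing\<close> applies to it.\<close>

lemma nabla_phi:
  assumes v: "v \<in> T p" and Y: "smooth_vfield_near A p Y"
  shows "nabla p v (\<lambda>q. \<phi> q (Y q)) = Dphi p v (Y p) + \<phi> p (nabla p v Y)"
proof -
  let ?X = "extend p (Y p)"
  let ?D = "\<lambda>q. Y q - ?X q"
  note X = extend_near[of p "Y p"]
  have D: "smooth_vfield_near A p ?D" by (rule smooth_vfield_near_diff[OF Y X])
  have "?D p = 0" by (simp add: extend_at smooth_vfield_near_tangent[OF Y])
  from nabla_phi_vanishing[OF v D this]
  have "nabla p v (\<lambda>q. \<phi> q (?D q)) = \<phi> p (nabla p v Y) - \<phi> p (nabla p v ?X)"
    by (simp add: nabla_diff[OF v Y X] phi_diff nabla_tangent v X Y)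
  moreover have "\<forall>\<^sub>F q in nhds p. \<phi> q (?D q) = \<phi> q (Y q) - \<phi> q (?X q)"
    using eventually_tangent[OF Y] eventually_tangent[OF X]
    by eventually_elim (rule phi_diff)
  from nabla_cong[OF v phi_smooth_near[OF D] this]
  have "nabla p v (\<lambda>q. \<phi> q (?D q)) = nabla p v (\<lambda>q. \<phi> q (Y q)) - nabla p v (\<lambda>q. \<phi> q (?X q))"
    by (simp add: nabla_diff[OF v] phi_smooth_near X Y)
  ultimately show ?thesis by (simp add: Dphi_def algebra_simps)
qed

lemma Dphi_add_left: "u \<in> T p \<Longrightarrow> v \<in> T p \<Longrightarrow> Dphi p (u + v) w = Dphi p u w + Dphi p v w"
  unfolding Dphi_def
  by (simp add: nabla_dir_add phi_smooth_near extend_near phi_add nabla_tangent)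

lemma Dphi_scale_left: "v \<in> T p \<Longrightarrow> Dphi p (a *\<^sub>R v) w = a *\<^sub>R Dphi p v w"
  unfolding Dphi_def
  by (simp add: nabla_dir_scale phi_smooth_near extend_near phi_scale nabla_tangent scaleR_diff_right)

text \<open>The skewness of \<phi> is differentiated along \<open>v\<close>; the derivatives of the
  extensions cancel by that same skewness.\<close>

lemma Dphi_skew:
  assumes v: "v \<in> T p" and w: "w \<in> T p" and u: "u \<in> T p"
  shows "g p (Dphi p v w) u = - g p w (Dphi p v u)"
proof -
  note W = extend_near[of p w] and U = extend_near[of p u]
  have "\<forall>\<^sub>F q in nhds p. g q (\<phi> q (extend p w q)) (extend p u q)
      = -1 * g q (extend p w q) (\<phi> q (extend p u q))"
    using eventually_tangent[OF W] eventually_tangent[OF U]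
    by eventually_elim (simp add: phi_skew)
  from tangent_cong[OF v this]
  have "v (\<lambda>q. g q (\<phi> q (extend p w q)) (extend p u q))
      = - v (\<lambda>q. g q (extend p w q) (\<phi> q (extend p u q)))"
    using tangent_spaceD(3)[OF v metric_smooth_near[OF W phi_smooth_near[OF U]], of "-1"] by simp
  then show ?thesis
    by (simp add: metric_compatible[OF v] W U phi_smooth_near nabla_phi[OF v] extend_at w u
        metric_linear Dphi_tangent v tangent nabla_tangent phi_skew)
qed

text \<open>The identity g(\<phi> W, \<xi>) = 0 is differentiated along \<open>v\<close>.\<close>

lemma Dphi_orth_xi:
  assumes v: "v \<in> T p" and w: "w \<in> T p"
  shows "g p (Dphi p v w) (\<xi> p) = - g p (\<phi> p w) (B p v)"
proof -
  note W = extend_near[of p w]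
  have "\<forall>\<^sub>F q in nhds p. g q (\<phi> q (extend p w q)) (\<xi> q) = 0"
    using eventually_tangent[OF W] by eventually_elim (rule phi_orth_xi)
  from tangent_cong[OF v this] have "v (\<lambda>q. g q (\<phi> q (extend p w q)) (\<xi> q)) = 0"
    by (simp add: tangent_const[OF v])
  then show ?thesis
    by (simp add: metric_compatible[OF v] W phi_smooth_near xi_smooth_near nabla_phi[OF v] extend_at w
        metric_linear Dphi_tangent v tangent nabla_tangent phi_orth_xi)
qed

text \<open>The identity \<open>\<phi>\<^sup>2 = - I + \<eta> \<otimes> \<xi>\<close> is
  differentiated along \<open>v\<close>.\<close>

lemma Dphi_phi:
  assumes v: "v \<in> T p" and w: "w \<in> T p"
  shows "Dphi p v (\<phi> p w) + \<phi> p (Dphi p v w) = g p (B p v) w *\<^sub>R \<xi> p + g p (\<xi> p) w *\<^sub>R B p v"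
proof -
  note W = extend_near[of p w]
  let ?f = "\<lambda>q. g q (\<xi> q) (extend p w q)"
  have f: "smooth_fun_near A p ?f" by (rule metric_smooth_near[OF xi_smooth_near W])
  have "\<forall>\<^sub>F q in nhds p. \<phi> q (\<phi> q (extend p w q)) = ?f q *\<^sub>R \<xi> q - extend p w q"
    using eventually_tangent[OF W] by eventually_elim (simp add: phi_phi)
  from nabla_cong[OF v _ this]
  have "nabla p v (\<lambda>q. \<phi> q (\<phi> q (extend p w q))) = v ?f *\<^sub>R \<xi> p + ?f p *\<^sub>R B p v - nabla p v (extend p w)"
    by (simp add: phi_smooth_near W nabla_diff[OF v] nabla_leibniz[OF v] f xi_smooth_near
        smooth_vfield_near_scale)
  moreover have "nabla p v (\<lambda>q. \<phi> q (\<phi> q (extend p w q)))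
      = Dphi p v (\<phi> p w) + (\<phi> p (Dphi p v w) + \<phi> p (\<phi> p (nabla p v (extend p w))))"
    by (simp add: nabla_phi[OF v] phi_smooth_near W extend_at w phi_add Dphi_tangent v tangent nabla_tangent)
  ultimately show ?thesis
    by (simp add: metric_compatible[OF v xi_smooth_near W] extend_at w phi_phi nabla_tangent v W
        algebra_simps)
qed

text \<open>This is the closedness of the fundamental 2-form \<open>\<Phi> = d\<eta>\<close>.\<close>

lemma Dphi_cyclic:
  assumes u: "u \<in> T p" and v: "v \<in> T p" and w: "w \<in> T p"
  shows "g p v (Dphi p u w) + g p w (Dphi p v u) + g p u (Dphi p w v) = 0"
proof -
  let ?U = "extend p u" and ?V = "extend p v" and ?W = "extend p w"
  have U: "smooth_vfield_near A p ?U" and V: "smooth_vfield_near A p ?V" and W: "smooth_vfield_near A p ?W"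
    by (rule extend_near)+
  have smooth: "smooth_fun_near A q (\<lambda>r. eta g \<xi> r (X r))" if "smooth_vfield_near A q X" for q X
    unfolding eta_def by (rule metric_smooth_near[OF xi_smooth_near that])
  have add: "eta g \<xi> p (v + w) = eta g \<xi> p v + eta g \<xi> p w" if "v \<in> T p" "w \<in> T p" for v w
    using that by (simp add: eta_def metric_add xi_tangent)
  \<comment> \<open>The last summand is moved across \<phi>, so that \<phi> always falls on the
    undifferentiated field. After cyclic summation these terms cancel against those of
    \<open>inner\<close>, and the derivatives of \<phi> remain.\<close>
  have outer: "x (d_one_form A (eta g \<xi>) Y Z)
      = g p (nabla p x Y) (\<phi> p (Z p)) + g p (Y p) (Dphi p x (Z p)) - g p (nabla p x Z) (\<phi> p (Y p))"
    if "x \<in> T p" "smooth_vfield_near A p Y" "smooth_vfield_near A p Z" for x Y Z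
  proof -
    have "\<forall>\<^sub>F q in nhds p. d_one_form A (eta g \<xi>) Y Z q = g q (Y q) (\<phi> q (Z q))"
      using eventually_smooth_vfield_near[OF that(2)] eventually_smooth_vfield_near[OF that(3)]
      by eventually_elim (rule d_eta)
    from tangent_cong[OF that(1) this]
    have "x (d_one_form A (eta g \<xi>) Y Z)
        = g p (nabla p x Y) (\<phi> p (Z p)) + g p (Y p) (Dphi p x (Z p)) + g p (Y p) (\<phi> p (nabla p x Z))"
      using that by (simp add: metric_compatible[OF that(1)] phi_smooth_near nabla_phi metric_linear Dphi_tangent
          tangent nabla_tangent smooth_vfield_near_tangent)
    moreover have "g p (Y p) (\<phi> p (nabla p x Z)) = - g p (nabla p x Z) (\<phi> p (Y p))"
      using that phi_skew[of "Y p" p "nabla p x Z"]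
        metric_sym[of "\<phi> p (Y p)" p "nabla p x Z"]
      by (simp add: tangent nabla_tangent smooth_vfield_near_tangent)
    ultimately show ?thesis by simp
  qed
  have inner: "d_one_form A (eta g \<xi>) (lie_bracket A X Y) Z p
      = g p (nabla p (X p) Y) (\<phi> p (Z p)) - g p (nabla p (Y p) X) (\<phi> p (Z p))"
    if "smooth_vfield_near A p X" "smooth_vfield_near A p Y" "smooth_vfield_near A p Z" for X Y Z
    using that by (simp add: d_eta lie_bracket_smooth_near torsion_free metric_linear tangent
        nabla_tangent smooth_vfield_near_tangent)
  from d_d_one_form[where \<omega> = "eta g \<xi>" and p = p and X = ?U and Y = ?V and Z = ?W, OF smooth add U V W]
  show ?thesis
    by (simp add: outer inner U V W extend_at u v w)
qed


section \<open>The symmetric part of \<nabla>\<xi>\<close>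

lemma B_xi: "B p (\<xi> p) = 0"
proof (rule metric_eqI[OF B_tangent[OF xi_tangent] tangent_space_zero])
  fix u assume u: "u \<in> T p"
  \<comment> \<open>In \<open>B_antisym\<close> with \<xi> in the first slot the other terms vanish,
    since \<nabla>\<xi> and \<phi> take values orthogonal to \<xi>.\<close>
  show "g p (B p (\<xi> p)) u = g p 0 u"
    using B_antisym[OF xi_tangent u] xi_B[OF u] xi_phi[OF u] by (simp add: metric_zero u)
qed

text \<open>The skew part of \<open>\<nabla>\<xi>\<close> is \<open>- \<phi>\<close> by the contact condition, so this is the symmetric part.\<close>

definition S :: "'a \<Rightarrow> 'a tvec \<Rightarrow> 'a tvec" where
  "S p v = B p v + \<phi> p v"

lemma S_tangent: "v \<in> T p \<Longrightarrow> S p v \<in> T p"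
  unfolding S_def by (intro tangent B_tangent)

lemma S_add: "v \<in> T p \<Longrightarrow> w \<in> T p \<Longrightarrow> S p (v + w) = S p v + S p w"
  by (simp add: S_def B_add phi_add)

lemma S_scale: "v \<in> T p \<Longrightarrow> S p (a *\<^sub>R v) = a *\<^sub>R S p v"
  by (simp add: S_def B_scale phi_scale scaleR_add_right)

lemma S_minus: "v \<in> T p \<Longrightarrow> S p (- v) = - S p v"
  using S_scale[of v p "-1"] by simp

lemma S_xi: "S p (\<xi> p) = 0"
  by (simp add: S_def B_xi phi_xi)

lemma xi_S: "v \<in> T p \<Longrightarrow> g p (\<xi> p) (S p v) = 0"
  by (simp add: S_def metric_add tangent B_tangent xi_B xi_phi)

text \<open>The skew part of \<nabla>\<xi> found in \<open>B_antisym\<close> is cancelled by adding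
  \<phi>.\<close>

lemma S_sym:
  assumes "v \<in> T p" "w \<in> T p"
  shows "g p (S p v) w = g p v (S p w)"
  using B_antisym[OF assms] phi_skew[OF assms] assms
  by (simp add: S_def metric_add tangent B_tangent)

text \<open>With \<xi> in the first slot of the cyclic identity, the derivatives of \<phi> in the
  other two summands are removed by \<open>Dphi_skew\<close> and \<open>Dphi_orth_xi\<close>; the
  products of \<phi> u and \<phi> v cancel by symmetry.\<close>

lemma Dphi_xi:
  assumes v: "v \<in> T p"
  shows "Dphi p (\<xi> p) v = - (S p (\<phi> p v) + \<phi> p (S p v))"
proof (rule metric_eqI[OF Dphi_tangent[OF xi_tangent]])
  show "- (S p (\<phi> p v) + \<phi> p (S p v)) \<in> T p"
    by (intro tangent S_tangent v)
  fix u assume u: "u \<in> T p"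
  note t = u v phi_tangent[OF u] phi_tangent[OF v] B_tangent[OF u] B_tangent[OF v]
    S_tangent[OF u] S_tangent[OF v]
  have "g p u (Dphi p (\<xi> p) v) + g p v (Dphi p u (\<xi> p)) + g p (\<xi> p) (Dphi p v u) = 0"
    by (rule Dphi_cyclic[OF xi_tangent u v])
  moreover have "g p v (Dphi p u (\<xi> p)) = g p (\<phi> p v) (B p u)"
    using Dphi_skew[OF u v xi_tangent] Dphi_orth_xi[OF u v] by simp
  moreover have "g p (\<xi> p) (Dphi p v u) = - g p (\<phi> p u) (B p v)"
    using Dphi_orth_xi[OF v u] metric_sym[OF xi_tangent Dphi_tangent[OF v]] by simp
  ultimately have "g p u (Dphi p (\<xi> p) v) = g p (\<phi> p u) (B p v) - g p (\<phi> p v) (B p u)"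
    by simp
  also have "g p (\<phi> p u) (B p v) = g p (\<phi> p u) (S p v) - g p (\<phi> p u) (\<phi> p v)"
    by (simp add: S_def metric_add t)
  also have "g p (\<phi> p v) (B p u) = g p (\<phi> p v) (S p u) - g p (\<phi> p v) (\<phi> p u)"
    by (simp add: S_def metric_add t)
  also have "g p (\<phi> p u) (S p v) = - g p (\<phi> p (S p v)) u"
    using phi_skew[of u p "S p v"] metric_sym[of u p "\<phi> p (S p v)"] by (simp add: t tangent)
  also have "g p (\<phi> p v) (S p u) = g p (S p (\<phi> p v)) u"
    using S_sym[of "\<phi> p v" p u] by (simp add: t)
  also have "g p (\<phi> p u) (\<phi> p v) = g p (\<phi> p v) (\<phi> p u)"
    by (rule metric_sym) (simp_all add: t)
  finally show "g p (Dphi p (\<xi> p) v) u = g p (- (S p (\<phi> p v) + \<phi> p (S p v))) u"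
    using metric_sym[of u p "Dphi p (\<xi> p) v"]
    by (simp add: metric_add metric_minus metric_diff t tangent S_tangent Dphi_tangent)
qed

text \<open>Along \<xi> the right-hand side of \<open>Dphi_phi\<close> vanishes, as \<nabla>_\<xi>
  \<xi> = 0. By \<open>Dphi_xi\<close> both summands on the left equal S v - \<phi> S \<phi> v, so
  this is 0.\<close>

lemma S_phi_phi:
  assumes v: "v \<in> T p"
  shows "S p v = \<phi> p (S p (\<phi> p v))"
proof -
  note t = v phi_tangent[OF v] S_tangent[OF v] S_tangent[OF phi_tangent[OF v]]
  have "Dphi p (\<xi> p) (\<phi> p v) + \<phi> p (Dphi p (\<xi> p) v) = 0"
    using Dphi_phi[OF xi_tangent v] by (simp add: B_xi metric_zero v)
  moreover have "Dphi p (\<xi> p) (\<phi> p v) = S p v - \<phi> p (S p (\<phi> p v))"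
    by (simp add: Dphi_xi t phi_phi S_add S_minus S_scale S_xi tangent del: minus_add_distrib add_uminus_conv_diff uminus_add_conv_diff)
  moreover have "\<phi> p (Dphi p (\<xi> p) v) = S p v - \<phi> p (S p (\<phi> p v))"
    by (simp add: Dphi_xi t phi_phi phi_add phi_diff phi_minus xi_S tangent)
  ultimately have "2 *\<^sub>R (S p v - \<phi> p (S p (\<phi> p v))) = 0"
    by (simp add: scaleR_2)
  then show ?thesis by simp
qed

text \<open>Apply \<phi> to \<open>S_phi_phi\<close> and reduce \<open>\<phi>\<^sup>2\<close> on the
  image of \<open>S\<close>, which is orthogonal to \<xi>. By \<open>Dphi_xi\<close> the derivative
  of \<phi> along \<xi> then vanishes.\<close>

lemma phi_S:
  assumes v: "v \<in> T p"
  shows "\<phi> p (S p v) = - S p (\<phi> p v)"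
proof -
  have "\<phi> p (S p v) = \<phi> p (\<phi> p (S p (\<phi> p v)))"
    using S_phi_phi[OF v] by simp
  also have "\<dots> = - S p (\<phi> p v)"
    by (simp add: phi_phi S_tangent tangent v xi_S)
  finally show ?thesis .
qed

lemma Dphi_xi_zero: "v \<in> T p \<Longrightarrow> Dphi p (\<xi> p) v = 0"
  by (simp add: Dphi_xi phi_S)

section \<open>The tensor h\<close>

lemma lie_derivative_phi:
  assumes v: "v \<in> T p"
  shows "lie_derivative_endo A \<xi> \<phi> p v = Dphi p (\<xi> p) v - B p (\<phi> p v) + \<phi> p (B p v)"
proof -
  define X where "X = (SOME X. smooth_vfield_near A p X \<and> X p = v)"
  have "\<exists>X. smooth_vfield_near A p X \<and> X p = v"
    using extend_near extend_at[OF v] by blast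
  then have X: "smooth_vfield_near A p X" "X p = v"
    unfolding X_def by (metis (mono_tags, lifting) someI_ex)+
  \<comment> \<open>Torsion-freeness expands both brackets. The terms \<phi> \<nabla>_\<xi> X
    cancel, so only the value of \<open>X\<close> at \<open>p\<close> remains.\<close>
  have "lie_derivative_endo A \<xi> \<phi> p v
      = lie_bracket A \<xi> (\<lambda>q. \<phi> q (X q)) p - \<phi> p (lie_bracket A \<xi> X p)"
    by (simp add: lie_derivative_endo_def X_def Let_def)
  also have "\<dots> = Dphi p (\<xi> p) v - B p (\<phi> p v) + \<phi> p (B p v)"
    by (simp add: torsion_free xi_smooth_near X phi_smooth_near nabla_phi[OF xi_tangent]
        phi_diff nabla_tangent xi_tangent B_tangent v algebra_simps)
  finally show ?thesis .
qed

text \<open>As the derivative of \<phi> along \<xi> is 0, the Lie derivative is \<phi> S - S \<phi>,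
  the two contributions of \<open>\<phi>\<^sup>2\<close> cancelling; and \<open>S\<close>
  anticommutes with \<phi>.\<close>

lemma h_tensor_eq_phi_S:
  assumes v: "v \<in> T p"
  shows "h_tensor A \<phi> \<xi> p v = \<phi> p (S p v)"
proof -
  have 1: "B p (\<phi> p v) = S p (\<phi> p v) - \<phi> p (\<phi> p v)" "B p v = S p v - \<phi> p v"
    by (simp_all add: S_def)
  have "lie_derivative_endo A \<xi> \<phi> p v = \<phi> p (S p v) - S p (\<phi> p v)"
    unfolding lie_derivative_phi[OF v] Dphi_xi_zero[OF v] 1
    by (simp add: phi_diff S_tangent tangent v)
  also have "\<dots> = 2 *\<^sub>R \<phi> p (S p v)"
    by (simp add: phi_S v scaleR_2)
  finally show ?thesis by (simp add: h_tensor_def)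
qed

text \<open>The form of h to be differentiated: it contains \<nabla>\<xi> itself, so its divergence
  brings in the rough Laplacian of \<xi>.\<close>

lemma h_tensor_eq:
  assumes v: "v \<in> T p"
  shows "h_tensor A \<phi> \<xi> p v = \<phi> p (B p v) - v + g p (\<xi> p) v *\<^sub>R \<xi> p"
  by (simp add: h_tensor_eq_phi_S[OF v] S_def phi_add phi_phi B_tangent tangent v)

section \<open>Traces and the divergence of \<phi>\<close>

abbreviation "e p i \<equiv> onframe A g p i p"

text \<open>The frame expansion of \<nabla>_\<xi> \<xi> = 0.\<close>

lemma sum_xi_B: "(\<Sum>i<DIM('b). g p (\<xi> p) (e p i) *\<^sub>R B p (e p i)) = 0"
proof -
  \<comment> \<open>The index sets of the induction stay below \<open>DIM('b)\<close>, where the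
    frame vectors are known to be tangent.\<close>
  have "B p (\<Sum>i\<in>I. g p (\<xi> p) (e p i) *\<^sub>R e p i) = (\<Sum>i\<in>I. g p (\<xi> p) (e p i) *\<^sub>R B p (e p i))"
    if "I \<subseteq> {..<DIM('b)}" for I
  proof -
    have "finite I" using that by (rule finite_subset) simp
    then show ?thesis using that
    proof (induction I rule: finite_induct)
      case empty
      show ?case unfolding sum.empty using B_scale[OF xi_tangent, of p 0] by simp
    next
      case (insert i I)
      have "e p j \<in> T p" if "j \<in> insert i I" for j
        using that insert.prems onframe_tangent by blast
      then have "e p i \<in> T p" "(\<Sum>i\<in>I. g p (\<xi> p) (e p i) *\<^sub>R e p i) \<in> T p"
        by (auto intro!: tangent_space_sum tangent_space_scale)
      then show ?case
        using insert.IH insert.prems unfolding sum.insert[OF insert.hyps]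
        by (simp add: B_add B_scale tangent)
    qed
  qed
  from this[OF order.refl] show ?thesis
    using onframe_expansion[OF xi_tangent, of p] by (simp add: B_xi)
qed

lemma trace_phi: "v \<in> T p \<Longrightarrow> g p (\<phi> p v) v = 0"
  using phi_skew[of v p v] metric_sym[of v p "\<phi> p v"] by (simp add: tangent)

text \<open>By \<open>S_phi_phi\<close>, g(S v, v) = - g(S \<phi> v, \<phi> v); but
  \<open>trace_skew\<close> makes the sums of g(S v, v) and g(S \<phi> v, \<phi> v) over the frame
  equal, so both are 0. The skew part of \<nabla>\<xi> contributes no trace.\<close>

lemma trace_B: "(\<Sum>i<DIM('b). g p (B p (e p i)) (e p i)) = 0"
proof -
  have S_phi: "g p (S p v) v = - g p (S p (\<phi> p v)) (\<phi> p v)" if "v \<in> T p" for v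
  proof -
    have "g p (S p v) v = g p (\<phi> p (S p (\<phi> p v))) v"
      by (subst S_phi_phi[OF that]) (rule refl)
    also have "\<dots> = - g p (S p (\<phi> p v)) (\<phi> p v)"
      by (rule phi_skew) (simp_all add: that S_tangent tangent)
    finally show ?thesis .
  qed
  have "(\<Sum>i<DIM('b). g p (S p (\<phi> p (e p i))) (\<phi> p (e p i)))
      = - (\<Sum>i<DIM('b). g p (S p (e p i)) (\<phi> p (\<phi> p (e p i))))"
    by (rule trace_skew[where L = "\<phi> p" and F = "\<lambda>v w. g p (S p v) (\<phi> p w)"])
      (simp_all add: phi_skew tangent S_tangent S_add S_scale phi_add phi_scale metric_add metric_scale)
  also have "\<dots> = (\<Sum>i<DIM('b). g p (S p (e p i)) (e p i))"
    using metric_sym[OF S_tangent xi_tangent]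
    by (simp add: phi_phi onframe_tangent metric_linear S_tangent tangent xi_S sum_negf)
  also have "\<dots> = - (\<Sum>i<DIM('b). g p (S p (\<phi> p (e p i))) (\<phi> p (e p i)))"
    by (simp add: S_phi onframe_tangent sum_negf)
  finally have "(\<Sum>i<DIM('b). g p (S p (\<phi> p (e p i))) (\<phi> p (e p i))) = 0" by simp
  then have "(\<Sum>i<DIM('b). g p (S p (e p i)) (e p i)) = 0"
    by (simp add: S_phi onframe_tangent sum_negf)
  then show ?thesis
    by (simp add: S_def metric_add B_tangent onframe_tangent tangent trace_phi)
qed

text \<open>Testing against the image of \<phi> shows that the divergence of \<phi> is a multiple of
  \<xi>. The cyclic identity for e, z, \<phi> e is summed over the frame: the middle sum vanishes
  and the outer two agree, so each is 0.\<close>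

lemma divergence_phi:
  assumes z: "z \<in> T p"
  shows "(\<Sum>i<DIM('b). g p (Dphi p (e p i) (e p i)) (\<phi> p z)) = 0"
proof -
  have t: "e p i \<in> T p" if "i \<in> {..<DIM('b)}" for i using that by (simp add: onframe_tangent)
  have 1: "(\<Sum>i<DIM('b). g p z (Dphi p (e p i) (\<phi> p (e p i)))) + (\<Sum>i<DIM('b). g p (\<phi> p (e p i)) (Dphi p z (e p i)))
      + (\<Sum>i<DIM('b). g p (e p i) (Dphi p (\<phi> p (e p i)) z)) = 0"
    unfolding sum.distrib[symmetric]
    by (intro sum.neutral ballI Dphi_cyclic z tangent t)
  \<comment> \<open>\<open>trace_skew\<close> moves \<phi> from one argument to the other; skewness
    of \<nabla>\<phi> then recovers the first sum.\<close>
  have "(\<Sum>i<DIM('b). g p (e p i) (Dphi p (\<phi> p (e p i)) z))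
      = - (\<Sum>i<DIM('b). g p (\<phi> p (e p i)) (Dphi p (e p i) z))"
    by (rule trace_skew[where L = "\<phi> p" and F = "\<lambda>v w. g p w (Dphi p v z)"])
      (simp_all add: phi_skew tangent Dphi_tangent Dphi_add_left Dphi_scale_left metric_add metric_scale)
  also have "\<dots> = (\<Sum>i<DIM('b). g p z (Dphi p (e p i) (\<phi> p (e p i))))"
  proof -
    have "- g p (\<phi> p v) (Dphi p v z) = g p z (Dphi p v (\<phi> p v))" if "v \<in> T p" for v
      using Dphi_skew[OF that z phi_tangent[OF that]] metric_sym[of "\<phi> p v" p "Dphi p v z"]
      by (simp add: that z tangent Dphi_tangent)
    then show ?thesis unfolding sum_negf[symmetric] by (intro sum.cong refl) (simp add: t)
  qed
  finally have 2: "(\<Sum>i<DIM('b). g p (e p i) (Dphi p (\<phi> p (e p i)) z))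
      = (\<Sum>i<DIM('b). g p z (Dphi p (e p i) (\<phi> p (e p i))))" .
  \<comment> \<open>Pairing \<open>Dphi_phi\<close> with \<open>v\<close> makes its two left-hand
    terms equal. By Parseval the remaining sum is, up to sign, g(B z, \<xi>) = 0.\<close>
  have 3: "(\<Sum>i<DIM('b). g p (\<phi> p (e p i)) (Dphi p z (e p i))) = 0"
  proof -
    have "g p (\<phi> p v) (Dphi p z v) = - (g p (B p z) v * g p (\<xi> p) v)" if v: "v \<in> T p" for v
    proof -
      have "g p (Dphi p z (\<phi> p v)) v + g p (\<phi> p (Dphi p z v)) v = 2 * (g p (B p z) v * g p (\<xi> p) v)"
        using arg_cong[OF Dphi_phi[OF z v], of "\<lambda>x. g p x v"]
        by (simp add: metric_linear tangent B_tangent Dphi_tangent z v)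
      moreover have "g p (Dphi p z (\<phi> p v)) v = - g p (\<phi> p v) (Dphi p z v)"
        by (rule Dphi_skew) (simp_all add: z v tangent)
      moreover have "g p (\<phi> p (Dphi p z v)) v = - g p (\<phi> p v) (Dphi p z v)"
        using phi_skew[of "Dphi p z v" p v] metric_sym[of "\<phi> p v" p "Dphi p z v"]
        by (simp add: z v tangent Dphi_tangent)
      ultimately show ?thesis by linarith
    qed
    then have "(\<Sum>i<DIM('b). g p (\<phi> p (e p i)) (Dphi p z (e p i)))
        = - (\<Sum>i<DIM('b). g p (B p z) (e p i) * g p (\<xi> p) (e p i))"
      unfolding sum_negf[symmetric] by (intro sum.cong refl) (simp add: t)
    also have "\<dots> = 0"
      by (simp add: onframe_Parseval B_tangent z xi_tangent B_orth_xi)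
    finally show ?thesis .
  qed
  from 1 2 3 have 4: "(\<Sum>i<DIM('b). g p z (Dphi p (e p i) (\<phi> p (e p i)))) = 0" by simp
  \<comment> \<open>\<open>Dphi_phi\<close> leads from the argument \<phi> e back to e; its
    correction terms add up to the trace of \<nabla>\<xi> and to \<nabla>_\<xi> \<xi>, both
    0.\<close>
  have "g p (Dphi p v v) (\<phi> p z) = g p z (Dphi p v (\<phi> p v)) - g p (B p v) v * g p (\<xi> p) z
      - g p (g p (\<xi> p) v *\<^sub>R B p v) z" if v: "v \<in> T p" for v
    using arg_cong[OF Dphi_phi[OF v v], of "\<lambda>x. g p x z"] phi_skew[OF Dphi_tangent[OF v] z, of v]
      metric_sym[OF z Dphi_tangent[OF v], of "\<phi> p v"]
    by (simp add: metric_linear tangent B_tangent Dphi_tangent z v)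
  then have 5: "(\<Sum>i<DIM('b). g p (Dphi p (e p i) (e p i)) (\<phi> p z))
      = (\<Sum>i<DIM('b). g p z (Dphi p (e p i) (\<phi> p (e p i)))) - (\<Sum>i<DIM('b). g p (B p (e p i)) (e p i)) * g p (\<xi> p) z
        - (\<Sum>i<DIM('b). g p (g p (\<xi> p) (e p i) *\<^sub>R B p (e p i)) z)"
    unfolding sum_distrib_right sum_subtractf[symmetric]
    by (intro sum.cong refl) (simp add: t)
  have 6: "(\<Sum>i<DIM('b). g p (g p (\<xi> p) (e p i) *\<^sub>R B p (e p i)) z)
      = g p (\<Sum>i<DIM('b). g p (\<xi> p) (e p i) *\<^sub>R B p (e p i)) z"
    by (rule metric_sum(1)[symmetric]) (simp_all add: tangent B_tangent t z)
  show ?thesis unfolding 5 6 4 trace_B sum_xi_B by (simp add: metric_zero z)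
qed

section \<open>The contact distribution and T(\<phi>)\<close>

lemma contact_distribution: "contact_distribution A \<phi> p = {w \<in> T p. g p (\<xi> p) w = 0}"
proof (intro subset_antisym subsetI)
  show "w \<in> {w \<in> T p. g p (\<xi> p) w = 0}" if "w \<in> contact_distribution A \<phi> p" for w
    using that by (auto simp: contact_distribution_def phi_tangent xi_phi)
  show "w \<in> contact_distribution A \<phi> p" if "w \<in> {w \<in> T p. g p (\<xi> p) w = 0}" for w
  proof -
    \<comment> \<open>The preimage is - \<phi> w, because \<open>\<phi>\<^sup>2\<close> is - I on
      the kernel of \<eta>.\<close>
    have "w = \<phi> p (- \<phi> p w)" and "- \<phi> p w \<in> T p"
      using that by (simp_all add: phi_minus phi_phi tangent)
    then show ?thesis unfolding contact_distribution_def by (rule image_eqI)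
  qed
qed

lemma orth_proj_contact_distribution:
  assumes v: "v \<in> T p"
  shows "orth_proj g p (contact_distribution A \<phi> p) v = v - g p (\<xi> p) v *\<^sub>R \<xi> p" (is "_ = ?w")
  unfolding orth_proj_def
proof (rule the_equality)
  have w: "?w \<in> T p" using v by (simp add: tangent)
  have orth: "g p (v - ?w) u = 0" if "u \<in> T p" "g p (\<xi> p) u = 0" for u
    using that v by (simp add: metric_scale tangent)
  have wD: "g p (\<xi> p) ?w = 0" by (simp add: metric_linear tangent v xi_unit)
  then show "?w \<in> contact_distribution A \<phi> p \<and> (\<forall>u\<in>contact_distribution A \<phi> p. g p (v - ?w) u = 0)"
    using orth w unfolding contact_distribution by blast
  fix w' assume "w' \<in> contact_distribution A \<phi> p \<and> (\<forall>u\<in>contact_distribution A \<phi> p. g p (v - w') u = 0)"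
  then have w': "w' \<in> T p" "g p (\<xi> p) w' = 0"
    and orth': "\<And>u. u \<in> T p \<Longrightarrow> g p (\<xi> p) u = 0 \<Longrightarrow> g p (v - w') u = 0"
    unfolding contact_distribution by auto
  \<comment> \<open>Both candidates lie in the distribution and leave residuals orthogonal to it, so
    their difference is orthogonal to itself.\<close>
  let ?d = "w' - ?w"
  have d: "?d \<in> T p" "g p (\<xi> p) ?d = 0"
    using w w' wD metric_diff(2)[OF w'(1) w xi_tangent] by (simp_all add: tangent_space_diff)
  have diff: "g p ((v - ?w) - (v - w')) ?d = g p (v - ?w) ?d - g p (v - w') ?d"
    by (rule metric_diff) (intro tangent_space_diff v w w'(1) d(1))+
  have "(v - ?w) - (v - w') = ?d" by simp
  with diff have "g p ?d ?d = 0" by (simp only: orth[OF d] orth'[OF d] diff_self)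
  then have "?d = 0" using metric_pos[OF d(1)] by (cases "?d = 0") auto
  then show "w' = ?w" by simp
qed

text \<open>\<open>J_of\<close> is \<open>undefined\<close> off the contact distribution, so
  orthogonality to \<xi> is verified wherever it is evaluated.\<close>

lemma J_of_eq: "w \<in> T p \<Longrightarrow> g p (\<xi> p) w = 0 \<Longrightarrow> J_of A \<phi> p w = \<phi> p w"
  by (simp add: J_of_def contact_distribution)

abbreviation "BE p i \<equiv> (\<lambda>q. B q (onframe A g p i q))"

lemma BE_near: "i < DIM('b) \<Longrightarrow> smooth_vfield_near A p (BE p i)"
  by (intro nabla_smooth_near onframe_near xi_smooth_near)

text \<open>The projections make no difference: the derivative of \<phi> \<nabla>_E \<xi> is already
  orthogonal to \<xi>, and the \<xi>-component removed from the derivative of \<nabla>_E \<xi> is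
  killed by \<phi>.\<close>

lemma T_phi_eq: "T_phi A g nabla \<phi> \<xi> p = (\<Sum>i<DIM('b). Dphi p (e p i) (B p (e p i)))"
  unfolding T_phi_def
proof (rule sum.cong[OF refl])
  fix i assume "i \<in> {..<DIM('b)}"
  then have i: "i < DIM('b)" by simp
  note E = onframe_near[OF i, of p] and t = onframe_tangent[OF i, of p] and BE = BE_near[OF i, of p]
  let ?n = "nabla p (e p i) (BE p i)" and ?m = "nabla p (e p i) (\<lambda>q. \<phi> q (BE p i q))"
  have n: "?n \<in> T p" and m: "?m \<in> T p"
    by (intro nabla_tangent t BE phi_smooth_near)+
  have "\<forall>\<^sub>F q in nhds p. \<phi> q (BE p i q) = J_of A \<phi> q (BE p i q)"
    using eventually_tangent[OF E]
    by eventually_elim (simp add: J_of_eq B_tangent xi_B)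
  from nabla_cong[OF t phi_smooth_near[OF BE] this]
  have J: "nabla p (e p i) (\<lambda>q. J_of A \<phi> q (BE p i q)) = ?m" by simp
  have m_eq: "?m = Dphi p (e p i) (B p (e p i)) + \<phi> p ?n"
    by (rule nabla_phi[OF t BE])
  \<comment> \<open>By \<open>Dphi_orth_xi\<close> this comes down to g(\<phi> w, w) = 0 for w =
    \<nabla>_E \<xi>.\<close>
  have "g p (\<xi> p) ?m = 0"
    using Dphi_orth_xi[OF t B_tangent[OF t]] trace_phi[OF B_tangent[OF t]]
      metric_sym[OF xi_tangent Dphi_tangent[OF t], of "B p (e p i)"]
    by (simp add: m_eq metric_add tangent Dphi_tangent t n xi_phi)
  moreover have "J_of A \<phi> p (?n - g p (\<xi> p) ?n *\<^sub>R \<xi> p) = \<phi> p ?n"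
    by (subst J_of_eq) (simp_all add: n tangent metric_linear xi_unit phi_diff phi_scale phi_xi)
  ultimately show "cov_deriv_endo (nabla_bar A g nabla \<phi>) (J_of A \<phi>) (onframe A g p i) (BE p i) p
      = Dphi p (e p i) (B p (e p i))"
    unfolding cov_deriv_endo_def nabla_bar_def J orth_proj_contact_distribution[OF n]
      orth_proj_contact_distribution[OF m]
    by (simp add: m_eq)
qed

section \<open>Rough Laplacian, tension and the codifferential of h\<close>

abbreviation "hess_xi p i \<equiv> second_cov_deriv nabla (onframe A g p i) (onframe A g p i) \<xi> p"

lemma hess_xi_tangent: "i < DIM('b) \<Longrightarrow> hess_xi p i \<in> T p"
  unfolding second_cov_deriv_def
  by (intro tangent nabla_tangent onframe_tangent BE_near xi_smooth_near onframe_near)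

lemma rough_laplacian_tangent: "rough_laplacian A g nabla \<xi> p \<in> T p"
  unfolding rough_laplacian_def by (intro tangent tangent_space_sum hess_xi_tangent) simp

text \<open>\<open>h_tensor_eq\<close> is differentiated along the frame. Of the terms with
  \<nabla>_E E, those outside \<phi> cancel, and the one inside \<phi> completes the second
  covariant derivative of \<xi>.\<close>

lemma cov_deriv_h:
  assumes i: "i < DIM('b)"
  shows "cov_deriv_endo nabla (h_tensor A \<phi> \<xi>) (onframe A g p i) (onframe A g p i) p
    = Dphi p (e p i) (B p (e p i)) + \<phi> p (hess_xi p i) + g p (B p (e p i)) (e p i) *\<^sub>R \<xi> p
      + g p (\<xi> p) (e p i) *\<^sub>R B p (e p i)"
proof -
  note E = onframe_near[OF i, of p] and t = onframe_tangent[OF i, of p] and BE = BE_near[OF i, of p]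
  let ?E = "onframe A g p i" and ?n = "nabla p (e p i) (onframe A g p i)"
  let ?f = "\<lambda>q. g q (\<xi> q) (?E q)"
  have n: "?n \<in> T p" by (intro nabla_tangent t E)
  have f: "smooth_fun_near A p ?f" by (rule metric_smooth_near[OF xi_smooth_near E])
  note near = smooth_vfield_near_add smooth_vfield_near_diff smooth_vfield_near_scale phi_smooth_near
    BE E f xi_smooth_near
  have "\<forall>\<^sub>F q in nhds p. (\<phi> q (BE p i q) - ?E q) + ?f q *\<^sub>R \<xi> q = h_tensor A \<phi> \<xi> q (?E q)"
    using eventually_tangent[OF E] by eventually_elim (simp add: h_tensor_eq)
  from nabla_cong[OF t _ this]
  have "nabla p (e p i) (\<lambda>q. h_tensor A \<phi> \<xi> q (?E q))
      = nabla p (e p i) (\<lambda>q. (\<phi> q (BE p i q) - ?E q) + ?f q *\<^sub>R \<xi> q)"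
    by (simp add: near)
  also have "\<dots> = Dphi p (e p i) (B p (e p i)) + \<phi> p (nabla p (e p i) (BE p i)) - ?n
      + ((g p (B p (e p i)) (e p i) + g p (\<xi> p) ?n) *\<^sub>R \<xi> p + g p (\<xi> p) (e p i) *\<^sub>R B p (e p i))"
    by (simp add: nabla_add[OF t] nabla_diff[OF t] nabla_leibniz[OF t] near nabla_phi[OF t]
        metric_compatible[OF t])
  finally have 1: "nabla p (e p i) (\<lambda>q. h_tensor A \<phi> \<xi> q (?E q)) = \<dots>" .
  have 2: "\<phi> p (hess_xi p i) = \<phi> p (nabla p (e p i) (BE p i)) - \<phi> p (B p ?n)"
    unfolding second_cov_deriv_def by (intro phi_diff nabla_tangent t BE B_tangent n)
  show ?thesis
    unfolding cov_deriv_endo_def 1 2 h_tensor_eq[OF n] by (simp add: algebra_simps)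
qed

text \<open>When \<open>cov_deriv_h\<close> is summed over the frame, its last two terms form the
  trace of \<nabla>\<xi> times \<xi> and \<nabla>_\<xi> \<xi>, both of which vanish.\<close>

lemma codiff_h:
  "codiff_endo A g nabla (h_tensor A \<phi> \<xi>) p
    = \<phi> p (rough_laplacian A g nabla \<xi> p) - T_phi A g nabla \<phi> \<xi> p"
proof -
  have "(\<Sum>i<DIM('b). cov_deriv_endo nabla (h_tensor A \<phi> \<xi>) (onframe A g p i) (onframe A g p i) p)
      = (\<Sum>i<DIM('b). Dphi p (e p i) (B p (e p i)) + \<phi> p (hess_xi p i)
        + g p (B p (e p i)) (e p i) *\<^sub>R \<xi> p + g p (\<xi> p) (e p i) *\<^sub>R B p (e p i))"
    by (intro sum.cong refl cov_deriv_h) simp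
  also have "\<dots> = T_phi A g nabla \<phi> \<xi> p + (\<Sum>i<DIM('b). \<phi> p (hess_xi p i))"
    unfolding sum.distrib T_phi_eq scaleR_sum_left[symmetric] trace_B sum_xi_B by simp
  also have "(\<Sum>i<DIM('b). \<phi> p (hess_xi p i)) = \<phi> p (\<Sum>i<DIM('b). hess_xi p i)"
    by (rule phi_sum[symmetric]) (simp add: hess_xi_tangent)
  also have "\<dots> = - \<phi> p (rough_laplacian A g nabla \<xi> p)"
    unfolding rough_laplacian_def
    by (subst phi_minus) (auto intro: tangent_space_sum hess_xi_tangent)
  finally show ?thesis unfolding codiff_endo_def by simp
qed

text \<open>Differentiate g(\<xi>, \<nabla>_E \<xi>) = 0 along E; the term with \<nabla>_E E drops
  out because \<nabla>\<xi> is orthogonal to \<xi>.\<close>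

lemma xi_rough_laplacian: "g p (\<xi> p) (rough_laplacian A g nabla \<xi> p) = grad_norm_sq A g nabla \<xi> p"
proof -
  have "g p (\<xi> p) (hess_xi p i) = - g p (B p (e p i)) (B p (e p i))" if i: "i < DIM('b)" for i
  proof -
    note E = onframe_near[OF i, of p] and t = onframe_tangent[OF i, of p] and BE = BE_near[OF i, of p]
    have "\<forall>\<^sub>F q in nhds p. g q (\<xi> q) (BE p i q) = 0"
      using eventually_tangent[OF E] by eventually_elim (rule xi_B)
    from tangent_cong[OF t this] have "e p i (\<lambda>q. g q (\<xi> q) (BE p i q)) = 0"
      by (simp add: tangent_const[OF t])
    then have "g p (\<xi> p) (nabla p (e p i) (BE p i)) = - g p (B p (e p i)) (B p (e p i))"
      by (simp add: metric_compatible[OF t xi_smooth_near BE])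
    then show ?thesis
      by (simp add: second_cov_deriv_def metric_diff nabla_tangent t E BE xi_tangent B_tangent xi_B)
  qed
  then have "g p (\<xi> p) (\<Sum>i<DIM('b). hess_xi p i) = - (\<Sum>i<DIM('b). g p (B p (e p i)) (B p (e p i)))"
    by (subst metric_sum) (auto simp: hess_xi_tangent xi_tangent sum_negf)
  moreover have "g p (\<xi> p) (- (\<Sum>i<DIM('b). hess_xi p i)) = - g p (\<xi> p) (\<Sum>i<DIM('b). hess_xi p i)"
    by (rule metric_minus) (auto intro: tangent_space_sum hess_xi_tangent xi_tangent)
  ultimately show ?thesis
    by (simp add: rough_laplacian_def grad_norm_sq_def Let_def)
qed

text \<open>By \<open>xi_rough_laplacian\<close> the tension is the component of the rough Laplacian
  orthogonal to \<xi>, and \<open>- \<phi>\<^sup>2\<close> is that projection.\<close>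

lemma tension_eq: "tension A g nabla \<xi> p = - \<phi> p (\<phi> p (rough_laplacian A g nabla \<xi> p))"
  by (simp add: tension_def phi_phi rough_laplacian_tangent xi_rough_laplacian)

lemma T_phi_tangent: "T_phi A g nabla \<phi> \<xi> p \<in> T p"
  unfolding T_phi_eq by (intro tangent_space_sum Dphi_tangent onframe_tangent) simp

text \<open>This places T(\<phi>) in the contact distribution, so that J acts on it as
  \<phi>.\<close>

lemma xi_T_phi: "g p (\<xi> p) (T_phi A g nabla \<phi> \<xi> p) = 0"
proof -
  have "g p (\<xi> p) (Dphi p v (B p v)) = 0" if "v \<in> T p" for v
    using Dphi_orth_xi[OF that B_tangent[OF that]] trace_phi[OF B_tangent[OF that]]
      metric_sym[OF xi_tangent Dphi_tangent[OF that], of "B p v"] by simp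
  then show ?thesis
    unfolding T_phi_eq by (subst metric_sum) (auto simp: xi_tangent onframe_tangent intro: Dphi_tangent)
qed

text \<open>Apply \<phi> to \<open>codiff_h\<close>; by \<open>tension_eq\<close> the term with
  \<open>\<phi>\<^sup>2\<close> is minus the tension.\<close>

lemma phi_codiff_h:
  "\<phi> p (codiff_endo A g nabla (h_tensor A \<phi> \<xi>) p)
    = - tension A g nabla \<xi> p - J_of A \<phi> p (T_phi A g nabla \<phi> \<xi> p)"
  unfolding codiff_h tension_eq J_of_eq[OF T_phi_tangent xi_T_phi]
  by (simp add: phi_diff tangent rough_laplacian_tangent T_phi_tangent)

section \<open>The first harmonic section equation\<close>

lemma first_harmonic_section_eq_iff:
  "first_harmonic_section_eq A g nabla \<phi> \<xi> \<longleftrightarrow>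
    (\<forall>p. tension A g nabla \<xi> p = \<phi> p (codiff_endo A g nabla (h_tensor A \<phi> \<xi>) p))"
proof -
  \<comment> \<open>By \<open>phi_codiff_h\<close>, both equations say that twice the tension plus J
    T(\<phi>) is 0.\<close>
  have "t + (1/2) *\<^sub>R j = 0 \<longleftrightarrow> t = - t - j" for t j :: "'a tvec"
  proof -
    have "t = - t - j \<longleftrightarrow> 2 *\<^sub>R t + j = 0"
      by (simp add: scaleR_2 eq_diff_eq eq_neg_iff_add_eq_0 algebra_simps)
    also have "2 *\<^sub>R t + j = 2 *\<^sub>R (t + (1/2) *\<^sub>R j)"
      by (simp add: scaleR_add_right)
    finally show ?thesis by simp
  qed
  then show ?thesis unfolding first_harmonic_section_eq_def phi_codiff_h by simp
qed

text \<open>The codifferential of h is orthogonal to \<xi>, and \<phi> is injective on the contact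
  distribution.\<close>

lemma phi_codiff_h_eq_0_iff:
  "\<phi> p (codiff_endo A g nabla (h_tensor A \<phi> \<xi>) p) = 0 \<longleftrightarrow>
    codiff_endo A g nabla (h_tensor A \<phi> \<xi>) p = 0" (is "\<phi> p ?d = 0 \<longleftrightarrow> _")
proof
  assume "\<phi> p ?d = 0"
  moreover have d: "?d \<in> T p"
    unfolding codiff_h by (intro tangent rough_laplacian_tangent T_phi_tangent)
  moreover have "g p (\<xi> p) ?d = 0"
    unfolding codiff_h
    by (simp add: metric_diff tangent rough_laplacian_tangent T_phi_tangent xi_phi xi_T_phi)
  ultimately show "?d = 0" using phi_phi[OF d] by (simp add: phi_zero)
qed (simp add: phi_zero)

text \<open>Both sides of the equivalent equation vanish: the codifferential because h = 0, the
  tension because the divergence of \<phi> is a multiple of \<xi>.\<close>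

lemma K_contact_first_harmonic_section_eq:
  assumes "K_contact A g \<phi> \<xi>"
  shows "first_harmonic_section_eq A g nabla \<phi> \<xi>"
  unfolding first_harmonic_section_eq_iff
proof
  fix p
  have h: "h_tensor A \<phi> \<xi> q v = 0" if "v \<in> T q" for q v
    using assms that unfolding K_contact_def by blast
  \<comment> \<open>Since h = \<phi> S = 0 and \<open>S\<close> takes values orthogonal to \<xi>,
    also S = 0; only the skew part of \<nabla>\<xi> is left.\<close>
  have B: "B q v = - \<phi> q v" if v: "v \<in> T q" for q v
  proof -
    have "\<phi> q (\<phi> q (S q v)) = 0"
      using h[OF v] by (simp add: h_tensor_eq_phi_S v phi_zero)
    then have "S q v = 0" by (simp add: phi_phi S_tangent v xi_S)
    then show ?thesis by (simp add: S_def eq_neg_iff_add_eq_0)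
  qed
  \<comment> \<open>With \<nabla>\<xi> = - \<phi> the rough Laplacian of \<xi> becomes the trace of
    \<nabla>\<phi>.\<close>
  have hess: "hess_xi p i = - Dphi p (e p i) (e p i)" if i: "i < DIM('b)" for i
  proof -
    note E = onframe_near[OF i, of p] and t = onframe_tangent[OF i, of p] and BE = BE_near[OF i, of p]
    have "\<forall>\<^sub>F q in nhds p. BE p i q = (- 1) *\<^sub>R \<phi> q (onframe A g p i q)"
      using eventually_tangent[OF E] by eventually_elim (simp add: B)
    from nabla_cong[OF t BE this]
    have "nabla p (e p i) (BE p i) = (- 1) *\<^sub>R nabla p (e p i) (\<lambda>q. \<phi> q (onframe A g p i q))"
      by (simp only: nabla_scale[OF t phi_smooth_near[OF E]])
    then show ?thesis
      by (simp add: second_cov_deriv_def nabla_phi[OF t E] B nabla_tangent t E)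
  qed
  let ?L = "rough_laplacian A g nabla \<xi> p"
  have L: "?L = (\<Sum>i<DIM('b). Dphi p (e p i) (e p i))"
    unfolding rough_laplacian_def by (simp add: hess sum_negf)
  have "\<phi> p ?L = 0"
  proof (rule metric_eqI[OF phi_tangent[OF rough_laplacian_tangent] tangent_space_zero])
    fix u assume u: "u \<in> T p"
    have "g p ?L (\<phi> p u) = (\<Sum>i<DIM('b). g p (Dphi p (e p i) (e p i)) (\<phi> p u))"
      unfolding L by (rule metric_sum) (simp_all add: Dphi_tangent onframe_tangent tangent u)
    then have "g p ?L (\<phi> p u) = 0" using divergence_phi[OF u] by simp
    then show "g p (\<phi> p ?L) u = g p 0 u"
      by (simp add: phi_skew rough_laplacian_tangent u metric_zero)
  qed
  then have "tension A g nabla \<xi> p = 0" by (simp add: tension_eq phi_zero)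
  moreover have "cov_deriv_endo nabla (h_tensor A \<phi> \<xi>) (onframe A g p i) (onframe A g p i) p = 0"
    if i: "i < DIM('b)" for i
  proof -
    note E = onframe_near[OF i, of p] and t = onframe_tangent[OF i, of p]
    \<comment> \<open>The tensor h is known to vanish on tangent vectors only, so the field is
      compared with 0 near \<open>p\<close>, where the frame is tangent.\<close>
    have "\<forall>\<^sub>F q in nhds p. 0 = h_tensor A \<phi> \<xi> q (onframe A g p i q)"
      using eventually_tangent[OF E] by eventually_elim (simp add: h)
    from nabla_cong[OF t smooth_vfield_near_zero this]
    show ?thesis by (simp add: cov_deriv_endo_def nabla_zero t h nabla_tangent E)
  qed
  then have "codiff_endo A g nabla (h_tensor A \<phi> \<xi>) p = 0"
    unfolding codiff_endo_def by simp
  ultimately show "tension A g nabla \<xi> p = \<phi> p (codiff_endo A g nabla (h_tensor A \<phi> \<xi>) p)"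
    by (simp add: phi_zero)
qed

end

theorem proposition2p1:
  fixes A :: "('a::{t2_space, second_countable_topology}, 'b::euclidean_space) atlas"
    and g :: "'a metric"
    and nabla :: "'a connection"
    and \<phi> :: "'a endo_field"
    and \<xi> :: "'a vfield"
    and n :: nat
  assumes "smooth_manifold A"
    and "DIM('b) = 2 * n + 1"
    and "riemannian_metric A g"
    and "levi_civita A g nabla"
    and "contact_metric A g \<phi> \<xi>"
  shows "(\<forall>p. codiff_endo A g nabla (h_tensor A \<phi> \<xi>) p =
             \<phi> p (rough_laplacian A g nabla \<xi> p) - T_phi A g nabla \<phi> \<xi> p) \<and>
         (first_harmonic_section_eq A g nabla \<phi> \<xi> \<longleftrightarrow>
             (\<forall>p. tension A g nabla \<xi> p = \<phi> p (codiff_endo A g nabla (h_tensor A \<phi> \<xi>) p))) \<and>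
         (H_contact A g nabla \<phi> \<xi> \<longrightarrow>
             (first_harmonic_section_eq A g nabla \<phi> \<xi> \<longleftrightarrow> (\<forall>p. codiff_endo A g nabla (h_tensor A \<phi> \<xi>) p = 0))) \<and>
         (K_contact A g \<phi> \<xi> \<longrightarrow> first_harmonic_section_eq A g nabla \<phi> \<xi>)"
proof -
  interpret contact_manifold A g nabla \<phi> \<xi>
    using assms by unfold_locales
  have "first_harmonic_section_eq A g nabla \<phi> \<xi> \<longleftrightarrow>
      (\<forall>p. codiff_endo A g nabla (h_tensor A \<phi> \<xi>) p = 0)" if "H_contact A g nabla \<phi> \<xi>"
  proof -
    \<comment> \<open>With vanishing tension the equation reads 0 = \<phi> \<delta>h, and \<phi> can
      be cancelled by \<open>phi_codiff_h_eq_0_iff\<close>.\<close>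
    have "tension A g nabla \<xi> p = 0" for p
      using that unfolding H_contact_def by blast
    then show ?thesis
      unfolding first_harmonic_section_eq_iff
      by (simp add: eq_commute[of "0::'a tvec"] phi_codiff_h_eq_0_iff)
  qed
  then show ?thesis
    using codiff_h first_harmonic_section_eq_iff K_contact_first_harmonic_section_eq by blast
qed

end
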